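(* Let $X$ be a finite dimensional vector space over $\mathbb K=\mathbb R$ or $\mathbb C$, and let $A_\hbar$, $B_\hbar$ be the deformation quantizations of $A=S(X^* )$ and $B=\wedge(X)$ with respect to an $\hbar$-formal quadratic Poisson bivector $\hbar\pi$ on $X$. The homotopy categories $\mathcal H^{tf}_\infty(A_\hbar)$ and $\mathcal H^{tf}_\infty(B_\hbar)$ are triangulated categories, with shift functor $\Sigma=[1]$ (the cohomological grading shift) and with distinguished triangles the triangles isomorphic to those induced by semi-split sequences of strict morphisms.
   Context: **Conventions.** Objects are $\mathbb Z$-bigraded: $M=\{M^i_j\}$ (upper index cohomological, lower internal), $(M[n])^i_j=M^{i+n}_j$; $s:M\to M[1]$ is the suspension of degree $-1$; Koszul signs; $T(V)=\bigoplus_{k\ge0}V^{\otimes k}$ is the tensor coalgebra with deconcatenation. **The algebras.** $A=S(X^* )$ with $A^0_i$ = homogeneous polynomials of degree $i$; $B=\wedge(X)$ with $B^i_{-i}=\wedge^iX$. A bivector $\pi=\sum\pi^{ij}\partial_i\wedge\partial_j$ is quadratic if each $\pi^{ij}$ is a homogeneous quadratic polynomial; $\hbar\pi$ is Poisson if its Schouten--Nijenhuis bracket with itself vanishes. The 2-brane Formality $L_\infty$-quasi-isomorphism $\mathcal U$ of Calaque--Felder--Ferrario--Rossi (Compos. Math. 147 (2011), 105--160), from polyvector fields on $X$ to the Hochschild cochains of the $A_\infty$-category attached to $(A,K,B)$ with $K=\mathbb K$, yields Maurer--Cartan elements $\mathcal U_A(\hbar\pi)\in C^{\bullet+1}(A,A)[[\hbar]]$,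 $\mathcal U_B(\hbar\pi)\in C^{\bullet+1}(B,B)[[\hbar]]$, and $A_\hbar=(A[[\hbar]],\cdot+\mathcal U_A(\hbar\pi))$, $B_\hbar=(B[[\hbar]],\wedge+\mathcal U_B(\hbar\pi))$. For $\pi$ quadratic these are unital associative bigraded $\mathbb K[[\hbar]]$-algebras with zero differential, reducing to $A$, $B$ at $\hbar=0$ (given data for this statement). **Topological $A_\infty$-modules.** A topologically free bigraded $\mathbb K[[\hbar]]$-module is $M_\hbar$ with $(M_\hbar)^i_j=M^i_j[[\hbar]]$; $M[[\hbar]]\tilde\otimes N[[\hbar]]=(M\otimes N)[[\hbar]]$ is the completed tensor product. $A_\hbar$ defines a codifferential $\mathrm d_{A_\hbar}$ on $T(A_\hbar[1])=T(A[1])[[\hbar]]$. A topological right $A_\infty$-$A_\hbar$-module is a topologically free $M_\hbar$ with a $\mathbb K[[\hbar]]$-linear bidegree $(1,0)$ codifferential $\mathrm d_{M_\hbar}=\sum_i\mathrm d^{(i)}_{M_\hbar}\hbar^i$ on the comodule $(M[1]\otimes T(A[1]))[[\hbar]]$, compatible with $\mathrm d_{A_\hbar}$ and with $\mathrm d_{M_\hbar}^2=0$; its Taylor components are $\bar{\mathrm d}^{l}_{M_\hbar}:M_\hbar[1]\tilde\otimes A_\hbar[1]^{\tilde\otimes l}\to M_\hbar[1]$. Morphisms are bidegree $(0,0)$ $\mathbb K[[\hbar]]$-linear comodule maps commuting with codifferentials; strict means only the zeroth Taylor component is nonzero. A homotopy between $f_\hbar,g_\hbar:M_\hbar\to N_\hbar$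 is a bidegree $(-1,0)$ comodule map $H_\hbar$ with $f_\hbar-g_\hbar=\mathrm d_{N_\hbar}H_\hbar+H_\hbar\mathrm d_{M_\hbar}$. Strict unitality: $1$ acts as identity through the binary component and $\bar{\mathrm d}^{l}_{M_\hbar}$, $l\ge2$, vanishes if an algebra argument is $1$; for morphisms and homotopies, components with at least one algebra argument vanish if such an argument is $1$. $\mathbf{Mod}^\infty_{tf}(A_\hbar)$ is the category of strictly unital topological right $A_\infty$-$A_\hbar$-modules and strictly unital morphisms; $\mathcal H^{tf}_\infty(A_\hbar)$ has the same objects and morphisms modulo strictly unital topological homotopy. Same for $B_\hbar$. **Triangles.** $M_\hbar[1]$ has codifferential with components $-s\circ\bar{\mathrm d}^{l}_{M_\hbar}\circ(s^{-1}\otimes1)$. A semi-split sequence is $M_\hbar\xrightarrow{f_\hbar}M'_\hbar\xrightarrow{g_\hbar}M''_\hbar$ with $f_\hbar,g_\hbar$ strict, $0\to M_\hbar\to M'_\hbar\to M''_\hbar\to0$ exact as bigraded $\mathbb K[[\hbar]]$-modules, and a strict bidegree $(0,0)$ $\mathbb K[[\hbar]]$-linear splitting $\rho_\hbar:M'_\hbar[1]\to M_\hbar[1]$, $\rho_\hbar\circ f_\hbar=1$, with $\rho_\hbar\circ\bar{\mathrm d}^{l}_{M'_\hbar}=\bar{\mathrm d}^{l}_{M_\hbar}\circ(\rho_\hbar\tilde\otimes1^{\tilde\otimes l})$ for all $l\ge1$ (not necessarily $l=0$). It induces the triangle $M_\hbar\to M'_\hbar\to M''_\hbar\xrightarrow{h_\hbar}M_\hbar[1]$,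 where $M'_\hbar\cong M_\hbar\tilde\oplus M''_\hbar$ with codifferential $\begin{pmatrix}\mathrm d_{M_\hbar}&-h_\hbar\\0&\mathrm d_{M''_\hbar}\end{pmatrix}$. "Triangulated" includes the octahedral axiom. *)

theory Defs
  imports
    Complex_Main
    "HOL-Library.Poly_Mapping"
    "HOL-Library.Function_Algebras"
    "HOL-Library.Infinite_Typeclass"
    "HOL-Computational_Algebra.Formal_Power_Series"
    "HOL-Algebra.Group"
begin

section \<open>Triangulated categories\<close>

text \<open>
  Composition is indexed by the three objects involved: \<open>Cmp C X Y Z g f\<close> is
  the composite of \<open>f \<in> Hom C X Y\<close> and \<open>g \<in> Hom C Y Z\<close>. Hom-sets need not be disjoint.
\<close>

record ('o, 'm) addcat =
  Obj :: "'o set"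
  Hom :: "'o \<Rightarrow> 'o \<Rightarrow> 'm set"
  Idt :: "'o \<Rightarrow> 'm"
  Cmp :: "'o \<Rightarrow> 'o \<Rightarrow> 'o \<Rightarrow> 'm \<Rightarrow> 'm \<Rightarrow> 'm"
  Add :: "'o \<Rightarrow> 'o \<Rightarrow> 'm \<Rightarrow> 'm \<Rightarrow> 'm"
  Zer :: "'o \<Rightarrow> 'o \<Rightarrow> 'm"

definition hom_group :: "('o, 'm) addcat \<Rightarrow> 'o \<Rightarrow> 'o \<Rightarrow> 'm monoid" where
  "hom_group C X Y = \<lparr>carrier = Hom C X Y, mult = Add C X Y, one = Zer C X Y\<rparr>"

definition Neg :: "('o, 'm) addcat \<Rightarrow> 'o \<Rightarrow> 'o \<Rightarrow> 'm \<Rightarrow> 'm" where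
  "Neg C X Y f = m_inv (hom_group C X Y) f"

definition is_iso :: "('o, 'm) addcat \<Rightarrow> 'o \<Rightarrow> 'o \<Rightarrow> 'm \<Rightarrow> bool" where
  "is_iso C X Y f \<longleftrightarrow> f \<in> Hom C X Y \<and>
     (\<exists>g\<in>Hom C Y X. Cmp C X Y X g f = Idt C X \<and> Cmp C Y X Y f g = Idt C Y)"

definition is_zero_object :: "('o, 'm) addcat \<Rightarrow> 'o \<Rightarrow> bool" where
  "is_zero_object C Z \<longleftrightarrow> Z \<in> Obj C \<and>
     (\<forall>X\<in>Obj C. (\<exists>!f. f \<in> Hom C X Z) \<and> (\<exists>!f. f \<in> Hom C Z X))"

locale additive_category =
  fixes C :: "('o, 'm) addcat"
  assumes Idt_in: "X \<in> Obj C \<Longrightarrow> Idt C X \<in> Hom C X X"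
    and Cmp_in: "\<lbrakk>X \<in> Obj C; Y \<in> Obj C; Z \<in> Obj C; f \<in> Hom C X Y; g \<in> Hom C Y Z\<rbrakk>
          \<Longrightarrow> Cmp C X Y Z g f \<in> Hom C X Z"
    and Cmp_Idt: "\<lbrakk>X \<in> Obj C; Y \<in> Obj C; f \<in> Hom C X Y\<rbrakk> \<Longrightarrow> Cmp C X X Y f (Idt C X) = f"
    and Idt_Cmp: "\<lbrakk>X \<in> Obj C; Y \<in> Obj C; f \<in> Hom C X Y\<rbrakk> \<Longrightarrow> Cmp C X Y Y (Idt C Y) f = f"
    and Cmp_assoc: "\<lbrakk>W \<in> Obj C; X \<in> Obj C; Y \<in> Obj C; Z \<in> Obj C;
            f \<in> Hom C W X; g \<in> Hom C X Y; h \<in> Hom C Y Z\<rbrakk>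
          \<Longrightarrow> Cmp C W Y Z h (Cmp C W X Y g f) = Cmp C W X Z (Cmp C X Y Z h g) f"
    and hom_comm_group: "\<lbrakk>X \<in> Obj C; Y \<in> Obj C\<rbrakk> \<Longrightarrow> comm_group (hom_group C X Y)"
    and Cmp_Add_left: "\<lbrakk>X \<in> Obj C; Y \<in> Obj C; Z \<in> Obj C;
            f \<in> Hom C X Y; g \<in> Hom C Y Z; g' \<in> Hom C Y Z\<rbrakk>
          \<Longrightarrow> Cmp C X Y Z (Add C Y Z g g') f = Add C X Z (Cmp C X Y Z g f) (Cmp C X Y Z g' f)"
    and Cmp_Add_right: "\<lbrakk>X \<in> Obj C; Y \<in> Obj C; Z \<in> Obj C;
            f \<in> Hom C X Y; f' \<in> Hom C X Y; g \<in> Hom C Y Z\<rbrakk>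
          \<Longrightarrow> Cmp C X Y Z g (Add C X Y f f') = Add C X Z (Cmp C X Y Z g f) (Cmp C X Y Z g f')"
    and zero_object: "\<exists>Z. is_zero_object C Z"
    and biproduct: "\<lbrakk>X \<in> Obj C; Y \<in> Obj C\<rbrakk> \<Longrightarrow> \<exists>S\<in>Obj C.
          \<exists>i1\<in>Hom C X S. \<exists>i2\<in>Hom C Y S. \<exists>p1\<in>Hom C S X. \<exists>p2\<in>Hom C S Y.
            Cmp C X S X p1 i1 = Idt C X \<and> Cmp C Y S Y p2 i2 = Idt C Y \<and>
            Cmp C Y S X p1 i2 = Zer C Y X \<and> Cmp C X S Y p2 i1 = Zer C X Y \<and>
            Add C S S (Cmp C S X S i1 p1) (Cmp C S Y S i2 p2) = Idt C S"

text \<open>\<open>(X, Y, Z, u, v, w)\<close> stands for \<open>X \<rightarrow> Y \<rightarrow> Z \<rightarrow> \<Sigma>X\<close> with arrows \<open>u\<close>, \<open>v\<close>, \<open>w\<close>.\<close>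

type_synonym ('o, 'm) triangle = "'o \<times> 'o \<times> 'o \<times> 'm \<times> 'm \<times> 'm"

definition is_triangle :: "('o, 'm) addcat \<Rightarrow> ('o \<Rightarrow> 'o) \<Rightarrow> ('o, 'm) triangle \<Rightarrow> bool" where
  "is_triangle C shO = (\<lambda>(X, Y, Z, u, v, w).
     X \<in> Obj C \<and> Y \<in> Obj C \<and> Z \<in> Obj C \<and>
     u \<in> Hom C X Y \<and> v \<in> Hom C Y Z \<and> w \<in> Hom C Z (shO X))"

definition triangle_mor ::
    "('o, 'm) addcat \<Rightarrow> ('o \<Rightarrow> 'o) \<Rightarrow> ('m \<Rightarrow> 'm) \<Rightarrow> ('o, 'm) triangle \<Rightarrow> ('o, 'm) triangle
       \<Rightarrow> 'm \<Rightarrow> 'm \<Rightarrow> 'm \<Rightarrow> bool" where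
  "triangle_mor C shO shA = (\<lambda>(X, Y, Z, u, v, w) (X', Y', Z', u', v', w') a b c.
     a \<in> Hom C X X' \<and> b \<in> Hom C Y Y' \<and> c \<in> Hom C Z Z' \<and>
     Cmp C X Y Y' b u = Cmp C X X' Y' u' a \<and>
     Cmp C Y Z Z' c v = Cmp C Y Y' Z' v' b \<and>
     Cmp C Z (shO X) (shO X') (shA a) w = Cmp C Z Z' (shO X') w' c)"

definition triangle_iso ::
    "('o, 'm) addcat \<Rightarrow> ('o \<Rightarrow> 'o) \<Rightarrow> ('m \<Rightarrow> 'm) \<Rightarrow> ('o, 'm) triangle \<Rightarrow> ('o, 'm) triangle \<Rightarrow> bool" where
  "triangle_iso C shO shA = (\<lambda>(X, Y, Z, u, v, w) (X', Y', Z', u', v', w').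
     \<exists>a b c. triangle_mor C shO shA (X, Y, Z, u, v, w) (X', Y', Z', u', v', w') a b c \<and>
       is_iso C X X' a \<and> is_iso C Y Y' b \<and> is_iso C Z Z' c)"

text \<open>Verdier's axioms; the shift is required to be an additive automorphism.\<close>

locale triangulated_category = additive_category C
  for C :: "('o, 'm) addcat" +
  fixes shO :: "'o \<Rightarrow> 'o" and shA :: "'m \<Rightarrow> 'm" and Dist :: "('o, 'm) triangle set"
  assumes shO_bij: "bij_betw shO (Obj C) (Obj C)"
    and shA_bij: "\<lbrakk>X \<in> Obj C; Y \<in> Obj C\<rbrakk> \<Longrightarrow> bij_betw shA (Hom C X Y) (Hom C (shO X) (shO Y))"
    and shA_Idt: "X \<in> Obj C \<Longrightarrow> shA (Idt C X) = Idt C (shO X)"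
    and shA_Cmp: "\<lbrakk>X \<in> Obj C; Y \<in> Obj C; Z \<in> Obj C; f \<in> Hom C X Y; g \<in> Hom C Y Z\<rbrakk>
          \<Longrightarrow> shA (Cmp C X Y Z g f) = Cmp C (shO X) (shO Y) (shO Z) (shA g) (shA f)"
    and shA_Add: "\<lbrakk>X \<in> Obj C; Y \<in> Obj C; f \<in> Hom C X Y; f' \<in> Hom C X Y\<rbrakk>
          \<Longrightarrow> shA (Add C X Y f f') = Add C (shO X) (shO Y) (shA f) (shA f')"
    and Dist_triangle: "T \<in> Dist \<Longrightarrow> is_triangle C shO T"
    and TR1_iso: "\<lbrakk>T \<in> Dist; is_triangle C shO T'; triangle_iso C shO shA T T'\<rbrakk> \<Longrightarrow> T' \<in> Dist"
    and TR1_id: "\<lbrakk>X \<in> Obj C; is_zero_object C Z\<rbrakk>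
          \<Longrightarrow> (X, X, Z, Idt C X, Zer C X Z, Zer C Z (shO X)) \<in> Dist"
    and TR1_cone: "\<lbrakk>X \<in> Obj C; Y \<in> Obj C; u \<in> Hom C X Y\<rbrakk> \<Longrightarrow> \<exists>Z v w. (X, Y, Z, u, v, w) \<in> Dist"
    and TR2: "is_triangle C shO (X, Y, Z, u, v, w) \<Longrightarrow>
          (X, Y, Z, u, v, w) \<in> Dist \<longleftrightarrow>
          (Y, Z, shO X, v, w, Neg C (shO X) (shO Y) (shA u)) \<in> Dist"
    and TR3: "\<lbrakk>(X, Y, Z, u, v, w) \<in> Dist; (X', Y', Z', u', v', w') \<in> Dist;
            a \<in> Hom C X X'; b \<in> Hom C Y Y'; Cmp C X Y Y' b u = Cmp C X X' Y' u' a\<rbrakk>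
          \<Longrightarrow> \<exists>c. triangle_mor C shO shA (X, Y, Z, u, v, w) (X', Y', Z', u', v', w') a b c"
    and TR4: "\<lbrakk>(X, Y, Z', u, j, k) \<in> Dist; (Y, Z, X', v, l, i) \<in> Dist;
            (X, Z, Y', Cmp C X Y Z v u, m, n) \<in> Dist\<rbrakk>
          \<Longrightarrow> \<exists>f\<in>Hom C Z' Y'. \<exists>g\<in>Hom C Y' X'.
            (Z', Y', X', f, g, Cmp C X' (shO Y) (shO Z') (shA j) i) \<in> Dist \<and>
            Cmp C Y Z' Y' f j = Cmp C Y Z Y' m v \<and>
            Cmp C Z' Y' (shO X) n f = k \<and>
            Cmp C Z Y' X' g m = l \<and>
            Cmp C Y' X' (shO Y) i g = Cmp C Y' (shO X) (shO Y) (shA u) n"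


section \<open>Formal deformations of bigraded algebras\<close>

text \<open>
  The underlying bigraded vector space has the homogeneous basis \<open>bas\<close>; its elements are the
  finitely supported functions on \<open>bas\<close>. The basis vector \<open>uni\<close> is the unit, \<open>cdeg\<close> and \<open>wdeg\<close>
  are the cohomological and the internal degree. The \<open>\<hbar>\<close>-bilinear product on formal power
  series is \<open>a \<star> b = (\<Sum>n. \<hbar>^n str n a b)\<close>.
\<close>

record (overloaded) ('b, 'k) halg =
  bas :: "'b set"
  cdeg :: "'b \<Rightarrow> int"
  wdeg :: "'b \<Rightarrow> int"
  uni :: "'b"
  str :: "nat \<Rightarrow> ('b \<Rightarrow>\<^sub>0 'k) \<Rightarrow> ('b \<Rightarrow>\<^sub>0 'k) \<Rightarrow> ('b \<Rightarrow>\<^sub>0 'k)"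

definition elems :: "('b, 'k::zero) halg \<Rightarrow> ('b \<Rightarrow>\<^sub>0 'k) set" where
  "elems A = {p. Poly_Mapping.keys p \<subseteq> bas A}"

abbreviation bvec :: "'b \<Rightarrow> 'b \<Rightarrow>\<^sub>0 'k::zero_neq_one" where
  "bvec b \<equiv> Poly_Mapping.single b 1"

definition hbar_algebra :: "('b, 'k::field) halg \<Rightarrow> bool" where
  "hbar_algebra A \<longleftrightarrow>
     uni A \<in> bas A \<and>
     (\<forall>n. \<forall>p\<in>elems A. \<forall>q\<in>elems A. str A n p q \<in> elems A) \<and>
     (\<forall>n. \<forall>p\<in>elems A. \<forall>q\<in>elems A. \<forall>r\<in>elems A.
        str A n (p + q) r = str A n p r + str A n q r \<and>
        str A n p (q + r) = str A n p q + str A n p r) \<and>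
     (\<forall>n c. \<forall>p\<in>elems A. \<forall>q\<in>elems A.
        str A n (Poly_Mapping.map ((*) c) p) q = Poly_Mapping.map ((*) c) (str A n p q) \<and>
        str A n p (Poly_Mapping.map ((*) c) q) = Poly_Mapping.map ((*) c) (str A n p q)) \<and>
     (\<forall>n. \<forall>a\<in>bas A. \<forall>b\<in>bas A. \<forall>e\<in>Poly_Mapping.keys (str A n (bvec a) (bvec b)).
        cdeg A e = cdeg A a + cdeg A b \<and> wdeg A e = wdeg A a + wdeg A b) \<and>
     (\<forall>n. \<forall>p\<in>elems A. \<forall>q\<in>elems A. \<forall>r\<in>elems A.
        (\<Sum>k\<le>n. str A k (str A (n - k) p q) r) = (\<Sum>k\<le>n. str A k p (str A (n - k) q r))) \<and>
     (\<forall>n. \<forall>p\<in>elems A. str A n (bvec (uni A)) p = (if n = 0 then p else 0) \<and>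
        str A n p (bvec (uni A)) = (if n = 0 then p else 0))"


section \<open>The quantizations of the symmetric and the exterior algebra\<close>

text \<open>
  \<open>X\<close> is a \<open>d\<close>-dimensional vector space with coordinates \<open>x_0, \<dots>, x_{d-1}\<close>. Polynomials are
  finitely supported functions on exponent vectors \<open>nat \<Rightarrow>\<^sub>0 nat\<close>.
  The scalars will be of class \<open>real_normed_field\<close>: up to isomorphism of \<open>\<real>\<close>-algebras the
  fields of this class are exactly the real and the complex numbers (Gelfand--Mazur).
\<close>

type_synonym 'k mpol = "(nat \<Rightarrow>\<^sub>0 nat) \<Rightarrow>\<^sub>0 'k"

definition monomials :: "nat \<Rightarrow> (nat \<Rightarrow>\<^sub>0 nat) set" where
  "monomials d = {m. Poly_Mapping.keys m \<subseteq> {..<d}}"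

definition mon_deg :: "(nat \<Rightarrow>\<^sub>0 nat) \<Rightarrow> nat" where
  "mon_deg m = (\<Sum>i\<in>Poly_Mapping.keys m. Poly_Mapping.lookup m i)"

definition coord :: "nat \<Rightarrow> 'k::zero_neq_one mpol" where
  "coord i = bvec (Poly_Mapping.single i 1)"

definition partial :: "nat \<Rightarrow> 'k::field mpol \<Rightarrow> 'k mpol" where
  "partial l p = (\<Sum>m\<in>Poly_Mapping.keys p.
     Poly_Mapping.single (m - Poly_Mapping.single l 1) (of_nat (Poly_Mapping.lookup m l) * Poly_Mapping.lookup p m))"

text \<open>The bivector \<open>\<Sum>i j. P i j \<partial>_i \<and> \<partial>_j\<close>, with coefficients normalized to be antisymmetric.\<close>

definition quadratic_bivector :: "nat \<Rightarrow> (nat \<Rightarrow> nat \<Rightarrow> 'k::field mpol) \<Rightarrow> bool" where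
  "quadratic_bivector d P \<longleftrightarrow>
     (\<forall>i<d. \<forall>j<d. P j i = - P i j \<and>
        (\<forall>m\<in>Poly_Mapping.keys (P i j). m \<in> monomials d \<and> mon_deg m = 2))"

text \<open>The component at \<open>\<partial>_i \<and> \<partial>_j \<and> \<partial>_k\<close> of the Schouten--Nijenhuis square, up to a nonzero scalar.\<close>

definition schouten_square ::
    "nat \<Rightarrow> (nat \<Rightarrow> nat \<Rightarrow> 'k::field mpol) \<Rightarrow> nat \<Rightarrow> nat \<Rightarrow> nat \<Rightarrow> 'k mpol" where
  "schouten_square d P i j k = (\<Sum>l<d.
     P i l * partial l (P j k) + P j l * partial l (P k i) + P k l * partial l (P i j))"

definition poisson_bivector :: "nat \<Rightarrow> (nat \<Rightarrow> nat \<Rightarrow> 'k::field mpol) \<Rightarrow> bool" where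
  "poisson_bivector d P \<longleftrightarrow> (\<forall>i<d. \<forall>j<d. \<forall>k<d. schouten_square d P i j k = 0)"

text \<open>
  \<open>U n\<close>, for \<open>n \<ge> 1\<close>, is the coefficient of \<open>\<hbar>^n\<close> in the Maurer--Cartan element that deforms
  the classical product; the value \<open>U 0\<close> plays no role.
\<close>

definition sym_quant ::
    "nat \<Rightarrow> (nat \<Rightarrow> 'k::field mpol \<Rightarrow> 'k mpol \<Rightarrow> 'k mpol) \<Rightarrow> (nat \<Rightarrow>\<^sub>0 nat, 'k) halg" where
  "sym_quant d U = \<lparr>bas = monomials d, cdeg = (\<lambda>_. 0), wdeg = (\<lambda>m. int (mon_deg m)), uni = 0,
     str = (\<lambda>n p q. if n = 0 then p * q else U n p q)\<rparr>"

definition ksgn :: "int \<Rightarrow> 'k::ring_1" where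
  "ksgn i = (if even i then 1 else - 1)"

text \<open>
  The exterior algebra has as basis the subsets of \<open>{..<d}\<close>: \<open>{i_1 < \<dots> < i_r}\<close> stands for
  \<open>e_{i_1} \<and> \<dots> \<and> e_{i_r}\<close>, of bidegree \<open>(r, -r)\<close>.
\<close>

definition wedge :: "(nat set \<Rightarrow>\<^sub>0 'k::field) \<Rightarrow> (nat set \<Rightarrow>\<^sub>0 'k) \<Rightarrow> (nat set \<Rightarrow>\<^sub>0 'k)" where
  "wedge p q = (\<Sum>S\<in>Poly_Mapping.keys p. \<Sum>T\<in>Poly_Mapping.keys q.
     if S \<inter> T = {}
     then Poly_Mapping.single (S \<union> T)
            (ksgn (int (card {(s, t). s \<in> S \<and> t \<in> T \<and> t < s})) * Poly_Mapping.lookup p S * Poly_Mapping.lookup q T)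
     else 0)"

definition ext_quant ::
    "nat \<Rightarrow> (nat \<Rightarrow> (nat set \<Rightarrow>\<^sub>0 'k::field) \<Rightarrow> (nat set \<Rightarrow>\<^sub>0 'k) \<Rightarrow> (nat set \<Rightarrow>\<^sub>0 'k))
       \<Rightarrow> (nat set, 'k) halg" where
  "ext_quant d U = \<lparr>bas = Pow {..<d}, cdeg = (\<lambda>S. int (card S)), wdeg = (\<lambda>S. - int (card S)),
     uni = {}, str = (\<lambda>n p q. if n = 0 then wedge p q else U n p q)\<rparr>"

text \<open>
  The Maurer--Cartan elements quantize the bivector: up to a normalization constant, the
  \<open>\<hbar>\<close>-linear part of the graded commutator of two generators is the bracket defined by \<open>P\<close>.
  On the exterior side a quadratic \<open>P\<close> is read as a quadratic bivector on the odd dual space,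
  with brackets \<open>{e_k, e_l} = (\<Sum>i j. (\<partial>_k \<partial>_l P i j) e_i \<and> e_j)\<close>, where the second
  derivatives are constants.
\<close>

definition sym_quantizes ::
    "nat \<Rightarrow> (nat \<Rightarrow> nat \<Rightarrow> 'k::field mpol) \<Rightarrow> (nat \<Rightarrow> 'k mpol \<Rightarrow> 'k mpol \<Rightarrow> 'k mpol) \<Rightarrow> bool" where
  "sym_quantizes d P U \<longleftrightarrow> (\<exists>c. c \<noteq> 0 \<and> (\<forall>i<d. \<forall>j<d.
     U 1 (coord i) (coord j) - U 1 (coord j) (coord i) = Poly_Mapping.map ((*) c) (P i j)))"

definition ext_quantizes ::
    "nat \<Rightarrow> (nat \<Rightarrow> nat \<Rightarrow> 'k::field mpol)
       \<Rightarrow> (nat \<Rightarrow> (nat set \<Rightarrow>\<^sub>0 'k) \<Rightarrow> (nat set \<Rightarrow>\<^sub>0 'k) \<Rightarrow> (nat set \<Rightarrow>\<^sub>0 'k)) \<Rightarrow> bool" where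
  "ext_quantizes d P U \<longleftrightarrow> (\<exists>c. c \<noteq> 0 \<and> (\<forall>k<d. \<forall>l<d.
     U 1 (bvec {k}) (bvec {l}) + U 1 (bvec {l}) (bvec {k}) =
     (\<Sum>i<d. \<Sum>j<d. Poly_Mapping.map ((*) (c * Poly_Mapping.lookup (partial k (partial l (P i j))) 0))
        (wedge (bvec {i}) (bvec {j})))))"


section \<open>The bar codifferential of the algebra\<close>

definition word_cdeg :: "('b, 'k::zero) halg \<Rightarrow> 'b list \<Rightarrow> int" where
  "word_cdeg A w = (\<Sum>b\<leftarrow>w. cdeg A b - 1)"

definition word_wdeg :: "('b, 'k::zero) halg \<Rightarrow> 'b list \<Rightarrow> int" where
  "word_wdeg A w = (\<Sum>b\<leftarrow>w. wdeg A b)"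

text \<open>
  The tensor coalgebra of \<open>A[1]\<close> has as basis the words in \<open>bas A\<close>. The coefficient of
  \<open>\<hbar>^n v\<close> in the codifferential of the word \<open>w\<close> is \<open>bar_coeff A n w v\<close>. The only Taylor
  component is \<open>sa \<otimes> sb \<mapsto> (-1)^|a| s(a \<star> b)\<close>, that is \<open>s \<circ> \<star> \<circ> (s \<otimes> s)\<inverse>\<close>.
\<close>

definition bar_coeff :: "('b, 'k::field) halg \<Rightarrow> nat \<Rightarrow> 'b list \<Rightarrow> 'b list \<Rightarrow> 'k" where
  "bar_coeff A n w v = (\<Sum>i | Suc i < length w.
     if length w = Suc (length v) \<and> take i v = take i w \<and> drop (Suc i) v = drop (Suc (Suc i)) w
     then ksgn (word_cdeg A (take i w) + cdeg A (w ! i)) *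
          Poly_Mapping.lookup (str A n (bvec (w ! i)) (bvec (w ! Suc i))) (v ! i)
     else 0)"


section \<open>Topological A-infinity modules\<close>

text \<open>
  An element of \<open>(M[1] \<otimes> T(A[1]))[[\<hbar>]]\<close> is a sequence (the powers of \<open>\<hbar>\<close>) of finitely
  supported functions from words in \<open>bas A\<close> to \<open>M\<close>. The homogeneous components of \<open>M\<close> are
  subspaces of the vector space \<open>'s \<Rightarrow> 'k\<close>. The type \<open>'s\<close> is a universe bounding the size
  of the modules considered (every vector space with a basis of at most the size of \<open>'s\<close>
  embeds); the subspaces \<open>spc M i j\<close> for different \<open>(i, j)\<close> are unrelated.
\<close>

type_synonym ('b, 's, 'k) hcofree = "nat \<Rightarrow> 'b list \<Rightarrow> 's \<Rightarrow> 'k"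

text \<open>A bigraded map is the family of its components on each bidegree \<open>(i, j)\<close> of the source.\<close>

type_synonym ('b, 's, 'k) hmap =
  "int \<Rightarrow> int \<Rightarrow> ('b, 's, 'k) hcofree \<Rightarrow> ('b, 's, 'k) hcofree"

record ('b, 's, 'k) hmod =
  spc :: "int \<Rightarrow> int \<Rightarrow> ('s \<Rightarrow> 'k) set"
  dif :: "('b, 's, 'k) hmap"

definition vscale :: "'k::field \<Rightarrow> ('s \<Rightarrow> 'k) \<Rightarrow> 's \<Rightarrow> 'k" where
  "vscale c x = (\<lambda>s. c * x s)"

definition hscale :: "'k::field fps \<Rightarrow> ('b, 's, 'k) hcofree \<Rightarrow> ('b, 's, 'k) hcofree" where
  "hscale c F = (\<lambda>n w. \<Sum>k\<le>n. vscale (fps_nth c k) (F (n - k) w))"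

definition is_subspace :: "('s \<Rightarrow> 'k::field) set \<Rightarrow> bool" where
  "is_subspace V \<longleftrightarrow> 0 \<in> V \<and> (\<forall>x\<in>V. \<forall>y\<in>V. x + y \<in> V) \<and> (\<forall>c. \<forall>x\<in>V. vscale c x \<in> V)"

text \<open>The component \<open>M^i_j[[\<hbar>]]\<close> of the topologically free module.\<close>

definition hspc :: "('b, 's, 'k) hmod \<Rightarrow> int \<Rightarrow> int \<Rightarrow> (nat \<Rightarrow> 's \<Rightarrow> 'k) set" where
  "hspc M i j = {m. \<forall>n. m n \<in> spc M i j}"

text \<open>
  The component of bidegree \<open>(i, j)\<close> of \<open>(M[1] \<otimes> T(A[1]))[[\<hbar>]]\<close>. The coefficient at a word
  \<open>w\<close> lies in \<open>M[1]\<close> in cohomological degree \<open>i - |w|\<close>, hence the summand \<open>1\<close>.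
\<close>

definition comod ::
    "('b, 'k::field) halg \<Rightarrow> ('b, 's, 'k) hmod \<Rightarrow> int \<Rightarrow> int \<Rightarrow> ('b, 's, 'k) hcofree set" where
  "comod A M i j = {F. \<forall>n. finite {w. F n w \<noteq> 0} \<and>
     (\<forall>w. if w \<in> lists (bas A)
          then F n w \<in> spc M (i + 1 - word_cdeg A w) (j - word_wdeg A w)
          else F n w = 0)}"

text \<open>
  \<open>coact v F\<close> is the coefficient of the word \<open>v\<close> in the coaction (deconcatenation)
  \<open>\<Delta>F \<in> (M[1] \<otimes> T(A[1])) \<otimes> T(A[1])\<close>.
\<close>

definition coact :: "'b list \<Rightarrow> ('b, 's, 'k) hcofree \<Rightarrow> ('b, 's, 'k) hcofree" where
  "coact v F = (\<lambda>n u. F n (u @ v))"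

text \<open>
  The coefficient of \<open>\<hbar>^n u \<otimes> v\<close> in \<open>(1 \<otimes> d_A) (\<Delta>F)\<close> for \<open>F\<close> of cohomological degree \<open>i\<close>;
  the Koszul sign arises from moving \<open>d_A\<close> past the left tensor factor, of degree
  \<open>i - |v'|\<close>.
\<close>

definition id_bar ::
    "('b, 'k::field) halg \<Rightarrow> int \<Rightarrow> ('b, 's, 'k) hcofree \<Rightarrow> nat \<Rightarrow> 'b list \<Rightarrow> 'b list \<Rightarrow> 's \<Rightarrow> 'k" where
  "id_bar A i F n u v = (\<Sum>k\<le>n. \<Sum>v' | F (n - k) (u @ v') \<noteq> 0.
     vscale (ksgn (i - word_cdeg A v') * bar_coeff A k v' v) (F (n - k) (u @ v')))"

definition hlinear ::
    "('b, 'k::field) halg \<Rightarrow> ('b, 's, 'k) hmod \<Rightarrow> ('b, 's, 'k) hmod \<Rightarrow> int \<Rightarrow> ('b, 's, 'k) hmap \<Rightarrow> bool" where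
  "hlinear A M N r f \<longleftrightarrow> (\<forall>i j. \<forall>F\<in>comod A M i j.
     f i j F \<in> comod A N (i + r) j \<and>
     (\<forall>G\<in>comod A M i j. f i j (F + G) = f i j F + f i j G) \<and>
     (\<forall>c. f i j (hscale c F) = hscale c (f i j F)))"

text \<open>Comodule maps of bidegree \<open>(r, 0)\<close>: \<open>\<Delta> \<circ> f = (f \<otimes> 1) \<circ> \<Delta>\<close>.\<close>

definition comodule_map ::
    "('b, 'k::field) halg \<Rightarrow> ('b, 's, 'k) hmod \<Rightarrow> ('b, 's, 'k) hmod \<Rightarrow> int \<Rightarrow> ('b, 's, 'k) hmap \<Rightarrow> bool" where
  "comodule_map A M N r f \<longleftrightarrow> hlinear A M N r f \<and>
     (\<forall>i j. \<forall>F\<in>comod A M i j. \<forall>v\<in>lists (bas A).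
        coact v (f i j F) = f (i - word_cdeg A v) (j - word_wdeg A v) (coact v F))"

text \<open>Codifferentials: \<open>\<Delta> \<circ> d = (d \<otimes> 1 + 1 \<otimes> d_A) \<circ> \<Delta>\<close> and \<open>d \<circ> d = 0\<close>.\<close>

definition codifferential :: "('b, 'k::field) halg \<Rightarrow> ('b, 's, 'k) hmod \<Rightarrow> bool" where
  "codifferential A M \<longleftrightarrow> hlinear A M M 1 (dif M) \<and>
     (\<forall>i j. \<forall>F\<in>comod A M i j. \<forall>v\<in>lists (bas A).
        coact v (dif M i j F) =
          dif M (i - word_cdeg A v) (j - word_wdeg A v) (coact v F) + (\<lambda>n u. id_bar A i F n u v)) \<and>
     (\<forall>i j. \<forall>F\<in>comod A M i j. dif M (i + 1) j (dif M i j F) = 0)"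

text \<open>
  The corestriction to \<open>M[1]\<close> of a map \<open>f\<close> is the coefficient of \<open>f i j F\<close> at the empty word;
  its restriction to elements supported on words of length \<open>l\<close> is the \<open>l\<close>-th Taylor component.
\<close>

definition corestr :: "('b, 's, 'k) hcofree \<Rightarrow> nat \<Rightarrow> 's \<Rightarrow> 'k" where
  "corestr F = (\<lambda>n. F n [])"

definition of_length :: "nat \<Rightarrow> ('b, 's, 'k::zero) hcofree set" where
  "of_length l = {F. \<forall>n w. F n w \<noteq> 0 \<longrightarrow> length w = l}"

definition with_unit :: "('b, 'k::zero) halg \<Rightarrow> ('b, 's, 'k::zero) hcofree set" where
  "with_unit A = {F. \<forall>n w. F n w \<noteq> 0 \<longrightarrow> uni A \<in> set w}"

text \<open>The element \<open>sm \<otimes> w\<close>.\<close>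

definition pure :: "(nat \<Rightarrow> 's \<Rightarrow> 'k::zero) \<Rightarrow> 'b list \<Rightarrow> ('b, 's, 'k) hcofree" where
  "pure m w = (\<lambda>n w'. if w' = w then m n else 0)"

text \<open>
  Strict unitality. With the sign convention used for the algebra, the binary product
  \<open>m \<cdot> a\<close> is given by \<open>sm \<otimes> sa \<mapsto> (-1)^|m| s(m \<cdot> a)\<close>, and \<open>sm \<otimes> s1\<close> has bidegree \<open>(p - 2, q)\<close>
  for \<open>m\<close> of bidegree \<open>(p, q)\<close>.
\<close>

definition unital_module :: "('b, 'k::field) halg \<Rightarrow> ('b, 's, 'k) hmod \<Rightarrow> bool" where
  "unital_module A M \<longleftrightarrow>
     (\<forall>p q. \<forall>m\<in>hspc M p q.
        corestr (dif M (p - 2) q (pure m [uni A])) = (\<lambda>n. vscale (ksgn p) (m n))) \<and>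
     (\<forall>l\<ge>2. \<forall>i j. \<forall>F\<in>comod A M i j \<inter> of_length l \<inter> with_unit A. corestr (dif M i j F) = 0)"

definition unital_map :: "('b, 'k::field) halg \<Rightarrow> ('b, 's, 'k) hmod \<Rightarrow> ('b, 's, 'k) hmap \<Rightarrow> bool" where
  "unital_map A M f \<longleftrightarrow>
     (\<forall>l\<ge>1. \<forall>i j. \<forall>F\<in>comod A M i j \<inter> of_length l \<inter> with_unit A. corestr (f i j F) = 0)"

definition strict_map :: "('b, 'k::field) halg \<Rightarrow> ('b, 's, 'k) hmod \<Rightarrow> ('b, 's, 'k) hmap \<Rightarrow> bool" where
  "strict_map A M f \<longleftrightarrow>
     (\<forall>l\<ge>1. \<forall>i j. \<forall>F\<in>comod A M i j \<inter> of_length l. corestr (f i j F) = 0)"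

text \<open>Objects and morphisms of the category of strictly unital topological modules.\<close>

definition tf_modules :: "('b, 'k::field) halg \<Rightarrow> ('b, 's, 'k) hmod set" where
  "tf_modules A = {M. (\<forall>i j. is_subspace (spc M i j)) \<and> codifferential A M \<and> unital_module A M}"

definition tf_morphisms ::
    "('b, 'k::field) halg \<Rightarrow> ('b, 's, 'k) hmod \<Rightarrow> ('b, 's, 'k) hmod \<Rightarrow> ('b, 's, 'k) hmap set" where
  "tf_morphisms A M N = {f. comodule_map A M N 0 f \<and> unital_map A M f \<and>
     (\<forall>i j. \<forall>F\<in>comod A M i j. f (i + 1) j (dif M i j F) = dif N i j (f i j F))}"

definition hcomp :: "('b, 's, 'k) hmap \<Rightarrow> ('b, 's, 'k) hmap \<Rightarrow> ('b, 's, 'k) hmap" where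
  "hcomp g f = (\<lambda>i j F. g i j (f i j F))"

definition homotopic ::
    "('b, 'k::field) halg \<Rightarrow> ('b, 's, 'k) hmod \<Rightarrow> ('b, 's, 'k) hmod
       \<Rightarrow> ('b, 's, 'k) hmap \<Rightarrow> ('b, 's, 'k) hmap \<Rightarrow> bool" where
  "homotopic A M N f g \<longleftrightarrow> (\<exists>H. comodule_map A M N (- 1) H \<and> unital_map A M H \<and>
     (\<forall>i j. \<forall>F\<in>comod A M i j.
        f i j F - g i j F = dif N (i - 1) j (H i j F) + H (i + 1) j (dif M i j F)))"


section \<open>The homotopy category and its triangles\<close>

definition hclass ::
    "('b, 'k::field) halg \<Rightarrow> ('b, 's, 'k) hmod \<Rightarrow> ('b, 's, 'k) hmod
       \<Rightarrow> ('b, 's, 'k) hmap \<Rightarrow> ('b, 's, 'k) hmap set" where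
  "hclass A M N f = {g \<in> tf_morphisms A M N. homotopic A M N f g}"

text \<open>
  Arrows are homotopy classes. Two maps that differ only outside the source comodule
  are homotopic, so the values there are immaterial.
\<close>

definition Htf :: "('b, 'k::field) halg \<Rightarrow> (('b, 's, 'k) hmod, ('b, 's, 'k) hmap set) addcat" where
  "Htf A = \<lparr>Obj = tf_modules A,
     Hom = (\<lambda>M N. hclass A M N ` tf_morphisms A M N),
     Idt = (\<lambda>M. hclass A M M (\<lambda>i j F. F)),
     Cmp = (\<lambda>M N P G F. \<Union>g\<in>G. \<Union>f\<in>F. hclass A M P (hcomp g f)),
     Add = (\<lambda>M N F G. \<Union>f\<in>F. \<Union>g\<in>G. hclass A M N (f + g)),
     Zer = (\<lambda>M N. hclass A M N 0)\<rparr>"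

text \<open>
  In \<open>M[1]\<close> the suspension is the identity on elements, so that the codifferential with
  Taylor components \<open>-s \<circ> d \<circ> (s\<inverse> \<otimes> 1)\<close> is the negative of the reindexed one: the sign in
  front of \<open>1 \<otimes> d_A\<close> changes as well because the degree of the module element drops by one.
\<close>

definition shift_mod :: "('b, 's, 'k::ab_group_add) hmod \<Rightarrow> ('b, 's, 'k) hmod" where
  "shift_mod M = \<lparr>spc = (\<lambda>i j. spc M (i + 1) j), dif = (\<lambda>i j F. - dif M (i + 1) j F)\<rparr>"

definition shift_map :: "('b, 's, 'k) hmap \<Rightarrow> ('b, 's, 'k) hmap" where
  "shift_map f = (\<lambda>i j. f (i + 1) j)"

definition shift_arr :: "('b, 's, 'k) hmap set \<Rightarrow> ('b, 's, 'k) hmap set" where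
  "shift_arr F = shift_map ` F"

text \<open>The \<open>0\<close>-th Taylor component of \<open>f\<close>, as a map on \<open>M^p_q[[\<hbar>]]\<close>.\<close>

definition zeroth ::
    "('b, 's, 'k::zero) hmap \<Rightarrow> int \<Rightarrow> int \<Rightarrow> (nat \<Rightarrow> 's \<Rightarrow> 'k) \<Rightarrow> nat \<Rightarrow> 's \<Rightarrow> 'k" where
  "zeroth f p q m = corestr (f (p - 1) q (pure m []))"

text \<open>Semi-split sequences \<open>L \<rightarrow> M \<rightarrow> N\<close> with splitting \<open>\<rho>\<close>; the latter need not be a morphism.\<close>

definition semi_split ::
    "('b, 'k::field) halg \<Rightarrow> ('b, 's, 'k) hmod \<Rightarrow> ('b, 's, 'k) hmod \<Rightarrow> ('b, 's, 'k) hmod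
       \<Rightarrow> ('b, 's, 'k) hmap \<Rightarrow> ('b, 's, 'k) hmap \<Rightarrow> ('b, 's, 'k) hmap \<Rightarrow> bool" where
  "semi_split A L M N f g \<rho> \<longleftrightarrow>
     L \<in> tf_modules A \<and> M \<in> tf_modules A \<and> N \<in> tf_modules A \<and>
     f \<in> tf_morphisms A L M \<and> strict_map A L f \<and>
     g \<in> tf_morphisms A M N \<and> strict_map A M g \<and>
     (\<forall>p q. inj_on (zeroth f p q) (hspc L p q) \<and>
        zeroth f p q ` hspc L p q = {m \<in> hspc M p q. zeroth g p q m = 0} \<and>
        zeroth g p q ` hspc M p q = hspc N p q) \<and>
     comodule_map A M L 0 \<rho> \<and> strict_map A M \<rho> \<and>
     (\<forall>i j. \<forall>F\<in>comod A L i j. \<rho> i j (f i j F) = F) \<and>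
     (\<forall>l\<ge>1. \<forall>i j. \<forall>F\<in>comod A M i j \<inter> of_length l.
        corestr (\<rho> (i + 1) j (dif M i j F)) = corestr (dif L i j (\<rho> i j F)))"

text \<open>
  Under \<open>(\<rho>, g): M \<cong> L \<oplus> N\<close> the codifferential of \<open>M\<close> becomes the upper triangular matrix with
  diagonal entries \<open>d_L\<close>, \<open>d_N\<close> and off-diagonal entry \<open>-h\<close>. The second row of this
  identity says that \<open>g\<close> is a morphism; the first row determines \<open>h : N \<rightarrow> L[1]\<close>, the component
  of \<open>L[1]\<close> in degree \<open>i\<close> being that of \<open>L\<close> in degree \<open>i + 1\<close>.
\<close>

definition connecting_map ::
    "('b, 'k::field) halg \<Rightarrow> ('b, 's, 'k) hmod \<Rightarrow> ('b, 's, 'k) hmod \<Rightarrow> ('b, 's, 'k) hmod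
       \<Rightarrow> ('b, 's, 'k) hmap \<Rightarrow> ('b, 's, 'k) hmap \<Rightarrow> ('b, 's, 'k) hmap \<Rightarrow> bool" where
  "connecting_map A L M N g \<rho> h \<longleftrightarrow> h \<in> tf_morphisms A N (shift_mod L) \<and>
     (\<forall>i j. \<forall>F\<in>comod A M i j.
        \<rho> (i + 1) j (dif M i j F) = dif L i j (\<rho> i j F) - h i j (g i j F))"

definition semi_split_triangles ::
    "('b, 'k::field) halg \<Rightarrow> (('b, 's, 'k) hmod, ('b, 's, 'k) hmap set) triangle set" where
  "semi_split_triangles A =
     {(L, M, N, hclass A L M f, hclass A M N g, hclass A N (shift_mod L) h) | L M N f g h.
        \<exists>\<rho>. semi_split A L M N f g \<rho> \<and> connecting_map A L M N g \<rho> h}"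

definition distinguished ::
    "('b, 'k::field) halg \<Rightarrow> (('b, 's, 'k) hmod, ('b, 's, 'k) hmap set) triangle set" where
  "distinguished A = {T. is_triangle (Htf A) shift_mod T \<and>
     (\<exists>T'\<in>semi_split_triangles A. triangle_iso (Htf A) shift_mod shift_arr T T')}"

end

theory Submission
  imports Defs
begin

text \<open>
  Strictly unital topological \<open>A\<^sub>\<infinity>\<close>-modules form a dg category with shift and cones, and the homotopy
  category of such a dg category is triangulated by the triangles \<open>X \<rightarrow> Y \<rightarrow> C(u) \<rightarrow> X[1]\<close>.
  The point specific to modules is that the splitting of a semi-split sequence respects all
  higher Taylor components, so that its connecting map is strict: semi-split triangles are exactly the
  rotated cone triangles \<open>Y \<rightarrow> C(u) \<rightarrow> X[1] \<rightarrow> Y[1]\<close> of strict morphisms \<open>u\<close>. Nevertheless, they give all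
  cone triangles up to isomorphism: for an arbitrary \<open>u: X \<rightarrow> Y\<close>, the projection \<open>C(u) \<rightarrow> X[1]\<close> is
  strict, and the cone on its desuspension is the mapping cylinder of \<open>u\<close>, which is homotopy
  equivalent to \<open>Y\<close>.
\<close>


text \<open>Verdier's axioms are easiest for cone triangles, whereas the definition speaks of
  semi-split ones. So the two classes are first shown to agree up to isomorphism. In one direction
  the splitting of a semi-split sequence as graded comodules exhibits its middle term as a cone.
  Every axiom is then a computation with matrices over chosen cones. Their entries are maps between
  different modules, placed in one noncommutative ring so that identities between them can be
  checked by oriented rewriting. Two obstacles come from the modules. Direct sums must be encoded in
  the fixed universe \<open>'s\<close>, which is possible because \<open>'s\<close> is infinite. And
  topological freeness makes elements infinite sums over powers of \<hbar> with no common bound on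
  the word length, so statements about Taylor components pass to all elements by \<hbar>-adic
  continuity, which follows from linearity over power series.\<close>

section \<open>Isomorphisms in additive categories\<close>

text \<open>Right-nested products hide the redex \<open>a * b\<close> inside
  \<open>a * (b * x)\<close>. This form of an equation lets it fire there, so that a set of product
  rules together with \<open>mult.assoc\<close> rewrites inside longer words.\<close>

lemma assoc_rule: "a * b = c \<Longrightarrow> a * (b * x) = c * (x :: 'r::semigroup_mult)"
  by (metis mult.assoc)

context additive_category
begin

lemma is_iso_Hom: "is_iso C X Y f \<Longrightarrow> f \<in> Hom C X Y"
  by (simp add: is_iso_def)

lemma is_isoE:
  assumes "is_iso C X Y f"
  obtains g where "g \<in> Hom C Y X" "Cmp C X Y X g f = Idt C X" "Cmp C Y X Y f g = Idt C Y"
    "is_iso C Y X g"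
  using assms unfolding is_iso_def by blast

lemma is_iso_Idt: "X \<in> Obj C \<Longrightarrow> is_iso C X X (Idt C X)"
  unfolding is_iso_def using Idt_in Cmp_Idt by blast

lemma is_iso_Cmp:
  assumes ob: "X \<in> Obj C" "Y \<in> Obj C" "Z \<in> Obj C"
    and f: "is_iso C X Y f" and g: "is_iso C Y Z g"
  shows "is_iso C X Z (Cmp C X Y Z g f)"
proof -
  obtain f' where f': "f' \<in> Hom C Y X" "Cmp C X Y X f' f = Idt C X" "Cmp C Y X Y f f' = Idt C Y"
    using is_isoE[OF f] by blast
  obtain g' where g': "g' \<in> Hom C Z Y" "Cmp C Y Z Y g' g = Idt C Y" "Cmp C Z Y Z g g' = Idt C Z"
    using is_isoE[OF g] by blast
  note fH = is_iso_Hom[OF f] and gH = is_iso_Hom[OF g]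
  have "Cmp C X Z X (Cmp C Z Y X f' g') (Cmp C X Y Z g f) = Cmp C X Y X f' (Cmp C X Y Y (Cmp C Y Z Y g' g) f)"
    using ob fH gH f' g' by (metis Cmp_assoc Cmp_in)
  also have "\<dots> = Idt C X"
    using ob fH f' g' by (simp add: Idt_Cmp)
  finally have 1: "Cmp C X Z X (Cmp C Z Y X f' g') (Cmp C X Y Z g f) = Idt C X" .
  have "Cmp C Z X Z (Cmp C X Y Z g f) (Cmp C Z Y X f' g') = Cmp C Z Y Z g (Cmp C Z Y Y (Cmp C Y X Y f f') g')"
    using ob fH gH f' g' by (metis Cmp_assoc Cmp_in)
  also have "\<dots> = Idt C Z"
    using ob f' g' by (simp add: Idt_Cmp)
  finally show ?thesis
    unfolding is_iso_def using 1 ob fH gH f'(1) g'(1) Cmp_in by blast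
qed

text \<open>Inverses \<open>a\<close> of \<open>g f\<close> and \<open>b\<close> of
  \<open>f g\<close> give the left inverse \<open>a g\<close> and the right inverse
  \<open>g b\<close> of \<open>f\<close>, and these coincide. It serves where \<open>g\<close>
  inverts \<open>f\<close> only up to isomorphism.\<close>

lemma iso_sandwich:
  assumes ob: "X \<in> Obj C" "Y \<in> Obj C" and f: "f \<in> Hom C X Y" and g: "g \<in> Hom C Y X"
    and gf: "is_iso C X X (Cmp C X Y X g f)" and fg: "is_iso C Y Y (Cmp C Y X Y f g)"
  shows "is_iso C X Y f"
proof -
  obtain a where a: "a \<in> Hom C X X" "Cmp C X X X a (Cmp C X Y X g f) = Idt C X"
    using is_isoE[OF gf] by blast
  obtain b where b: "b \<in> Hom C Y Y" "Cmp C Y Y Y (Cmp C Y X Y f g) b = Idt C Y"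
    using is_isoE[OF fg] by blast
  define l where "l = Cmp C Y X X a g"
  define r where "r = Cmp C Y Y X g b"
  have l: "l \<in> Hom C Y X" and r: "r \<in> Hom C Y X"
    unfolding l_def r_def using ob a b g Cmp_in by blast+
  have lf: "Cmp C X Y X l f = Idt C X"
    unfolding l_def using a ob f g by (metis Cmp_assoc)
  have fr: "Cmp C Y X Y f r = Idt C Y"
    unfolding r_def using b ob f g by (metis Cmp_assoc)
  have "l = Cmp C Y X X (Cmp C X Y X l f) r"
    using fr l r f ob by (metis Cmp_assoc Cmp_Idt)
  hence "l = r"
    using lf r ob by (simp add: Idt_Cmp)
  thus ?thesis
    unfolding is_iso_def using lf fr f l by blast
qed

text \<open>One-sided inverses suffice to read a square backwards: \<open>a'\<close> is a section of
  \<open>a\<close>, and \<open>b'\<close> is a retraction of \<open>b\<close>.\<close>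

lemma square_inverse:
  assumes ob: "X \<in> Obj C" "Y \<in> Obj C" "X' \<in> Obj C" "Y' \<in> Obj C"
    and a: "a \<in> Hom C X X'" "a' \<in> Hom C X' X" "Cmp C X' X X' a a' = Idt C X'"
    and b: "b \<in> Hom C Y Y'" "b' \<in> Hom C Y' Y" "Cmp C Y Y' Y b' b = Idt C Y"
    and u: "u \<in> Hom C X Y" "u' \<in> Hom C X' Y'"
    and sq: "Cmp C X Y Y' b u = Cmp C X X' Y' u' a"
  shows "Cmp C X' Y' Y b' u' = Cmp C X' X Y u a'"
proof -
  have "Cmp C X' X Y' (Cmp C X Y Y' b u) a' = u'"
    unfolding sq using ob a u by (metis Cmp_assoc Cmp_Idt)
  hence "Cmp C X' Y' Y b' u' = Cmp C X' Y' Y b' (Cmp C X' Y Y' b (Cmp C X' X Y u a'))"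
    using ob a b u by (metis Cmp_assoc)
  also have "\<dots> = Cmp C X' X Y u a'"
    using ob a b u by (metis Cmp_assoc Idt_Cmp Cmp_in)
  finally show ?thesis .
qed

lemma square_paste:
  assumes ob: "X \<in> Obj C" "Y \<in> Obj C" "X' \<in> Obj C" "Y' \<in> Obj C" "X'' \<in> Obj C" "Y'' \<in> Obj C"
    and "a \<in> Hom C X X'" "a' \<in> Hom C X' X''" "b \<in> Hom C Y Y'" "b' \<in> Hom C Y' Y''"
    and "u \<in> Hom C X Y" "u' \<in> Hom C X' Y'" "u'' \<in> Hom C X'' Y''"
    and "Cmp C X Y Y' b u = Cmp C X X' Y' u' a"
    and "Cmp C X' Y' Y'' b' u' = Cmp C X' X'' Y'' u'' a'"
  shows "Cmp C X Y Y'' (Cmp C Y Y' Y'' b' b) u = Cmp C X X'' Y'' u'' (Cmp C X X' X'' a' a)"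
  using assms by (metis Cmp_assoc)

end

text \<open>
  A dg category is modelled inside one ring: \<open>e X\<close> is the idempotent of the object \<open>X\<close>, \<open>d X\<close> its
  differential, and \<open>Hm X Y r\<close> consists of the maps \<open>X \<rightarrow> Y\<close> of degree \<open>r\<close>. The differential need not
  itself be such a map: codifferentials are not comodule maps. The units \<open>S\<close> and \<open>S'\<close>
  are the suspension \<open>X \<rightarrow> sh X\<close>, of degree \<open>-1\<close>, and its inverse.
  In \<open>cone X Y u K i j p q\<close> the object \<open>K\<close> is \<open>Y \<oplus> X[1]\<close> with inclusions \<open>i\<close>, \<open>q\<close> and
  projections \<open>j\<close>, \<open>p\<close>.
\<close>

locale dg_base =
  fixes C :: "('o, 'm) addcat"
    and Hm :: "'o \<Rightarrow> 'o \<Rightarrow> int \<Rightarrow> 'r::{ring,monoid_mult} set"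
    and e d :: "'o \<Rightarrow> 'r" and S S' :: 'r
    and sh :: "'o \<Rightarrow> 'o"
  fixes Zc :: "'o \<Rightarrow> 'o \<Rightarrow> 'r set" and htp :: "'o \<Rightarrow> 'o \<Rightarrow> 'r \<Rightarrow> 'r \<Rightarrow> bool"
    and cone :: "'o \<Rightarrow> 'o \<Rightarrow> 'r \<Rightarrow> 'o \<Rightarrow> 'r \<Rightarrow> 'r \<Rightarrow> 'r \<Rightarrow> 'r \<Rightarrow> bool"
  defines Zc_def: "Zc \<equiv> \<lambda>X Y. {f \<in> Hm X Y 0. d Y * f = f * d X}"
    and htp_def: "htp \<equiv> \<lambda>X Y f g. \<exists>H\<in>Hm X Y (-1). f - g = d Y * H + H * d X"
    and cone_def: "cone \<equiv> \<lambda>X Y u K i j p q. u \<in> Zc X Y \<and> K \<in> Obj C \<and>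
      i \<in> Hm Y K 0 \<and> j \<in> Hm K Y 0 \<and> p \<in> Hm K X 1 \<and> q \<in> Hm X K (-1) \<and>
      j * i = e Y \<and> p * q = e X \<and> j * q = 0 \<and> p * i = 0 \<and> i * j + q * p = e K \<and>
      d K = i * d Y * j + i * u * p - q * d X * p"
  assumes S_inv: "S * S' = 1" "S' * S = 1"
    and Hm_obj: "f \<in> Hm X Y r \<Longrightarrow> X \<in> Obj C \<and> Y \<in> Obj C"
    and Hm_0: "X \<in> Obj C \<Longrightarrow> Y \<in> Obj C \<Longrightarrow> 0 \<in> Hm X Y r"
    and Hm_add: "f \<in> Hm X Y r \<Longrightarrow> g \<in> Hm X Y r \<Longrightarrow> f + g \<in> Hm X Y r"
    and Hm_neg: "f \<in> Hm X Y r \<Longrightarrow> - f \<in> Hm X Y r"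
    and Hm_comp: "f \<in> Hm X Y r \<Longrightarrow> g \<in> Hm Y Z s \<Longrightarrow> t = r + s \<Longrightarrow> g * f \<in> Hm X Z t"
    and e_Hm: "X \<in> Obj C \<Longrightarrow> e X \<in> Hm X X 0"
    and Hm_e: "f \<in> Hm X Y r \<Longrightarrow> e Y * f = f" "f \<in> Hm X Y r \<Longrightarrow> f * e X = f"
    and d_e: "X \<in> Obj C \<Longrightarrow> e X * d X = d X" "X \<in> Obj C \<Longrightarrow> d X * e X = d X"
    and d_d: "X \<in> Obj C \<Longrightarrow> d X * d X = 0"
    and sh_bij: "bij_betw sh (Obj C) (Obj C)"
    and e_sh: "X \<in> Obj C \<Longrightarrow> e (sh X) = S * e X * S'"
    and d_sh: "X \<in> Obj C \<Longrightarrow> d (sh X) = - (S * d X * S')"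
    and Hm_S: "f \<in> Hm X Y r \<Longrightarrow> t = r - 1 \<Longrightarrow> S * f \<in> Hm X (sh Y) t"
      "Y \<in> Obj C \<Longrightarrow> f \<in> Hm X (sh Y) r \<Longrightarrow> t = r + 1 \<Longrightarrow> S' * f \<in> Hm X Y t"
      "f \<in> Hm X Y r \<Longrightarrow> t = r + 1 \<Longrightarrow> f * S' \<in> Hm (sh X) Y t"
      "X \<in> Obj C \<Longrightarrow> f \<in> Hm (sh X) Y r \<Longrightarrow> t = r - 1 \<Longrightarrow> f * S \<in> Hm X Y t"
begin

section \<open>Closed maps, homotopies and their behaviour under the shift\<close>

lemmas S_inv2 = S_inv[THEN assoc_rule]

lemma Hm_diff: "f \<in> Hm X Y r \<Longrightarrow> g \<in> Hm X Y r \<Longrightarrow> f - g \<in> Hm X Y r"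
  using Hm_add[of f X Y r "- g"] Hm_neg[of g X Y r] by simp

lemma Zc_Hm: "f \<in> Zc X Y \<Longrightarrow> f \<in> Hm X Y 0"
  by (simp add: Zc_def)

lemma Zc_d: "f \<in> Zc X Y \<Longrightarrow> d Y * f = f * d X"
  by (simp add: Zc_def)

lemma Zc_obj: "f \<in> Zc X Y \<Longrightarrow> X \<in> Obj C" "f \<in> Zc X Y \<Longrightarrow> Y \<in> Obj C"
  using Zc_Hm Hm_obj by blast+

lemma ZcI: "f \<in> Hm X Y 0 \<Longrightarrow> d Y * f = f * d X \<Longrightarrow> f \<in> Zc X Y"
  by (simp add: Zc_def)

lemma Zc_comp: "f \<in> Zc X Y \<Longrightarrow> g \<in> Zc Y Z \<Longrightarrow> g * f \<in> Zc X Z"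
  unfolding Zc_def by (auto intro: Hm_comp) (metis mult.assoc)

lemma Zc_add: "f \<in> Zc X Y \<Longrightarrow> g \<in> Zc X Y \<Longrightarrow> f + g \<in> Zc X Y"
  unfolding Zc_def by (auto intro: Hm_add simp: algebra_simps)

lemma Zc_neg: "f \<in> Zc X Y \<Longrightarrow> - f \<in> Zc X Y"
  unfolding Zc_def by (auto intro: Hm_neg)

lemma Zc_diff: "f \<in> Zc X Y \<Longrightarrow> g \<in> Zc X Y \<Longrightarrow> f - g \<in> Zc X Y"
  using Zc_add[of f X Y "- g"] Zc_neg[of g] by simp

lemma Zc_0: "X \<in> Obj C \<Longrightarrow> Y \<in> Obj C \<Longrightarrow> 0 \<in> Zc X Y"
  unfolding Zc_def by (simp add: Hm_0)

lemma Zc_e: "X \<in> Obj C \<Longrightarrow> e X \<in> Zc X X"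
  unfolding Zc_def by (simp add: e_Hm d_e)

lemma sh_obj: "X \<in> Obj C \<Longrightarrow> sh X \<in> Obj C"
  using sh_bij bij_betwE by blast

lemma sh_surj: "X \<in> Obj C \<Longrightarrow> \<exists>Y\<in>Obj C. sh Y = X"
  using sh_bij by (metis bij_betw_def imageE)

lemma Zc_sh: "f \<in> Zc X Y \<Longrightarrow> S * f * S' \<in> Zc (sh X) (sh Y)"
proof (rule ZcI)
  assume f: "f \<in> Zc X Y"
  show "S * f * S' \<in> Hm (sh X) (sh Y) 0"
    using Hm_S(1)[OF Zc_Hm[OF f] refl] by (rule Hm_S(3)) simp
  show "d (sh Y) * (S * f * S') = S * f * S' * d (sh X)"
    using Zc_obj[OF f] Zc_d[OF f] Zc_d[OF f, THEN assoc_rule]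
    by (simp add: d_sh mult.assoc S_inv S_inv2)
qed

lemma Zc_unsh:
  assumes ob: "X \<in> Obj C" "Y \<in> Obj C" and f: "f \<in> Zc (sh X) (sh Y)"
  shows "S' * f * S \<in> Zc X Y"
proof (rule ZcI)
  show "S' * f * S \<in> Hm X Y 0"
    using Hm_S(2)[OF ob(2) Zc_Hm[OF f] refl] by (rule Hm_S(4)[OF ob(1)]) simp
  have "S' * (d (sh Y) * f) * S = S' * (f * d (sh X)) * S"
    using Zc_d[OF f] by simp
  thus "d Y * (S' * f * S) = S' * f * S * d X"
    by (simp add: ob d_sh mult.assoc S_inv S_inv2)
qed

lemma htp_refl: "X \<in> Obj C \<Longrightarrow> Y \<in> Obj C \<Longrightarrow> htp X Y f f"
  unfolding htp_def by (rule bexI[of _ 0]) (auto simp: Hm_0)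

lemma htpI: "H \<in> Hm X Y (-1) \<Longrightarrow> f - g = d Y * H + H * d X \<Longrightarrow> htp X Y f g"
  unfolding htp_def by blast

lemma htp_diff: "htp X Y f g \<longleftrightarrow> htp X Y (f - g) 0"
  unfolding htp_def by simp

lemma htp_sym: "htp X Y f g \<Longrightarrow> htp X Y g f"
  unfolding htp_def
proof (elim bexE)
  fix H assume "H \<in> Hm X Y (-1)" "f - g = d Y * H + H * d X"
  hence "- H \<in> Hm X Y (-1)" "g - f = d Y * (- H) + (- H) * d X"
    by (auto simp: Hm_neg algebra_simps)
  thus "\<exists>H\<in>Hm X Y (-1). g - f = d Y * H + H * d X" by blast
qed

lemma htp_add: "htp X Y f g \<Longrightarrow> htp X Y f' g' \<Longrightarrow> htp X Y (f + f') (g + g')"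
  unfolding htp_def
proof (elim bexE)
  fix H H' assume "H \<in> Hm X Y (-1)" "f - g = d Y * H + H * d X"
    "H' \<in> Hm X Y (-1)" "f' - g' = d Y * H' + H' * d X"
  moreover have "f + f' - (g + g') = (f - g) + (f' - g')" by simp
  ultimately have "H + H' \<in> Hm X Y (-1)" "f + f' - (g + g') = d Y * (H + H') + (H + H') * d X"
    by (simp_all add: Hm_add algebra_simps)
  thus "\<exists>H\<in>Hm X Y (-1). f + f' - (g + g') = d Y * H + H * d X" by blast
qed

lemma htp_trans: "htp X Y f g \<Longrightarrow> htp X Y g h \<Longrightarrow> htp X Y f h"
  using htp_add[of X Y "f - g" 0 "g - h" 0] htp_diff[of X Y f g] htp_diff[of X Y g h] htp_diff[of X Y f h]
  by simp

lemma htp_left: "htp X Y f g \<Longrightarrow> h \<in> Zc Y Z \<Longrightarrow> htp X Z (h * f) (h * g)"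
  unfolding htp_def
proof (elim bexE)
  fix H assume h: "h \<in> Zc Y Z" and H: "H \<in> Hm X Y (-1)" "f - g = d Y * H + H * d X"
  have "h * H \<in> Hm X Z (-1)" by (rule Hm_comp[OF H(1) Zc_Hm[OF h]]) simp
  moreover have "h * f - h * g = d Z * (h * H) + h * H * d X"
    unfolding right_diff_distrib[symmetric] H(2)
    using Zc_d[OF h, THEN assoc_rule] by (simp add: distrib_left mult.assoc)
  ultimately show "\<exists>H\<in>Hm X Z (-1). h * f - h * g = d Z * H + H * d X" by blast
qed

lemma htp_right: "htp Y Z f g \<Longrightarrow> h \<in> Zc X Y \<Longrightarrow> htp X Z (f * h) (g * h)"
  unfolding htp_def
proof (elim bexE)
  fix H assume h: "h \<in> Zc X Y" and H: "H \<in> Hm Y Z (-1)" "f - g = d Z * H + H * d Y"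
  have "H * h \<in> Hm X Z (-1)" by (rule Hm_comp[OF Zc_Hm[OF h] H(1)]) simp
  moreover have "f * h - g * h = d Z * (H * h) + H * h * d X"
    unfolding left_diff_distrib[symmetric] H(2)
    using Zc_d[OF h] by (simp add: distrib_right mult.assoc)
  ultimately show "\<exists>H\<in>Hm X Z (-1). f * h - g * h = d Z * H + H * d X" by blast
qed

lemma htp_neg: "htp X Y f g \<Longrightarrow> htp X Y (- f) (- g)"
  using htp_sym[of X Y f g] htp_diff[of X Y g f] htp_diff[of X Y "-f" "-g"] by simp

text \<open>Conjugation by the suspension negates the differentials, so a homotopy \<open>H\<close>
  is carried to \<open>- (S * H * S')\<close>, and back with the same sign.\<close>

lemma htp_sh:
  assumes ob: "X \<in> Obj C" "Y \<in> Obj C"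
  shows "htp (sh X) (sh Y) (S * f * S') (S * g * S') \<longleftrightarrow> htp X Y f g"
proof
  assume "htp (sh X) (sh Y) (S * f * S') (S * g * S')"
  then obtain H where H: "H \<in> Hm (sh X) (sh Y) (-1)"
    "S * f * S' - S * g * S' = d (sh Y) * H + H * d (sh X)" unfolding htp_def by blast
  have "- (S' * H * S) \<in> Hm X Y (-1)"
    by (rule Hm_neg, rule Hm_S(4)[OF ob(1) Hm_S(2)[OF ob(2) H(1) refl]]) simp
  moreover have "S' * (S * f * S' - S * g * S') * S = S' * (d (sh Y) * H + H * d (sh X)) * S"
    using H(2) by simp
  hence "f - g = d Y * (- (S' * H * S)) + (- (S' * H * S)) * d X"
    by (simp add: ob d_sh algebra_simps S_inv S_inv2)
  ultimately show "htp X Y f g" unfolding htp_def by blast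
next
  assume "htp X Y f g"
  then obtain H where H: "H \<in> Hm X Y (-1)" "f - g = d Y * H + H * d X" unfolding htp_def by blast
  have "- (S * H * S') \<in> Hm (sh X) (sh Y) (-1)"
    by (rule Hm_neg, rule Hm_S(3)[OF Hm_S(1)[OF H(1) refl]]) simp
  moreover have "S * (f - g) * S' = S * (d Y * H + H * d X) * S'" using H(2) by simp
  hence "S * f * S' - S * g * S' = d (sh Y) * (- (S * H * S')) + (- (S * H * S')) * d (sh X)"
    by (simp add: ob d_sh algebra_simps S_inv S_inv2)
  ultimately show "htp (sh X) (sh Y) (S * f * S') (S * g * S')" unfolding htp_def by blast
qed

lemma htp_unsh:
  assumes ob: "X \<in> Obj C" "Y \<in> Obj C"
  shows "htp (sh X) (sh Y) f g \<Longrightarrow> htp X Y (S' * f * S) (S' * g * S)"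
  using htp_sh[OF ob, of "S' * f * S" "S' * g * S"] by (simp add: mult.assoc S_inv S_inv2)

end

text \<open>
  \<open>kl X Y f\<close> is the homotopy class of the closed map \<open>f\<close>. The triangles in \<open>SST\<close> abstract those
  of semi-split sequences. In \<open>ex_cone\<close>, the object \<open>X'\<close> is \<open>K[-1]\<close> and \<open>K'\<close> is the mapping cylinder of \<open>u\<close>.
\<close>

locale dg_model = dg_base C Hm e d S S' sh Zc htp cone
  for C :: "('o, 'm) addcat"
    and Hm :: "'o \<Rightarrow> 'o \<Rightarrow> int \<Rightarrow> 'r::{ring,monoid_mult} set"
    and e d :: "'o \<Rightarrow> 'r" and S S' :: 'r and sh :: "'o \<Rightarrow> 'o"
    and Zc :: "'o \<Rightarrow> 'o \<Rightarrow> 'r set" and htp :: "'o \<Rightarrow> 'o \<Rightarrow> 'r \<Rightarrow> 'r \<Rightarrow> bool"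
    and cone :: "'o \<Rightarrow> 'o \<Rightarrow> 'r \<Rightarrow> 'o \<Rightarrow> 'r \<Rightarrow> 'r \<Rightarrow> 'r \<Rightarrow> 'r \<Rightarrow> bool" +
  fixes shA :: "'m \<Rightarrow> 'm" and kl :: "'o \<Rightarrow> 'o \<Rightarrow> 'r \<Rightarrow> 'm" and SST :: "('o, 'm) triangle set"
  assumes kl_Hom: "X \<in> Obj C \<Longrightarrow> Y \<in> Obj C \<Longrightarrow> Hom C X Y = kl X Y ` Zc X Y"
    and kl_eq: "f \<in> Zc X Y \<Longrightarrow> g \<in> Zc X Y \<Longrightarrow> kl X Y f = kl X Y g \<longleftrightarrow> htp X Y f g"
    and kl_Cmp: "f \<in> Zc X Y \<Longrightarrow> g \<in> Zc Y Z \<Longrightarrow> Cmp C X Y Z (kl Y Z g) (kl X Y f) = kl X Z (g * f)"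
    and kl_Add: "f \<in> Zc X Y \<Longrightarrow> g \<in> Zc X Y \<Longrightarrow> Add C X Y (kl X Y f) (kl X Y g) = kl X Y (f + g)"
    and kl_Zer: "X \<in> Obj C \<Longrightarrow> Y \<in> Obj C \<Longrightarrow> Zer C X Y = kl X Y 0"
    and kl_Idt: "X \<in> Obj C \<Longrightarrow> Idt C X = kl X X (e X)"
    and kl_sh: "f \<in> Zc X Y \<Longrightarrow> shA (kl X Y f) = kl (sh X) (sh Y) (S * f * S')"
    and zero_module: "\<exists>Z\<in>Obj C. e Z = 0"
    and ex_cone: "u \<in> Zc X Y \<Longrightarrow> \<exists>K i j p q. cone X Y u K i j p q \<and>
      (\<forall>X'\<in>Obj C. sh X' = K \<longrightarrow> (\<exists>K' i' j' p' q'. cone X' X (- (p * S)) K' i' j' p' q' \<and>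
         (X, K', K, kl X K' i', kl K' K (S * p'), kl K (sh X) (S * p)) \<in> SST))"
    and SST_split: "T \<in> SST \<Longrightarrow> \<exists>L M N f g \<rho> \<sigma> h. f \<in> Zc L M \<and> g \<in> Zc M N \<and> h \<in> Zc N (sh L) \<and>
      \<rho> \<in> Hm M L 0 \<and> \<sigma> \<in> Hm N M 0 \<and> \<rho> * f = e L \<and> g * \<sigma> = e N \<and> \<rho> * \<sigma> = 0 \<and> g * f = 0 \<and>
      f * \<rho> + \<sigma> * g = e M \<and> \<rho> * d M = d L * \<rho> - S' * h * g \<and>
      T = (L, M, N, kl L M f, kl M N g, kl N (sh L) h)"

section \<open>Cones\<close>

context dg_model
begin

lemma coneD:
  assumes "cone X Y u K i j p q"
  shows "u \<in> Zc X Y" "K \<in> Obj C" "i \<in> Hm Y K 0" "j \<in> Hm K Y 0" "p \<in> Hm K X 1" "q \<in> Hm X K (-1)"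
    "X \<in> Obj C" "Y \<in> Obj C" "u \<in> Hm X Y 0" "i * j + q * p = e K"
  using assms Zc_obj Zc_Hm unfolding cone_def by blast+

text \<open>These are the entries of \<open>d K\<close> with respect to
  \<open>K = Y \<oplus> X[1]\<close>, oriented so that \<open>d K\<close> is moved past inclusions
  and projections until it disappears. The completeness relation \<open>i * j + q * p = e K\<close>
  does not simplify a product and is kept out; where needed, it is inserted by hand.\<close>

lemma cone_rules0:
  assumes "cone X Y u K i j p q"
  shows "j * i = e Y" "p * q = e X" "j * q = 0" "p * i = 0"
    "d K * i = i * d Y" "d K * q = i * u - q * d X"
    "p * d K = - (d X * p)" "j * d K = d Y * j + u * p"
    "d Y * u = u * d X"
    "e K * i = i" "i * e Y = i" "e Y * j = j" "j * e K = j" "e X * p = p" "p * e K = p"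
    "e K * q = q" "q * e X = q" "e Y * u = u" "u * e X = u"
    "e X * d X = d X" "d X * e X = d X" "e Y * d Y = d Y" "d Y * e Y = d Y" 
    "e K * d K = d K" "d K * e K = d K"
proof -
  note D = coneD[OF assms]
  have r: "j * i = e Y" "p * q = e X" "j * q = 0" "p * i = 0"
    and dK: "d K = i * d Y * j + i * u * p - q * d X * p"
    using assms unfolding cone_def by blast+
  note e = Hm_e[OF D(3)] Hm_e[OF D(4)] Hm_e[OF D(5)] Hm_e[OF D(6)] Hm_e[OF D(9)]
    d_e[OF D(2)] d_e[OF D(7)] d_e[OF D(8)]
  note r' = r r[THEN assoc_rule] e e[THEN assoc_rule]
  show "d K * i = i * d Y" "d K * q = i * u - q * d X"
    "p * d K = - (d X * p)" "j * d K = d Y * j + u * p"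
    unfolding dK by (simp_all add: distrib_left distrib_right left_diff_distrib right_diff_distrib mult.assoc r')
  show "d Y * u = u * d X" using D(1) Zc_d by blast
  show "e K * d K = d K" "d K * e K = d K" using d_e[OF D(2)] .
qed (use assms in \<open>auto simp: cone_def Hm_e d_e dest: Zc_obj Zc_Hm\<close>)

lemmas cone_rules = cone_rules0 cone_rules0[THEN assoc_rule]
lemmas ring_rules = mult.assoc distrib_left distrib_right left_diff_distrib right_diff_distrib
  S_inv S_inv2

text \<open>Inserts the completeness relation in front of a map into the cone; this is the form in
  which the homotopy computations below use it.\<close>

lemma cone_split:
  assumes "cone X Y u K i j p q" "f \<in> Hm W K r"
  shows "f = i * (j * f) + q * (p * f)"
  using coneD(10)[OF assms(1)] Hm_e(1)[OF assms(2)] by (metis distrib_right mult.assoc)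

lemma cone_split_right:
  assumes "cone X Y u K i j p q" "f \<in> Hm K W r"
  shows "f = f * i * j + f * q * p"
  using coneD(10)[OF assms(1)] Hm_e(2)[OF assms(2)] by (metis distrib_left mult.assoc)

lemma cone_i: "cone X Y u K i j p q \<Longrightarrow> i \<in> Zc Y K"
  by (rule ZcI) (auto dest: coneD cone_rules)

lemma cone_p:
  assumes "cone X Y u K i j p q"
  shows "S * p \<in> Zc K (sh X)"
proof (rule ZcI)
  note D = coneD[OF assms]
  show "S * p \<in> Hm K (sh X) 0" using D(5) by (rule Hm_S(1)) simp
  show "d (sh X) * (S * p) = S * p * d K"
    using D by (simp add: d_sh ring_rules cone_rules[OF assms])
qed

text \<open>As a graded object \<open>K2\<close> is \<open>Y \<oplus> X[1] \<oplus> Y[1]\<close>,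
  and \<phi> embeds \<open>X[1]\<close> as the graph of \<open>- u\<close> into the last summand,
  which makes it closed. The complement \<open>Y \<oplus> Y[1]\<close> is the cone on the identity
  of \<open>Y\<close>; the homotopy \<open>- (Q * j * J)\<close> contracts it. The graph is also the
  source of the sign of the rotated arrow.\<close>

lemma cone_rotate:
  assumes K: "cone X Y u K i j p q" and K2: "cone Y K i K2 I J P Q"
  defines "\<phi> \<equiv> (I * q - Q * u) * S'" and "\<psi> \<equiv> S * (p * J)"
  shows "\<phi> \<in> Zc (sh X) K2" "\<psi> \<in> Zc K2 (sh X)"
    "htp (sh X) (sh X) (\<psi> * \<phi>) (e (sh X))" "htp K2 K2 (\<phi> * \<psi>) (e K2)"
    "htp K K2 (\<phi> * (S * p)) I" "S * P * \<phi> = - (S * u * S')"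
proof -
  note D = coneD[OF K] and D2 = coneD[OF K2]
  note r = ring_rules cone_rules[OF K] cone_rules[OF K2] d_sh[OF D(7)] e_sh[OF D(7)]
  show "\<phi> \<in> Zc (sh X) K2"
  proof (rule ZcI)
    have "I * q - Q * u \<in> Hm X K2 (-1)"
      by (rule Hm_diff Hm_comp[OF D(6) D2(3)] Hm_comp[OF D(9) D2(6)] | simp)+
    thus "\<phi> \<in> Hm (sh X) K2 0" unfolding \<phi>_def by (rule Hm_S(3)) simp
    show "d K2 * \<phi> = \<phi> * d (sh X)" unfolding \<phi>_def by (simp add: r)
  qed
  show "\<psi> \<in> Zc K2 (sh X)"
  proof (rule ZcI)
    have "p * J \<in> Hm K2 X 1" by (rule Hm_comp[OF D2(4) D(5)]) simp
    thus "\<psi> \<in> Hm K2 (sh X) 0" unfolding \<psi>_def by (rule Hm_S(1)) simp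
    show "d (sh X) * \<psi> = \<psi> * d K2" unfolding \<psi>_def by (simp add: r)
  qed
  have "\<psi> * \<phi> = e (sh X)" unfolding \<phi>_def \<psi>_def by (simp add: r)
  thus "htp (sh X) (sh X) (\<psi> * \<phi>) (e (sh X))" using htp_refl sh_obj D(7) by simp
  have Qj: "Q * j \<in> Hm K K2 (-1)" by (rule Hm_comp[OF D(4) D2(6)]) simp
  show "htp K2 K2 (\<phi> * \<psi>) (e K2)"
  proof (rule htpI)
    show "- (Q * j * J) \<in> Hm K2 K2 (-1)"
      by (rule Hm_neg, rule Hm_comp[OF D2(4) Qj]) simp
    have "I * (i * (j * J)) + I * (q * (p * J)) = I * J"
      using cone_split[OF K D2(4)] by (metis distrib_left)
    thus "\<phi> * \<psi> - e K2 = d K2 * - (Q * j * J) + - (Q * j * J) * d K2"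
      unfolding \<phi>_def \<psi>_def D2(10)[symmetric] by (simp add: r algebra_simps)
  qed
  show "htp K K2 (\<phi> * (S * p)) I"
  proof (rule htpI)
    show "- (Q * j) \<in> Hm K K2 (-1)" using Qj by (rule Hm_neg)
    have "I * (i * j) + I * (q * p) = I"
      using cone_split_right[OF K D2(3)] by (simp add: mult.assoc)
    thus "\<phi> * (S * p) - I = d K2 * - (Q * j) + - (Q * j) * d K"
      unfolding \<phi>_def by (simp add: r algebra_simps)
  qed
  show "S * P * \<phi> = - (S * u * S')" unfolding \<phi>_def by (simp add: r)
qed

text \<open>Desuspending negates all three differentials. For the matrix of \<open>d K0\<close> to
  be that of a cone, its off-diagonal entry has to change sign too, which turns \<open>u\<close>
  into \<open>- (S' * u * S)\<close>.\<close>

lemma cone_unsh: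
  assumes X: "X \<in> Obj C" and Y: "Y \<in> Obj C" and K0: "K0 \<in> Obj C"
    and K: "cone (sh X) (sh Y) u (sh K0) i j p q"
  shows "cone X Y (- (S' * u * S)) K0 (S' * i * S) (S' * j * S) (S' * p * S) (S' * q * S)"
proof -
  note D = coneD[OF K] and r = cone_rules[OF K]
  have mv: "\<And>a b. S * a * S' = b \<Longrightarrow> a = S' * b * S"
    using S_inv by (metis mult.assoc mult_1_left mult_1_right)
  have eX: "e X = S' * e (sh X) * S" and eY: "e Y = S' * e (sh Y) * S" and eK: "e K0 = S' * e (sh K0) * S"
    using mv e_sh[OF X] e_sh[OF Y] e_sh[OF K0] by simp_all
  have dX: "d X = - (S' * d (sh X) * S)" and dY: "d Y = - (S' * d (sh Y) * S)" and dK: "d K0 = - (S' * d (sh K0) * S)"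
    using d_sh[OF X] d_sh[OF Y] d_sh[OF K0] by (simp_all add: mult.assoc S_inv S_inv2)
  have unS: "S' * f * S \<in> Hm A B s" if "A \<in> Obj C" "B \<in> Obj C" "f \<in> Hm (sh A) (sh B) s" for A B f s
    by (rule Hm_S(4)[OF that(1) Hm_S(2)[OF that(2,3) refl]]) simp
  have dK': "d (sh K0) = i * d (sh Y) * j + i * u * p - q * d (sh X) * p"
    and eK': "e (sh K0) = i * j + q * p"
    using K unfolding cone_def by simp_all
  have "S' * i * S * (S' * j * S) + S' * q * S * (S' * p * S) = e K0"
    "d K0 = S' * i * S * d Y * (S' * j * S) + S' * i * S * (- (S' * u * S)) * (S' * p * S)
      - S' * q * S * d X * (S' * p * S)"
    unfolding eK dK dK' eK' dX dY by (simp_all add: ring_rules)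
  moreover have "S' * j * S * (S' * i * S) = e Y" "S' * p * S * (S' * q * S) = e X"
    "S' * j * S * (S' * q * S) = 0" "S' * p * S * (S' * i * S) = 0"
    unfolding eX eY by (simp_all add: ring_rules r)
  ultimately show ?thesis
    unfolding cone_def using Zc_neg[OF Zc_unsh[OF X Y D(1)]] K0 unS X Y D by simp
qed

text \<open>The homotopy \<open>H\<close> between the two ways around the square is the off-diagonal
  entry of the matrix \<open>c\<close>, and the equation for \<open>H\<close> is exactly the
  condition that \<open>c\<close> is closed. Since \<open>H\<close> is a choice, the fill-in is not
  unique.\<close>

lemma cone_map:
  assumes K: "cone X Y u K i j p q" and K': "cone X' Y' u' K' i' j' p' q'"
    and a: "a \<in> Zc X X'" and b: "b \<in> Zc Y Y'" and h: "htp X Y' (b * u) (u' * a)"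
  shows "\<exists>c\<in>Zc K K'. c * i = i' * b \<and> S * p' * c = S * a * S' * (S * p)"
proof -
  note D = coneD[OF K] and D' = coneD[OF K']
  obtain H where H: "H \<in> Hm X Y' (-1)" "b * u - u' * a = d Y' * H + H * d X"
    using h unfolding htp_def by blast
  note e = Hm_e[OF H(1)] Hm_e[OF Zc_Hm[OF a]] Hm_e[OF Zc_Hm[OF b]] Zc_d[OF a] Zc_d[OF b]
  note r = ring_rules cone_rules[OF K] cone_rules[OF K'] e e[THEN assoc_rule]
  define c where "c = i' * b * j + q' * a * p + i' * H * p"
  have "b * u = u' * a + d Y' * H + H * d X" using H(2) by (simp add: algebra_simps)
  hence bu: "b * (u * x) = u' * a * x + d Y' * H * x + H * d X * x" for x
    by (metis distrib_right mult.assoc)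
  have "c \<in> Zc K K'"
  proof (rule ZcI)
    show "c \<in> Hm K K' 0" unfolding c_def
      by (rule Hm_add Hm_comp[OF D(4) Hm_comp[OF Zc_Hm[OF b] D'(3)]]
          Hm_comp[OF D(5) Hm_comp[OF Zc_Hm[OF a] D'(6)]]
          Hm_comp[OF D(5) Hm_comp[OF H(1) D'(3)]] | simp)+
    show "d K' * c = c * d K" unfolding c_def by (simp add: r bu algebra_simps)
  qed
  moreover have "c * i = i' * b" "S * p' * c = S * a * S' * (S * p)"
    unfolding c_def by (simp_all add: r)
  ultimately show ?thesis by blast
qed

text \<open>Subtracting the boundary of \<open>H * j\<close> from \<open>n\<close> kills its
  restriction to \<open>Y\<close>. What remains lives on the summand \<open>X[1]\<close>, where it
  is \<open>n * q - H * u\<close>.\<close>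

lemma cone_factor:
  assumes K: "cone X Y u K i j p q" and n: "n \<in> Zc K W" and h: "htp Y W (n * i) 0"
  shows "\<exists>n'\<in>Zc (sh X) W. htp K W n (n' * (S * p))"
proof -
  note D = coneD[OF K]
  obtain H where H: "H \<in> Hm Y W (-1)" "n * i = d W * H + H * d Y"
    using h unfolding htp_def by auto
  note e = Hm_e[OF H(1)] Hm_e[OF Zc_Hm[OF n]]
  note r = ring_rules cone_rules[OF K] e e[THEN assoc_rule] H(2) H(2)[THEN assoc_rule] d_sh[OF D(7)]
  have nd: "d W * (n * x) = n * (d K * x)" for x using Zc_d[OF n, THEN assoc_rule] by (simp add: mult.assoc)
  define n' where "n' = (n * q - H * u) * S'"
  have "n' \<in> Zc (sh X) W"
  proof (rule ZcI)
    have "n * q - H * u \<in> Hm X W (-1)"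
      by (rule Hm_diff Hm_comp[OF D(6) Zc_Hm[OF n]] Hm_comp[OF D(9) H(1)] | simp)+
    thus "n' \<in> Hm (sh X) W 0" unfolding n'_def by (rule Hm_S(3)) simp
    show "d W * n' = n' * d (sh X)" unfolding n'_def by (simp add: r nd)
  qed
  moreover have "htp K W n (n' * (S * p))"
  proof (rule htpI)
    show "H * j \<in> Hm K W (-1)" by (rule Hm_comp[OF D(4) H(1)]) simp
    have "n = d W * H * j + H * d Y * j + n * q * p"
      using cone_split_right[OF K Zc_Hm[OF n]] H(2) by (simp add: distrib_right)
    thus "n - n' * (S * p) = d W * (H * j) + H * j * d K"
      unfolding n'_def by (simp add: r algebra_simps)
  qed
  ultimately show ?thesis by blast
qed

text \<open>The contraction \<open>q * j\<close> carries the summand \<open>X\<close> identically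
  onto the summand \<open>X[1]\<close>.\<close>

lemma cone_contractible:
  assumes K: "cone X X (e X) K i j p q"
  shows "htp K K (e K) 0"
proof (rule htpI)
  note D = coneD[OF K]
  show "q * j \<in> Hm K K (-1)" by (rule Hm_comp[OF D(4) D(6)]) simp
  show "e K - 0 = d K * (q * j) + q * j * d K"
    unfolding D(10)[symmetric] by (simp add: ring_rules cone_rules[OF K])
qed

text \<open>Write \<open>N\<close> as \<open>sh X\<close>. The splitting makes \<open>M\<close> the
  graded sum of \<open>L\<close> and \<open>N\<close>, and the off-diagonal entry of its
  differential is \<open>- (S' * h)\<close>. Hence \<open>M\<close> is the cone on
  \<open>u = - (S' * h * S)\<close>, and \<open>h = - (S * u * S')\<close> is the sign that belongs
  to a rotated cone triangle.\<close>

lemma SST_cone: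
  assumes "T \<in> SST"
  shows "\<exists>X Y u K i j p q. cone X Y u K i j p q \<and>
      T = (Y, K, sh X, kl Y K i, kl K (sh X) (S * p), kl (sh X) (sh Y) (- (S * u * S')))"
proof -
  obtain L M N f g \<rho> \<sigma> h where f: "f \<in> Zc L M" and g: "g \<in> Zc M N" and h: "h \<in> Zc N (sh L)"
    and \<rho>: "\<rho> \<in> Hm M L 0" and \<sigma>: "\<sigma> \<in> Hm N M 0"
    and r: "\<rho> * f = e L" "g * \<sigma> = e N" "\<rho> * \<sigma> = 0" "g * f = 0" "f * \<rho> + \<sigma> * g = e M"
      "\<rho> * d M = d L * \<rho> - S' * h * g"
    and T: "T = (L, M, N, kl L M f, kl M N g, kl N (sh L) h)"
    using SST_split[OF assms] by (elim exE conjE)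
  obtain X where X: "X \<in> Obj C" "sh X = N" using sh_surj Zc_obj[OF g] by blast
  note ob = Zc_obj[OF f] Zc_obj[OF g]
  have eN: "e N = S * e X * S'" and dN: "d N = - (S * d X * S')" using e_sh d_sh X by blast+
  define u where "u = - (S' * h * S)"
  have "S' * h * S \<in> Zc X L" using Zc_unsh[OF X(1) ob(1)] h X(2) by simp
  hence "u \<in> Zc X L" unfolding u_def by (rule Zc_neg)
  moreover have "d M = f * d L * \<rho> + f * u * (S' * g) - \<sigma> * S * d X * (S' * g)"
  proof -
    have "d M = f * (\<rho> * d M) + \<sigma> * (g * d M)"
      using d_e(1)[OF ob(2)] r(5) by (metis distrib_right mult.assoc)
    also have "g * d M = d N * g" using Zc_d[OF g] by simp
    finally show ?thesis
      unfolding r(6) u_def dN by (simp add: algebra_simps S_inv S_inv2)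
  qed
  moreover have "S' * g * (\<sigma> * S) = e X"
    using r(2) unfolding eN by (simp add: mult.assoc assoc_rule[OF r(2), unfolded eN] S_inv S_inv2)
  moreover have "\<sigma> * S * (S' * g) = \<sigma> * g" "\<rho> * (\<sigma> * S) = 0" "S' * g * f = 0"
    using r(3,4) by (simp_all add: mult.assoc S_inv S_inv2 assoc_rule[OF r(3)])
  moreover have "S' * g \<in> Hm M X 1" "\<sigma> * S \<in> Hm X M (-1)"
    using Hm_S(2)[OF X(1), of g M 0 1] Hm_S(4)[OF X(1), of \<sigma> M 0 "-1"] Zc_Hm[OF g] \<sigma> X(2) by simp_all
  ultimately have "cone X L u M f \<rho> (S' * g) (\<sigma> * S)"
    unfolding cone_def using Zc_Hm[OF f] \<rho> r ob by simp
  moreover have "S * (S' * g) = g" "- (S * u * S') = h"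
    unfolding u_def by (simp_all add: mult.assoc S_inv S_inv2)
  ultimately show ?thesis using T X(2) by metis
qed

text \<open>As a graded object \<open>K\<close> is
  \<open>Z \<oplus> X[1] \<oplus> Y[1] \<oplus> X[2]\<close>. The middle two vertices of the
  octahedron share the summand \<open>X[1]\<close>, and together with \<open>X[2]\<close> it forms a
  cone on an identity, contracted by \<open>- (Q * q1 * (p3 * J))\<close>. What is left is
  \<open>K2 = Z \<oplus> Y[1]\<close>, included by \<theta> with retraction \<psi>.\<close>

lemma cone_octahedron:
  assumes K1: "cone X Y u K1 i1 j1 p1 q1" and K2: "cone Y Z v K2 i2 j2 p2 q2"
    and K3: "cone X Z (v * u) K3 i3 j3 p3 q3"
  defines "f \<equiv> i3 * v * j1 + q3 * p1" and "g \<equiv> i2 * j3 + q2 * u * p3"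
  assumes K: "cone K1 K3 f K I J P Q"
  defines "\<psi> \<equiv> g * J + q2 * j1 * P" and "\<theta> \<equiv> I * i3 * j2 + Q * i1 * p2"
  shows "\<psi> \<in> Zc K K2" "\<theta> \<in> Zc K2 K" "\<psi> * \<theta> = e K2" "htp K K (\<theta> * \<psi>) (e K)" "\<psi> * I = g"
    "P * \<theta> = i1 * p2"
proof -
  note D1 = coneD[OF K1] and D2 = coneD[OF K2] and D3 = coneD[OF K3] and D = coneD[OF K]
  note r0 = ring_rules cone_rules[OF K1] cone_rules[OF K2] cone_rules[OF K3]
  have fr0: "f * i1 = i3 * v" "p3 * f = p1" "f * q1 = q3" "g * i3 = i2" "p2 * g = u * p3" "g * q3 = q2 * u"
    "g * d K3 = d K2 * g" "f * d K1 = d K3 * f" "j3 * f = v * j1" "g * f = i2 * (v * j1) + q2 * (u * p1)"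
    unfolding f_def g_def by (simp_all add: r0)
  note r = r0 cone_rules[OF K] fr0 fr0[THEN assoc_rule]
  have gH: "g \<in> Hm K3 K2 0" unfolding g_def
    by (rule Hm_add Hm_comp[OF D3(4) D2(3)] Hm_comp[OF D3(5) Hm_comp[OF D1(9) D2(6) refl]] | simp)+
  show "\<psi> \<in> Zc K K2"
  proof (rule ZcI)
    show "\<psi> \<in> Hm K K2 0" unfolding \<psi>_def
      by (rule Hm_add Hm_comp[OF D(4) gH] Hm_comp[OF D(5) Hm_comp[OF D1(4) D2(6) refl]] | simp)+
    show "d K2 * \<psi> = \<psi> * d K"
      unfolding \<psi>_def by (simp add: r)
  qed
  show "\<theta> \<in> Zc K2 K"
  proof (rule ZcI)
    show "\<theta> \<in> Hm K2 K 0" unfolding \<theta>_def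
      by (rule Hm_add Hm_comp[OF D2(4) Hm_comp[OF D3(3) D(3) refl]]
          Hm_comp[OF D2(5) Hm_comp[OF D1(3) D(6) refl]] | simp)+
    show "d K * \<theta> = \<theta> * d K2"
      unfolding \<theta>_def by (simp add: r algebra_simps)
  qed
  show "\<psi> * \<theta> = e K2"
    unfolding \<theta>_def \<psi>_def D2(10)[symmetric] by (simp add: r)
  show "\<psi> * I = g" "P * \<theta> = i1 * p2"
    unfolding \<theta>_def \<psi>_def using Hm_e[OF gH] by (simp_all add: r)
  show "htp K K (\<theta> * \<psi>) (e K)"
  proof (rule htpI)
    show "- (Q * q1 * (p3 * J)) \<in> Hm K K (-1)"
      by (rule Hm_neg, rule Hm_comp[OF Hm_comp[OF D(4) D3(5) refl] Hm_comp[OF D1(6) D(6) refl]]) simp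
    have "I * (i3 * (j3 * J)) + I * (q3 * (p3 * J)) = I * J"
      using cone_split[OF K3 D(4)] by (metis distrib_left)
    moreover have "Q * (i1 * (j1 * P)) + Q * (q1 * (p1 * P)) = Q * P"
      using cone_split[OF K1 D(5)] by (metis distrib_left)
    moreover have "j2 * (g * x) = j3 * x" "p2 * (g * x) = u * (p3 * x)" for x
      unfolding g_def by (simp_all add: r0)
    ultimately show "\<theta> * \<psi> - e K = d K * - (Q * q1 * (p3 * J)) + - (Q * q1 * (p3 * J)) * d K"
      unfolding \<theta>_def \<psi>_def D(10)[symmetric] by (simp add: r algebra_simps)
  qed
qed

text \<open>\<open>f\<close> is the diagonal matrix with entries \<open>v\<close> and the identity
  of \<open>X[1]\<close>, \<open>g\<close> the one with the identity of \<open>Z\<close> and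
  \<open>u\<close>. No homotopy term is needed to close them, because the third cone is taken on the
  literal product \<open>v * u\<close>.\<close>

lemma cone_octahedron_maps:
  assumes K1: "cone X Y u K1 i1 j1 p1 q1" and K2: "cone Y Z v K2 i2 j2 p2 q2"
    and K3: "cone X Z (v * u) K3 i3 j3 p3 q3"
  defines "f \<equiv> i3 * v * j1 + q3 * p1" and "g \<equiv> i2 * j3 + q2 * u * p3"
  shows "f \<in> Zc K1 K3" "g \<in> Zc K3 K2" "f * i1 = i3 * v" "p3 * f = p1" "g * i3 = i2" "p2 * g = u * p3"
proof -
  note D1 = coneD[OF K1] and D2 = coneD[OF K2] and D3 = coneD[OF K3]
  note r = ring_rules cone_rules[OF K1] cone_rules[OF K2] cone_rules[OF K3]
  show "f \<in> Zc K1 K3" unfolding f_def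
  proof (rule ZcI)
    show "i3 * v * j1 + q3 * p1 \<in> Hm K1 K3 0"
      by (rule Hm_add Hm_comp[OF D1(4) Hm_comp[OF D2(9) D3(3) refl]] Hm_comp[OF D1(5) D3(6)] | simp)+
  qed (simp add: r algebra_simps)
  show "g \<in> Zc K3 K2" unfolding g_def
  proof (rule ZcI)
    show "i2 * j3 + q2 * u * p3 \<in> Hm K3 K2 0"
      by (rule Hm_add Hm_comp[OF D3(4) D2(3)] Hm_comp[OF D3(5) Hm_comp[OF D1(9) D2(6) refl]] | simp)+
  qed (simp add: r algebra_simps)
  show "f * i1 = i3 * v" "p3 * f = p1" "g * i3 = i2" "p2 * g = u * p3"
    unfolding f_def g_def by (simp_all add: r)
qed

text \<open>Here \<open>K'\<close> is the mapping cylinder of \<open>u\<close>, written as the cone on the desuspension of \<open>K \<rightarrow> sh X\<close>.\<close>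

lemma cone_cylinder:
  assumes K: "cone X Y u K i j p q" and X': "X' \<in> Obj C" "sh X' = K"
    and K': "cone X' X (- (p * S)) K' i' j' p' q'"
  defines "b \<equiv> u * j' + j * S * p'" and "a \<equiv> q' * S' * i"
  shows "b \<in> Zc K' Y" "a \<in> Zc Y K'" "b * a = e Y" "htp K' K' (a * b) (e K')" "b * i' = u"
    "htp K' K (i * b) (S * p')"
proof -
  note D = coneD[OF K] and D' = coneD[OF K']
  \<comment> \<open>The cylinder is built over \<open>X'\<close>, while the other data live on
    \<open>K = sh X'\<close>; expressing \<open>e X'\<close> and \<open>d X'\<close> through
    \<open>K\<close> lets the rules of both cones interact.\<close>
  have e': "e X' = S' * e K * S" and d': "d X' = - (S' * d K * S)"
    unfolding X'(2)[symmetric] e_sh[OF X'(1)] d_sh[OF X'(1)] by (simp_all add: ring_rules)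
  have cl0: "p' * q' = S' * e K * S" "d K' * q' = i' * (- (p * S)) + q' * S' * d K * S" "p' * d K' = S' * d K * S * p'"
    using cone_rules(2,6,7)[OF K'] unfolding e' d' by (simp_all add: ring_rules)
  note c' = cl0 cone_rules0(1,3,4,5,8,10-13,16-17,20-25)[OF K']
  note r0 = ring_rules cone_rules[OF K] c' c'[THEN assoc_rule]
  have eS: "e K * (S * p') = S * p'" "q' * (S' * e K) = q' * S'"
    using cone_rules0(14,17)[OF K'] unfolding e' by (metis S_inv mult.assoc mult_1_left mult_1_right)+
  have eS2: "q' * (S' * (e K * x)) = q' * (S' * x)" for x
    using eS(2) by (metis mult.assoc)
  note r = r0 eS eS(1)[THEN assoc_rule] eS2
  have p': "S * p' \<in> Hm K' K 0" using Hm_S(1)[OF D'(5)] X'(2) by fastforce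
  have q': "q' * S' \<in> Hm K K' 0" using Hm_S(3)[OF D'(6)] X'(2) by fastforce
  show "b \<in> Zc K' Y"
  proof (rule ZcI)
    have "u * j' + j * (S * p') \<in> Hm K' Y 0"
      by (rule Hm_add Hm_comp[OF D'(4) D(9)] Hm_comp[OF p' D(4)] | simp)+
    thus "b \<in> Hm K' Y 0" by (simp add: b_def mult.assoc)
    show "d Y * b = b * d K'" unfolding b_def by (simp add: r)
  qed
  show "a \<in> Zc Y K'"
  proof (rule ZcI)
    show "a \<in> Hm Y K' 0" unfolding a_def by (rule Hm_comp[OF D(3) q']) simp
    show "d K' * a = a * d Y" unfolding a_def by (simp add: r)
  qed
  show "b * a = e Y" "b * i' = u" unfolding a_def b_def by (simp_all add: r)
  have j: "j' * (i' * x) = e X * x" for x using cone_rules(1)[OF K'] by (metis mult.assoc)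
  \<comment> \<open>The cylinder is \<open>X \<oplus> Y \<oplus> X[1]\<close> as a graded object.
    The homotopy moves the summand \<open>X\<close> identically onto \<open>X[1]\<close>, so that
    only \<open>Y\<close> survives.\<close>
  show "htp K' K' (a * b) (e K')"
  proof (rule htpI)
    have "q' * S' * (q * j') \<in> Hm K' K' (-1)"
      by (rule Hm_comp[OF Hm_comp[OF D'(4) D(6) refl] q']) simp
    thus "q' * S' * q * j' \<in> Hm K' K' (-1)" by (simp add: mult.assoc)
    have "q' * (S' * (i * (j * (S * p')))) + q' * (S' * (q * (p * (S * p')))) = q' * p'"
      using cone_split[OF K p'] by (metis distrib_left mult.assoc S_inv(2) mult_1_left)
    thus "a * b - e K' = d K' * (q' * S' * q * j') + q' * S' * q * j' * d K'"
      unfolding a_def b_def D'(10)[symmetric] by (simp add: r algebra_simps)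
  qed
  show "htp K' K (i * b) (S * p')"
  proof (rule htpI)
    show "q * j' \<in> Hm K' K (-1)" by (rule Hm_comp[OF D'(4) D(6)]) simp
    have "i * (j * (S * p')) + q * (p * (S * p')) = S * p'"
      using cone_split[OF K p'] by simp
    thus "i * b - S * p' = d K * (q * j') + q * j' * d K'"
      unfolding b_def by (simp add: r algebra_simps)
  qed
qed

text \<open>Both cones carry the same matrix as differential, so the identity matrix between the two
  decompositions is closed.\<close>

lemma cone_unique:
  assumes K: "cone X Y u K i j p q" and K': "cone X Y u K' i' j' p' q'"
  shows "i' * j + q' * p \<in> Zc K K'" "(i' * j + q' * p) * (i * j' + q * p') = e K'"
    "(i' * j + q' * p) * i = i'" "p' * (i' * j + q' * p) = p"
proof -
  note D = coneD[OF K] and D' = coneD[OF K'] and r = ring_rules cone_rules[OF K] cone_rules[OF K']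
  show "i' * j + q' * p \<in> Zc K K'"
  proof (rule ZcI)
    show "i' * j + q' * p \<in> Hm K K' 0"
      by (rule Hm_add Hm_comp[OF D(4) D'(3)] Hm_comp[OF D(5) D'(6)] | simp)+
  qed (simp add: r algebra_simps)
  show "(i' * j + q' * p) * (i * j' + q * p') = e K'"
    unfolding D'(10)[symmetric] by (simp add: r)
  show "(i' * j + q' * p) * i = i'" "p' * (i' * j + q' * p) = p"
    by (simp_all add: r)
qed

section \<open>Additive structure of the homotopy category\<close>

lemma HomE:
  assumes "f \<in> Hom C X Y" "X \<in> Obj C" "Y \<in> Obj C"
  obtains f0 where "f0 \<in> Zc X Y" "f = kl X Y f0"
  using assms kl_Hom by auto

lemma kl_in: "f \<in> Zc X Y \<Longrightarrow> kl X Y f \<in> Hom C X Y"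
  using kl_Hom Zc_obj by blast

lemma kl_eqI: "f \<in> Zc X Y \<Longrightarrow> g \<in> Zc X Y \<Longrightarrow> htp X Y f g \<Longrightarrow> kl X Y f = kl X Y g"
  using kl_eq by blast

lemma kl_Add_neg: "f \<in> Zc X Y \<Longrightarrow> Add C X Y (kl X Y (- f)) (kl X Y f) = Zer C X Y"
  by (simp add: kl_Add Zc_neg kl_Zer Zc_obj)

lemma hom_comm_group_kl:
  assumes ob: "X \<in> Obj C" "Y \<in> Obj C"
  shows "comm_group (hom_group C X Y)"
proof (rule comm_groupI)
  fix x y assume "x \<in> carrier (hom_group C X Y)" "y \<in> carrier (hom_group C X Y)"
  then obtain f g where f: "f \<in> Zc X Y" "x = kl X Y f" and g: "g \<in> Zc X Y" "y = kl X Y g"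
    using ob by (auto simp: hom_group_def kl_Hom)
  show "x \<otimes>\<^bsub>hom_group C X Y\<^esub> y \<in> carrier (hom_group C X Y)"
    "x \<otimes>\<^bsub>hom_group C X Y\<^esub> y = y \<otimes>\<^bsub>hom_group C X Y\<^esub> x"
    using f g by (simp_all add: hom_group_def kl_Add kl_in Zc_add add.commute)
  show "\<exists>y\<in>carrier (hom_group C X Y). y \<otimes>\<^bsub>hom_group C X Y\<^esub> x = \<one>\<^bsub>hom_group C X Y\<^esub>"
    using f by (auto simp: hom_group_def intro!: bexI[of _ "kl X Y (- f)"] kl_in Zc_neg kl_Add_neg)
  show "\<one>\<^bsub>hom_group C X Y\<^esub> \<otimes>\<^bsub>hom_group C X Y\<^esub> x = x"
    using f ob by (simp add: hom_group_def kl_Zer kl_Add Zc_0)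
  fix z assume "z \<in> carrier (hom_group C X Y)"
  then obtain h where h: "h \<in> Zc X Y" "z = kl X Y h"
    using ob by (auto simp: hom_group_def kl_Hom)
  show "x \<otimes>\<^bsub>hom_group C X Y\<^esub> y \<otimes>\<^bsub>hom_group C X Y\<^esub> z = x \<otimes>\<^bsub>hom_group C X Y\<^esub> (y \<otimes>\<^bsub>hom_group C X Y\<^esub> z)"
    using f g h by (simp add: hom_group_def kl_Add Zc_add add.assoc)
qed (use ob in \<open>simp add: hom_group_def kl_Zer kl_in Zc_0\<close>)

lemma Neg_kl:
  assumes f: "f \<in> Zc X Y"
  shows "Neg C X Y (kl X Y f) = kl X Y (- f)"
proof -
  interpret G: comm_group "hom_group C X Y"
    using f Zc_obj by (blast intro: hom_comm_group_kl)
  show ?thesis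
    unfolding Neg_def using f
    by (intro G.inv_equality) (auto simp: hom_group_def kl_Add_neg kl_in Zc_neg)
qed

text \<open>The cone on the zero map from the desuspension \<open>X'\<close> of \<open>X\<close> to
  \<open>Y\<close> has a block-diagonal differential, so both its inclusions and both its
  projections are closed.\<close>

lemma biproduct_kl:
  assumes X: "X \<in> Obj C" and Y: "Y \<in> Obj C"
  shows "\<exists>S\<in>Obj C. \<exists>i1\<in>Hom C X S. \<exists>i2\<in>Hom C Y S. \<exists>p1\<in>Hom C S X. \<exists>p2\<in>Hom C S Y.
            Cmp C X S X p1 i1 = Idt C X \<and> Cmp C Y S Y p2 i2 = Idt C Y \<and>
            Cmp C Y S X p1 i2 = Zer C Y X \<and> Cmp C X S Y p2 i1 = Zer C X Y \<and>
            Add C S S (Cmp C S X S i1 p1) (Cmp C S Y S i2 p2) = Idt C S"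
proof -
  obtain X' where X': "X' \<in> Obj C" "sh X' = X" using sh_surj[OF X] by blast
  obtain K i j p q where K: "cone X' Y 0 K i j p q" using ex_cone[OF Zc_0[OF X'(1) Y]] by blast
  note D = coneD[OF K] and r = ring_rules cone_rules[OF K]
  have e': "e X = S * e X' * S'" and d': "d X = - (S * d X' * S')"
    using e_sh[OF X'(1)] d_sh[OF X'(1)] X'(2) by simp_all
  have i1: "q * S' \<in> Zc X K"
  proof (rule ZcI)
    show "q * S' \<in> Hm X K 0" using Hm_S(3)[OF D(6)] X'(2) by fastforce
  qed (simp add: d' r)
  have p1: "S * p \<in> Zc K X" using cone_p[OF K] X'(2) by simp
  have i2: "i \<in> Zc Y K" by (rule cone_i[OF K])
  have p2: "j \<in> Zc K Y" by (rule ZcI) (simp_all add: D r)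
  have "S * p * (q * S') = e X" "j * i = e Y" "S * p * i = 0" "j * (q * S') = 0"
    by (simp_all add: r e')
  moreover have "q * S' * (S * p) + i * j = e K"
    using D(10) by (simp add: r add.commute)
  moreover have "kl X K (q * S') \<in> Hom C X K" "kl Y K i \<in> Hom C Y K" "kl K X (S * p) \<in> Hom C K X" "kl K Y j \<in> Hom C K Y"
    using i1 i2 p1 p2 kl_in by blast+
  ultimately show ?thesis
    using i1 i2 p1 p2 D(2) X Y
    by (intro bexI[of _ K] bexI[of _ "kl X K (q * S')"] bexI[of _ "kl Y K i"]
        bexI[of _ "kl K X (S * p)"] bexI[of _ "kl K Y j"])
      (simp_all add: kl_Cmp kl_Add kl_Idt kl_Zer Zc_comp)
qed

lemma zero_object_iff:
  assumes Z: "Z \<in> Obj C"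
  shows "is_zero_object C Z \<longleftrightarrow> htp Z Z (e Z) 0"
proof
  assume "is_zero_object C Z"
  hence "kl Z Z (e Z) = kl Z Z 0"
    unfolding is_zero_object_def using Z kl_in[OF Zc_e[OF Z]] kl_in[OF Zc_0[OF Z Z]] by blast
  thus "htp Z Z (e Z) 0" using kl_eq Zc_e Zc_0 Z by blast
next
  assume h: "htp Z Z (e Z) 0"
  have "f = kl X Z 0" if XZ: "X \<in> Obj C" "f \<in> Hom C X Z" for X f
  proof -
    obtain f0 where f0: "f0 \<in> Zc X Z" "f = kl X Z f0" using HomE[OF XZ(2)] XZ(1) Z by metis
    have "htp X Z (e Z * f0) (0 * f0)" using h f0(1) by (rule htp_right)
    thus ?thesis using f0 kl_eqI[OF f0(1) Zc_0] Z XZ Hm_e[OF Zc_Hm[OF f0(1)]] by simp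
  qed
  moreover have "f = kl Z X 0" if XZ: "X \<in> Obj C" "f \<in> Hom C Z X" for X f
  proof -
    obtain f0 where f0: "f0 \<in> Zc Z X" "f = kl Z X f0" using HomE[OF XZ(2)] XZ(1) Z by metis
    have "htp Z X (f0 * e Z) (f0 * 0)" using h f0(1) by (rule htp_left)
    thus ?thesis using f0 kl_eqI[OF f0(1) Zc_0] Z XZ Hm_e[OF Zc_Hm[OF f0(1)]] by simp
  qed
  ultimately show "is_zero_object C Z"
    unfolding is_zero_object_def using Z kl_in Zc_0 by metis
qed

sublocale additive_category C
proof (rule additive_category.intro)
  fix X Y :: 'o assume ob: "X \<in> Obj C" "Y \<in> Obj C"
  show "comm_group (hom_group C X Y)" using ob by (rule hom_comm_group_kl)
  show "\<exists>S\<in>Obj C. \<exists>i1\<in>Hom C X S. \<exists>i2\<in>Hom C Y S. \<exists>p1\<in>Hom C S X. \<exists>p2\<in>Hom C S Y.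
            Cmp C X S X p1 i1 = Idt C X \<and> Cmp C Y S Y p2 i2 = Idt C Y \<and>
            Cmp C Y S X p1 i2 = Zer C Y X \<and> Cmp C X S Y p2 i1 = Zer C X Y \<and>
            Add C S S (Cmp C S X S i1 p1) (Cmp C S Y S i2 p2) = Idt C S"
    using ob by (rule biproduct_kl)
next
  fix X assume "X \<in> Obj C"
  thus "Idt C X \<in> Hom C X X" by (simp add: kl_Idt kl_in Zc_e)
next
  fix X Y f assume "X \<in> Obj C" "Y \<in> Obj C" "f \<in> Hom C X Y"
  thus "Cmp C X X Y f (Idt C X) = f"
    by (auto elim!: HomE simp: kl_Idt kl_Cmp Zc_e Hm_e[OF Zc_Hm])
next
  fix X Y f assume "X \<in> Obj C" "Y \<in> Obj C" "f \<in> Hom C X Y"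
  thus "Cmp C X Y Y (Idt C Y) f = f"
    by (auto elim!: HomE simp: kl_Idt kl_Cmp Zc_e Hm_e[OF Zc_Hm])
next
  fix X Y Z f g assume "X \<in> Obj C" "Y \<in> Obj C" "Z \<in> Obj C" "f \<in> Hom C X Y" "g \<in> Hom C Y Z"
  thus "Cmp C X Y Z g f \<in> Hom C X Z"
    by (auto elim!: HomE simp: kl_Cmp kl_in Zc_comp)
next
  fix W X Y Z f g h assume "W \<in> Obj C" "X \<in> Obj C" "Y \<in> Obj C" "Z \<in> Obj C"
    "f \<in> Hom C W X" "g \<in> Hom C X Y" "h \<in> Hom C Y Z"
  thus "Cmp C W Y Z h (Cmp C W X Y g f) = Cmp C W X Z (Cmp C X Y Z h g) f"
    by (auto elim!: HomE simp: kl_Cmp Zc_comp mult.assoc)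
next
  fix X Y Z f g g' assume "X \<in> Obj C" "Y \<in> Obj C" "Z \<in> Obj C"
    "f \<in> Hom C X Y" "g \<in> Hom C Y Z" "g' \<in> Hom C Y Z"
  thus "Cmp C X Y Z (Add C Y Z g g') f = Add C X Z (Cmp C X Y Z g f) (Cmp C X Y Z g' f)"
    by (auto elim!: HomE simp: kl_Cmp kl_Add Zc_comp Zc_add distrib_right)
next
  fix X Y Z f f' g assume "X \<in> Obj C" "Y \<in> Obj C" "Z \<in> Obj C"
    "f \<in> Hom C X Y" "f' \<in> Hom C X Y" "g \<in> Hom C Y Z"
  thus "Cmp C X Y Z g (Add C X Y f f') = Add C X Z (Cmp C X Y Z g f) (Cmp C X Y Z g f')"
    by (auto elim!: HomE simp: kl_Cmp kl_Add Zc_comp Zc_add distrib_left)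
next
  obtain Z where Z: "Z \<in> Obj C" "e Z = 0" using zero_module by blast
  hence "is_zero_object C Z" by (simp add: zero_object_iff htp_refl)
  thus "\<exists>Z. is_zero_object C Z" ..
qed

section \<open>The shift as an additive automorphism\<close>

lemma shA_in:
  assumes "X \<in> Obj C" "Y \<in> Obj C" "f \<in> Hom C X Y"
  shows "shA f \<in> Hom C (sh X) (sh Y)"
  using assms by (auto elim!: HomE simp: kl_sh intro!: kl_in Zc_sh)

lemma shA_Idt: "X \<in> Obj C \<Longrightarrow> shA (Idt C X) = Idt C (sh X)"
  by (simp add: kl_Idt kl_sh Zc_e sh_obj e_sh)

lemma shA_Cmp:
  assumes "X \<in> Obj C" "Y \<in> Obj C" "Z \<in> Obj C" "f \<in> Hom C X Y" "g \<in> Hom C Y Z"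
  shows "shA (Cmp C X Y Z g f) = Cmp C (sh X) (sh Y) (sh Z) (shA g) (shA f)"
  using assms by (auto elim!: HomE simp: kl_sh kl_Cmp Zc_comp Zc_sh[unfolded mult.assoc] ring_rules)

lemma shA_Add:
  assumes "X \<in> Obj C" "Y \<in> Obj C" "f \<in> Hom C X Y" "g \<in> Hom C X Y"
  shows "shA (Add C X Y f g) = Add C (sh X) (sh Y) (shA f) (shA g)"
  using assms by (auto elim!: HomE simp: kl_sh kl_Add Zc_add Zc_sh[unfolded mult.assoc] ring_rules)

lemma shA_bij:
  assumes ob: "X \<in> Obj C" "Y \<in> Obj C"
  shows "bij_betw shA (Hom C X Y) (Hom C (sh X) (sh Y))"
proof -
  have "inj_on shA (Hom C X Y)"
  proof (rule inj_onI)
    fix f g assume fg: "f \<in> Hom C X Y" "g \<in> Hom C X Y" "shA f = shA g"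
    obtain f0 g0 where "f0 \<in> Zc X Y" "f = kl X Y f0" "g0 \<in> Zc X Y" "g = kl X Y g0"
      using fg ob by (metis HomE)
    thus "f = g" using fg(3) ob by (simp add: kl_sh kl_eq Zc_sh htp_sh)
  qed
  moreover have "f \<in> shA ` Hom C X Y" if f: "f \<in> Hom C (sh X) (sh Y)" for f
  proof -
    obtain f0 where f0: "f0 \<in> Zc (sh X) (sh Y)" "f = kl (sh X) (sh Y) f0"
      using HomE[OF f] ob sh_obj by metis
    have "shA (kl X Y (S' * f0 * S)) = f"
      using Zc_unsh[OF ob f0(1)] f0(2) by (simp add: kl_sh ring_rules)
    thus ?thesis using kl_in[OF Zc_unsh[OF ob f0(1)]] by blast
  qed
  ultimately show ?thesis
    unfolding bij_betw_def using shA_in[OF ob] by blast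
qed

lemma is_iso_shA:
  assumes ob: "X \<in> Obj C" "Y \<in> Obj C" and f: "is_iso C X Y f"
  shows "is_iso C (sh X) (sh Y) (shA f)"
proof -
  obtain g where "g \<in> Hom C Y X" "Cmp C X Y X g f = Idt C X" "Cmp C Y X Y f g = Idt C Y"
    using is_isoE[OF f] by blast
  thus ?thesis
    unfolding is_iso_def using ob is_iso_Hom[OF f] shA_in shA_Cmp shA_Idt by metis
qed

lemma kl_isoI:
  assumes "f \<in> Zc X Y" "g \<in> Zc Y X" "htp X X (g * f) (e X)" "htp Y Y (f * g) (e Y)"
  shows "is_iso C X Y (kl X Y f)"
  unfolding is_iso_def using assms Zc_obj[OF assms(1)]
  by (auto intro!: bexI[of _ "kl Y X g"] kl_eqI kl_in Zc_comp Zc_e simp: kl_Cmp kl_Idt)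

section \<open>Isomorphisms of triangles, and comparison of cone triangles with semi-split
  ones\<close>

lemma triangle_iso_sym:
  assumes T: "is_triangle C sh T" and T': "is_triangle C sh T'" and i: "triangle_iso C sh shA T T'"
  shows "triangle_iso C sh shA T' T"
proof -
  obtain X Y Z u v w where T_eq: "T = (X, Y, Z, u, v, w)" by (metis prod_cases6)
  obtain X' Y' Z' u' v' w' where T'_eq: "T' = (X', Y', Z', u', v', w')" by (metis prod_cases6)
  have ob: "X \<in> Obj C" "Y \<in> Obj C" "Z \<in> Obj C" "X' \<in> Obj C" "Y' \<in> Obj C" "Z' \<in> Obj C"
    "sh X \<in> Obj C" "sh X' \<in> Obj C"
    and m: "u \<in> Hom C X Y" "v \<in> Hom C Y Z" "w \<in> Hom C Z (sh X)"
      "u' \<in> Hom C X' Y'" "v' \<in> Hom C Y' Z'" "w' \<in> Hom C Z' (sh X')"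
    using T T' sh_obj by (auto simp: is_triangle_def T_eq T'_eq)
  obtain a b c where tm: "triangle_mor C sh shA T T' a b c"
    and a: "is_iso C X X' a" and b: "is_iso C Y Y' b" and c: "is_iso C Z Z' c"
    using i by (auto simp: triangle_iso_def T_eq T'_eq)
  obtain a' where a': "a' \<in> Hom C X' X" "Cmp C X X' X a' a = Idt C X" "Cmp C X' X X' a a' = Idt C X'" "is_iso C X' X a'"
    using is_isoE[OF a] by blast
  obtain b' where b': "b' \<in> Hom C Y' Y" "Cmp C Y Y' Y b' b = Idt C Y" "Cmp C Y' Y Y' b b' = Idt C Y'" "is_iso C Y' Y b'"
    using is_isoE[OF b] by blast
  obtain c' where c': "c' \<in> Hom C Z' Z" "Cmp C Z Z' Z c' c = Idt C Z" "Cmp C Z' Z Z' c c' = Idt C Z'" "is_iso C Z' Z c'"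
    using is_isoE[OF c] by blast
  have eq: "Cmp C X Y Y' b u = Cmp C X X' Y' u' a" "Cmp C Y Z Z' c v = Cmp C Y Y' Z' v' b"
     "Cmp C Z (sh X) (sh X') (shA a) w = Cmp C Z Z' (sh X') w' c"
    using tm by (simp_all add: triangle_mor_def T_eq T'_eq)
  have sa: "shA a \<in> Hom C (sh X) (sh X')" "shA a' \<in> Hom C (sh X') (sh X)"
    "Cmp C (sh X) (sh X') (sh X) (shA a') (shA a) = Idt C (sh X)"
    using a' ob is_iso_Hom[OF a] shA_in shA_Cmp shA_Idt by metis+
  note H = is_iso_Hom[OF a] is_iso_Hom[OF b] is_iso_Hom[OF c]
  have "triangle_mor C sh shA T' T a' b' c'"
    unfolding triangle_mor_def T_eq T'_eq prod.case
    using a'(1) b'(1) c'(1)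
      square_inverse[OF ob(1,2,4,5) H(1) a'(1,3) H(2) b'(1,2) m(1,4) eq(1)]
      square_inverse[OF ob(2,3,5,6) H(2) b'(1,3) H(3) c'(1,2) m(2,5) eq(2)]
      square_inverse[OF ob(3,7,6,8) H(3) c'(1,3) sa m(3,6) eq(3)]
    by blast
  thus ?thesis
    unfolding triangle_iso_def T_eq T'_eq prod.case using a'(4) b'(4) c'(4) by blast
qed

lemma triangle_iso_trans:
  assumes T: "is_triangle C sh T" and T': "is_triangle C sh T'" and T'': "is_triangle C sh T''"
    and i: "triangle_iso C sh shA T T'" and i': "triangle_iso C sh shA T' T''"
  shows "triangle_iso C sh shA T T''"
proof -
  obtain X Y Z u v w where T_eq: "T = (X, Y, Z, u, v, w)" by (metis prod_cases6)
  obtain X' Y' Z' u' v' w' where T'_eq: "T' = (X', Y', Z', u', v', w')" by (metis prod_cases6)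
  obtain X'' Y'' Z'' u'' v'' w'' where T''_eq: "T'' = (X'', Y'', Z'', u'', v'', w'')" by (metis prod_cases6)
  have ob: "X \<in> Obj C" "Y \<in> Obj C" "Z \<in> Obj C" "X' \<in> Obj C" "Y' \<in> Obj C" "Z' \<in> Obj C"
    "X'' \<in> Obj C" "Y'' \<in> Obj C" "Z'' \<in> Obj C"
    "sh X \<in> Obj C" "sh X' \<in> Obj C" "sh X'' \<in> Obj C"
    and m: "u \<in> Hom C X Y" "v \<in> Hom C Y Z" "w \<in> Hom C Z (sh X)"
      "u' \<in> Hom C X' Y'" "v' \<in> Hom C Y' Z'" "w' \<in> Hom C Z' (sh X')"
      "u'' \<in> Hom C X'' Y''" "v'' \<in> Hom C Y'' Z''" "w'' \<in> Hom C Z'' (sh X'')"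
    using T T' T'' sh_obj by (auto simp: is_triangle_def T_eq T'_eq T''_eq)
  obtain a b c where tm: "triangle_mor C sh shA T T' a b c"
    and abc: "is_iso C X X' a" "is_iso C Y Y' b" "is_iso C Z Z' c"
    using i by (auto simp: triangle_iso_def T_eq T'_eq)
  obtain a' b' c' where tm': "triangle_mor C sh shA T' T'' a' b' c'"
    and abc': "is_iso C X' X'' a'" "is_iso C Y' Y'' b'" "is_iso C Z' Z'' c'"
    using i' by (auto simp: triangle_iso_def T'_eq T''_eq)
  note H = abc[THEN is_iso_Hom] abc'[THEN is_iso_Hom]
  have eq: "Cmp C X Y Y' b u = Cmp C X X' Y' u' a" "Cmp C Y Z Z' c v = Cmp C Y Y' Z' v' b"
     "Cmp C Z (sh X) (sh X') (shA a) w = Cmp C Z Z' (sh X') w' c"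
     "Cmp C X' Y' Y'' b' u' = Cmp C X' X'' Y'' u'' a'" "Cmp C Y' Z' Z'' c' v' = Cmp C Y' Y'' Z'' v'' b'"
     "Cmp C Z' (sh X') (sh X'') (shA a') w' = Cmp C Z' Z'' (sh X'') w'' c'"
    using tm tm' by (simp_all add: triangle_mor_def T_eq T'_eq T''_eq)
  have "triangle_mor C sh shA T T'' (Cmp C X X' X'' a' a) (Cmp C Y Y' Y'' b' b) (Cmp C Z Z' Z'' c' c)"
    unfolding triangle_mor_def T_eq T''_eq prod.case
    using square_paste[OF ob(1,2,4,5,7,8) H(1,4,2,5) m(1,4,7) eq(1,4)]
      square_paste[OF ob(2,3,5,6,8,9) H(2,5,3,6) m(2,5,8) eq(2,5)]
      square_paste[OF ob(3,10,6,11,9,12) H(3,6) shA_in[OF ob(1,4) H(1)] shA_in[OF ob(4,7) H(4)] m(3,6,9) eq(3,6)]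
      H ob by (simp add: Cmp_in shA_Cmp)
  moreover have "is_iso C X X'' (Cmp C X X' X'' a' a)" "is_iso C Y Y'' (Cmp C Y Y' Y'' b' b)"
    "is_iso C Z Z'' (Cmp C Z Z' Z'' c' c)"
    using abc abc' ob is_iso_Cmp by blast+
  ultimately show ?thesis
    unfolding triangle_iso_def T_eq T''_eq prod.case by blast
qed

text \<open>The cone triangle of \<open>u\<close>. The arrow \<open>p\<close> has degree one, so it
  is \<open>S * p\<close> that becomes a map to \<open>sh X\<close>; the splitting \<open>j\<close>,
  \<open>q\<close> is not recorded, being closed only when \<open>u\<close> vanishes.\<close>

definition std :: "'o \<Rightarrow> 'o \<Rightarrow> 'r \<Rightarrow> 'o \<Rightarrow> 'r \<Rightarrow> 'r \<Rightarrow> ('o, 'm) triangle" where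
  "std X Y u K i p = (X, Y, K, kl X Y u, kl Y K i, kl K (sh X) (S * p))"

text \<open>Has the shape of \<open>distinguished\<close>, with \<open>SST\<close> in the role of
  the semi-split triangles, so that the final result is obtained by unfolding both.\<close>

definition Dist :: "('o, 'm) triangle set" where
  "Dist = {T. is_triangle C sh T \<and> (\<exists>T'\<in>SST. triangle_iso C sh shA T T')}"

lemma std_triangle: "cone X Y u K i j p q \<Longrightarrow> is_triangle C sh (std X Y u K i p)"
  unfolding is_triangle_def std_def by (auto dest: coneD cone_i cone_p intro!: kl_in)

lemma rot_triangle:
  assumes K: "cone X Y u K i j p q"
  shows "is_triangle C sh (Y, K, sh X, kl Y K i, kl K (sh X) (S * p), kl (sh X) (sh Y) (- (S * u * S')))"
  unfolding is_triangle_def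
  using coneD[OF K] cone_i[OF K] cone_p[OF K] by (auto intro!: kl_in Zc_neg Zc_sh sh_obj)

lemma triangle_isoI_third:
  assumes T: "is_triangle C sh (X, Y, Z, u, v, w)" and T': "is_triangle C sh (X, Y, Z', u, v', w')"
    and c: "is_iso C Z Z' c" "Cmp C Y Z Z' c v = v'" "Cmp C Z Z' (sh X) w' c = w"
  shows "triangle_iso C sh shA (X, Y, Z, u, v, w) (X, Y, Z', u, v', w')"
proof -
  have "triangle_mor C sh shA (X, Y, Z, u, v, w) (X, Y, Z', u, v', w') (Idt C X) (Idt C Y) c"
    unfolding triangle_mor_def prod.case
    using T T' c is_iso_Hom[OF c(1)]
    by (simp add: is_triangle_def Idt_in Idt_Cmp Cmp_Idt shA_Idt sh_obj)
  thus ?thesis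
    unfolding triangle_iso_def prod.case using T is_iso_Idt c(1) by (auto simp: is_triangle_def)
qed

lemma triangle_isoI_second:
  assumes T: "is_triangle C sh (X, Y, Z, u, v, w)" and T': "is_triangle C sh (X, Y', Z, u', v', w)"
    and b: "is_iso C Y Y' b" "Cmp C X Y Y' b u = u'" "Cmp C Y Y' Z v' b = v"
  shows "triangle_iso C sh shA (X, Y, Z, u, v, w) (X, Y', Z, u', v', w)"
proof -
  have "triangle_mor C sh shA (X, Y, Z, u, v, w) (X, Y', Z, u', v', w) (Idt C X) b (Idt C Z)"
    unfolding triangle_mor_def prod.case
    using T T' b is_iso_Hom[OF b(1)]
    by (simp add: is_triangle_def Idt_in Idt_Cmp Cmp_Idt shA_Idt sh_obj)
  thus ?thesis
    unfolding triangle_iso_def prod.case using T is_iso_Idt b(1) by (auto simp: is_triangle_def)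
qed

text \<open>Only the third vertex changes, along the equivalence of \<open>cone_rotate\<close>; the
  first two vertices and the first arrow are literally the same.\<close>

lemma rot_iso_std:
  assumes K: "cone X Y u K i j p q" and K2: "cone Y K i K2 I J P Q"
  shows "triangle_iso C sh shA
    (Y, K, sh X, kl Y K i, kl K (sh X) (S * p), kl (sh X) (sh Y) (- (S * u * S'))) (std Y K i K2 I P)"
proof -
  note D = coneD[OF K] and D2 = coneD[OF K2] and R = cone_rotate[OF K K2]
  define \<phi> where "\<phi> = (I * q - Q * u) * S'"
  have \<phi>: "\<phi> \<in> Zc (sh X) K2" "is_iso C (sh X) K2 (kl (sh X) K2 \<phi>)"
    "htp K K2 (\<phi> * (S * p)) I" "S * P * \<phi> = - (S * u * S')"
    unfolding \<phi>_def using R(1,5,6) kl_isoI[OF R(1-4)] by blast+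
  note Z = cone_i[OF K] cone_p[OF K] cone_i[OF K2] cone_p[OF K2]
  have "kl K K2 (\<phi> * (S * p)) = kl K K2 I"
    using \<phi> Z by (intro kl_eqI) (auto intro: Zc_comp)
  thus ?thesis
    unfolding std_def
    using \<phi> Z rot_triangle[OF K] std_triangle[OF K2, unfolded std_def]
    by (intro triangle_isoI_third[OF _ _ \<phi>(2)]) (simp_all add: kl_Cmp)
qed

lemma std_iso_std:
  assumes K: "cone X Y u K i j p q" and K': "cone X Y u K' i' j' p' q'"
  shows "triangle_iso C sh shA (std X Y u K i p) (std X Y u K' i' p')"
proof -
  note D = coneD[OF K] and D' = coneD[OF K'] and R = cone_unique[OF K K'] and R' = cone_unique[OF K' K]
  have "is_iso C K K' (kl K K' (i' * j + q' * p))"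
    using R R' D D' by (intro kl_isoI[OF R(1) R'(1)]) (auto simp: htp_refl)
  thus ?thesis
    unfolding std_def
    using R cone_i[OF K] cone_p[OF K'] std_triangle[OF K, unfolded std_def] std_triangle[OF K', unfolded std_def]
    by (intro triangle_isoI_third[of _ _ _ _ _ _ _ _ _ "kl K K' (i' * j + q' * p)"]) (simp_all add: kl_Cmp mult.assoc)
qed

text \<open>\<open>ex_cone\<close> offers a semi-split triangle only over the cone \<open>K0\<close>
  that it produces. The map \<open>b\<close> from the cylinder to \<open>Y\<close> is an isomorphism
  in the homotopy category and replaces the middle vertex; \<open>std_iso_std\<close> then passes
  from \<open>K0\<close> to the given cone.\<close>

lemma std_Dist:
  assumes K: "cone X Y u K i j p q"
  shows "std X Y u K i p \<in> Dist"
proof -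
  obtain K0 i0 j0 p0 q0 where K0: "cone X Y u K0 i0 j0 p0 q0"
    and cyl: "\<forall>X'\<in>Obj C. sh X' = K0 \<longrightarrow> (\<exists>K' i' j' p' q'. cone X' X (- (p0 * S)) K' i' j' p' q' \<and>
         (X, K', K0, kl X K' i', kl K' K0 (S * p'), kl K0 (sh X) (S * p0)) \<in> SST)"
    using ex_cone[OF coneD(1)[OF K]] by blast
  note D = coneD[OF K0]
  obtain X' where X': "X' \<in> Obj C" "sh X' = K0" using sh_surj[OF D(2)] by blast
  obtain K' i' j' p' q' where K': "cone X' X (- (p0 * S)) K' i' j' p' q'"
    and SST: "(X, K', K0, kl X K' i', kl K' K0 (S * p'), kl K0 (sh X) (S * p0)) \<in> SST"
    using cyl X' by blast
  note R = cone_cylinder[OF K0 X' K'] and D' = coneD[OF K']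
  define b where "b = u * j' + j0 * S * p'"
  have b: "b \<in> Zc K' Y" "is_iso C K' Y (kl K' Y b)" "b * i' = u" "htp K' K0 (i0 * b) (S * p')"
    unfolding b_def using R kl_isoI[OF R(1,2,4)] htp_refl[OF D(8,8)] by simp_all
  have p': "S * p' \<in> Zc K' K0" using cone_p[OF K'] X'(2) by simp
  note Z = cone_i[OF K0] cone_p[OF K0] cone_i[OF K'] p'
  have tr: "is_triangle C sh (X, K', K0, kl X K' i', kl K' K0 (S * p'), kl K0 (sh X) (S * p0))"
    using D D' Z by (auto simp: is_triangle_def kl_in)
  have "kl K' K0 (i0 * b) = kl K' K0 (S * p')"
    using b Z by (intro kl_eqI) (auto intro: Zc_comp)
  hence "triangle_iso C sh shA (X, K', K0, kl X K' i', kl K' K0 (S * p'), kl K0 (sh X) (S * p0)) (std X Y u K0 i0 p0)"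
    unfolding std_def
    using b Z tr std_triangle[OF K0, unfolded std_def]
    by (intro triangle_isoI_second[of _ _ _ _ _ _ _ _ _ "kl K' Y b"]) (simp_all add: kl_Cmp)
  hence "triangle_iso C sh shA (std X Y u K0 i0 p0) (X, K', K0, kl X K' i', kl K' K0 (S * p'), kl K0 (sh X) (S * p0))"
    using triangle_iso_sym tr std_triangle[OF K0] by blast
  hence "triangle_iso C sh shA (std X Y u K i p) (X, K', K0, kl X K' i', kl K' K0 (S * p'), kl K0 (sh X) (S * p0))"
    using triangle_iso_trans std_triangle[OF K] std_triangle[OF K0] tr std_iso_std[OF K K0] by blast
  thus ?thesis unfolding Dist_def using SST std_triangle[OF K] by blast
qed

text \<open>From here on distinguished triangles are handled through cones. A triangle of
  \<open>SST\<close> is a rotated cone triangle, and the cone \<open>K2\<close> on the inclusion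
  \<open>i\<close> presents it as an unrotated one.\<close>

lemma Dist_iff:
  "T \<in> Dist \<longleftrightarrow> is_triangle C sh T \<and>
     (\<exists>X Y u K i j p q. cone X Y u K i j p q \<and> triangle_iso C sh shA T (std X Y u K i p))"
proof
  assume "T \<in> Dist"
  then obtain T' where T: "is_triangle C sh T" and T': "T' \<in> SST" "triangle_iso C sh shA T T'"
    unfolding Dist_def by blast
  obtain X Y u K i j p q where K: "cone X Y u K i j p q"
    and T'_eq: "T' = (Y, K, sh X, kl Y K i, kl K (sh X) (S * p), kl (sh X) (sh Y) (- (S * u * S')))"
    using SST_cone[OF T'(1)] by blast
  obtain K2 I J P Q where K2: "cone Y K i K2 I J P Q" using ex_cone[OF cone_i[OF K]] by blast
  have "triangle_iso C sh shA T (std Y K i K2 I P)"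
    using triangle_iso_trans[OF T _ std_triangle[OF K2] T'(2)] rot_iso_std[OF K K2] rot_triangle[OF K]
    unfolding T'_eq by blast
  thus "is_triangle C sh T \<and> (\<exists>X Y u K i j p q. cone X Y u K i j p q \<and> triangle_iso C sh shA T (std X Y u K i p))"
    using T K2 by blast
next
  assume "is_triangle C sh T \<and>
     (\<exists>X Y u K i j p q. cone X Y u K i j p q \<and> triangle_iso C sh shA T (std X Y u K i p))"
  then obtain X Y u K i j p q where T: "is_triangle C sh T" and K: "cone X Y u K i j p q"
    and i: "triangle_iso C sh shA T (std X Y u K i p)" by blast
  obtain T' where T': "T' \<in> SST" "triangle_iso C sh shA (std X Y u K i p) T'"
    using std_Dist[OF K] unfolding Dist_def by blast
  have "is_triangle C sh T'" using SST_cone[OF T'(1)] rot_triangle by auto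
  thus "T \<in> Dist"
    unfolding Dist_def using triangle_iso_trans[OF T std_triangle[OF K] _ i T'(2)] T T'(1) by blast
qed

lemma Dist_iso:
  assumes "T \<in> Dist" "is_triangle C sh T'" "triangle_iso C sh shA T T'"
  shows "T' \<in> Dist"
proof -
  obtain T1 where T1: "is_triangle C sh T" "T1 \<in> SST" "triangle_iso C sh shA T T1"
    using assms(1) unfolding Dist_def by blast
  have "is_triangle C sh T1" using SST_cone[OF T1(2)] rot_triangle by auto
  thus ?thesis
    unfolding Dist_def using assms T1 triangle_iso_sym triangle_iso_trans by blast
qed

section \<open>Distinguished triangles\<close>

text \<open>
  Write \<open>\<phi> = 1 + n\<close>. Then \<open>n i = 0\<close> lets \<open>n\<close> factor through \<open>S p\<close>, and \<open>S p n = 0\<close> gives \<open>n n = 0\<close>,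
  so \<open>1 - n\<close> is inverse to \<open>\<phi>\<close>.
\<close>

lemma cone_endo_iso:
  assumes K: "cone X Y u K i j p q" and \<phi>: "\<phi> \<in> Hom C K K"
    and i: "Cmp C Y K K \<phi> (kl Y K i) = kl Y K i"
    and p: "Cmp C K K (sh X) (kl K (sh X) (S * p)) \<phi> = kl K (sh X) (S * p)"
  shows "is_iso C K K \<phi>"
proof -
  note D = coneD[OF K] and Z = cone_i[OF K] cone_p[OF K]
  obtain f where f: "f \<in> Zc K K" "\<phi> = kl K K f" using HomE[OF \<phi> D(2,2)] by metis
  define n where "n = f - e K"
  have n: "n \<in> Zc K K" unfolding n_def by (intro Zc_diff f Zc_e D)
  have "htp Y K (f * i) i"
    using i f Z kl_eq[OF Zc_comp[OF Z(1) f(1)] Z(1)] by (simp add: kl_Cmp)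
  hence ni: "htp Y K (n * i) 0"
    unfolding n_def using htp_diff cone_rules[OF K] by (simp add: left_diff_distrib)
  obtain n' where n': "n' \<in> Zc (sh X) K" "htp K K n (n' * (S * p))"
    using cone_factor[OF K n ni] by blast
  have "htp K (sh X) (S * p * f) (S * p)"
    using p f Z kl_eq[OF Zc_comp[OF f(1) Z(2)] Z(2)] by (simp add: kl_Cmp)
  hence "htp K (sh X) (S * p * f - S * p) 0"
    using htp_diff by blast
  hence pn: "htp K (sh X) (S * p * n) 0"
    unfolding n_def using cone_rules[OF K] by (simp add: right_diff_distrib mult.assoc)
  have "htp K K (n * n) (n' * (S * p) * n)" using n'(2) n by (rule htp_right)
  moreover have "htp K K (n' * (S * p * n)) (n' * 0)" using pn n'(1) by (rule htp_left)
  ultimately have "htp K K (n * n) 0" using htp_trans by (simp add: mult.assoc)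
  hence nn: "htp K K (- (n * n)) 0" using htp_neg by force
  have f_eq: "f = e K + n" by (simp add: n_def)
  have ne: "e K * n = n" "n * e K = n" "e K * e K = e K"
    using Hm_e[OF Zc_Hm[OF n]] Hm_e(1)[OF e_Hm[OF D(2)]] by simp_all
  have *: "(e K - n) * f = - (n * n) + e K" "f * (e K - n) = - (n * n) + e K"
    unfolding f_eq by (simp_all add: algebra_simps ne)
  have "htp K K (- (n * n) + e K) (e K)"
    using htp_add[OF nn htp_refl[OF D(2,2), of "e K"]] by simp
  thus ?thesis unfolding f(2)
    by (intro kl_isoI[OF f(1), of "e K - n"]) (simp_all only: * Zc_diff n Zc_e D)
qed

lemma cone_map_arrow:
  assumes K: "cone X Y u K i j p q" and K': "cone X' Y' u' K' i' j' p' q'"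
    and a: "a \<in> Hom C X X'" and b: "b \<in> Hom C Y Y'"
    and sq: "Cmp C X Y Y' b (kl X Y u) = Cmp C X X' Y' (kl X' Y' u') a"
  shows "\<exists>c\<in>Hom C K K'. Cmp C Y K K' c (kl Y K i) = Cmp C Y Y' K' (kl Y' K' i') b \<and>
    Cmp C K K' (sh X') (kl K' (sh X') (S * p')) c
      = Cmp C K (sh X) (sh X') (shA a) (kl K (sh X) (S * p))"
proof -
  note D = coneD[OF K] and D' = coneD[OF K']
  note Z = cone_i[OF K] cone_p[OF K] cone_i[OF K'] cone_p[OF K']
  obtain a0 where a0: "a0 \<in> Zc X X'" "a = kl X X' a0" using HomE[OF a D(7) D'(7)] by metis
  obtain b0 where b0: "b0 \<in> Zc Y Y'" "b = kl Y Y' b0" using HomE[OF b D(8) D'(8)] by metis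
  have "htp X Y' (b0 * u) (u' * a0)"
    using sq kl_eq[OF Zc_comp[OF D(1) b0(1)] Zc_comp[OF a0(1) D'(1)]] a0 b0 D(1) D'(1)
    by (simp add: kl_Cmp)
  then obtain c where "c \<in> Zc K K'" "c * i = i' * b0" "S * p' * c = S * a0 * S' * (S * p)"
    using cone_map[OF K K' a0(1) b0(1)] by blast
  thus ?thesis
    using a0 b0 Z Zc_sh[OF a0(1)]
    by (intro bexI[of _ "kl K K' c"]) (simp_all add: kl_Cmp kl_sh kl_in)
qed

text \<open>This replaces the five lemma, without long exact sequences. A fill-in for the square and
  one for its inverse need not be inverse to each other, but both composites are compatible with the
  inclusion and the projection of the cone. By \<open>cone_endo_iso\<close> they are isomorphisms,
  and then so is each fill-in.\<close>

lemma cone_map_iso: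
  assumes K: "cone X Y u K i j p q" and K': "cone X' Y' u' K' i' j' p' q'"
    and a: "is_iso C X X' a" and b: "is_iso C Y Y' b"
    and sq: "Cmp C X Y Y' b (kl X Y u) = Cmp C X X' Y' (kl X' Y' u') a"
  shows "\<exists>c. is_iso C K K' c \<and> Cmp C Y K K' c (kl Y K i) = Cmp C Y Y' K' (kl Y' K' i') b \<and>
    Cmp C K K' (sh X') (kl K' (sh X') (S * p')) c
      = Cmp C K (sh X) (sh X') (shA a) (kl K (sh X) (S * p))"
proof -
  note D = coneD[OF K] and D' = coneD[OF K']
  note Z = cone_i[OF K] cone_p[OF K] cone_i[OF K'] cone_p[OF K']
  note Zh = Z[THEN kl_in]
  note aH = is_iso_Hom[OF a] and bH = is_iso_Hom[OF b]
  obtain a' where a': "a' \<in> Hom C X' X" "Cmp C X X' X a' a = Idt C X" "Cmp C X' X X' a a' = Idt C X'"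
    using is_isoE[OF a] by metis
  obtain b' where b': "b' \<in> Hom C Y' Y" "Cmp C Y Y' Y b' b = Idt C Y" "Cmp C Y' Y Y' b b' = Idt C Y'"
    using is_isoE[OF b] by metis
  have sq': "Cmp C X' Y' Y b' (kl X' Y' u') = Cmp C X' X Y (kl X Y u) a'"
    using square_inverse[OF D(7,8) D'(7,8) aH a'(1,3) bH b'(1,2) _ _ sq] kl_in D(1) D'(1) by blast
  have shob: "sh X \<in> Obj C" "sh X' \<in> Obj C" using sh_obj D D' by blast+
  have sa: "shA a \<in> Hom C (sh X) (sh X')" "shA a' \<in> Hom C (sh X') (sh X)"
    "Cmp C (sh X) (sh X') (sh X) (shA a') (shA a) = Idt C (sh X)"
    "Cmp C (sh X') (sh X) (sh X') (shA a) (shA a') = Idt C (sh X')"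
    using a' aH D D' shA_in shA_Cmp shA_Idt by metis+
  obtain c where c: "c \<in> Hom C K K'" "Cmp C Y K K' c (kl Y K i) = Cmp C Y Y' K' (kl Y' K' i') b"
    "Cmp C K (sh X) (sh X') (shA a) (kl K (sh X) (S * p)) = Cmp C K K' (sh X') (kl K' (sh X') (S * p')) c"
    using cone_map_arrow[OF K K' aH bH sq] by metis
  obtain c' where c': "c' \<in> Hom C K' K" "Cmp C Y' K' K c' (kl Y' K' i') = Cmp C Y' Y K (kl Y K i) b'"
    "Cmp C K' (sh X') (sh X) (shA a') (kl K' (sh X') (S * p')) = Cmp C K' K (sh X) (kl K (sh X) (S * p)) c'"
    using cone_map_arrow[OF K' K a'(1) b'(1) sq'] by metis
  have 1: "is_iso C K K (Cmp C K K' K c' c)"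
  proof (rule cone_endo_iso[OF K])
    show "Cmp C K K' K c' c \<in> Hom C K K" using c(1) c'(1) D D' Cmp_in by blast
    show "Cmp C Y K K (Cmp C K K' K c' c) (kl Y K i) = kl Y K i"
      using square_paste[OF D(8,2) D'(8,2) D(8,2) bH b'(1) c(1) c'(1) Zh(1,3,1) c(2) c'(2)] b'(2) Zh D
      by (simp add: Cmp_Idt)
    show "Cmp C K K (sh X) (kl K (sh X) (S * p)) (Cmp C K K' K c' c) = kl K (sh X) (S * p)"
      using square_paste[OF D(2) shob(1) D'(2) shob(2) D(2) shob(1) c(1) c'(1) sa(1,2) Zh(2,4,2) c(3) c'(3)]
        sa(3) Zh D shob by (simp add: Idt_Cmp)
  qed
  have 2: "is_iso C K' K' (Cmp C K' K K' c c')"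
  proof (rule cone_endo_iso[OF K'])
    show "Cmp C K' K K' c c' \<in> Hom C K' K'" using c(1) c'(1) D D' Cmp_in by blast
    show "Cmp C Y' K' K' (Cmp C K' K K' c c') (kl Y' K' i') = kl Y' K' i'"
      using square_paste[OF D'(8,2) D(8,2) D'(8,2) b'(1) bH c'(1) c(1) Zh(3,1,3) c'(2) c(2)] b'(3) Zh D'
      by (simp add: Cmp_Idt)
    show "Cmp C K' K' (sh X') (kl K' (sh X') (S * p')) (Cmp C K' K K' c c') = kl K' (sh X') (S * p')"
      using square_paste[OF D'(2) shob(2) D(2) shob(1) D'(2) shob(2) c'(1) c(1) sa(2,1) Zh(4,2,4) c'(3) c(3)]
        sa(4) Zh D' shob by (simp add: Idt_Cmp)
  qed
  have "is_iso C K K' c" using iso_sandwich[OF D(2) D'(2) c(1) c'(1) 1 2] .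
  thus ?thesis using c by metis
qed

text \<open>A distinguished triangle is known only to be isomorphic to the cone triangle of some
  other map \<open>u'\<close>, by isomorphisms \<open>a\<close>, \<open>b\<close>, \<open>c\<close>.
  Lifting \<open>a\<close> and \<open>b\<close> to the cones and correcting \<open>c\<close> by the
  lift gives an isomorphism over the identities of \<open>X\<close> and \<open>Y\<close>. This rigid
  form is what the axioms use.\<close>

lemma Dist_cone:
  assumes T: "(X, Y, Z, kl X Y u, v, w) \<in> Dist" and K: "cone X Y u K i j p q"
  shows "\<exists>c. is_iso C Z K c \<and> Cmp C Y Z K c v = kl Y K i \<and> Cmp C Z K (sh X) (kl K (sh X) (S * p)) c = w"
proof -
  obtain X' Y' u' K' i' j' p' q' where tr: "is_triangle C sh (X, Y, Z, kl X Y u, v, w)"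
    and K': "cone X' Y' u' K' i' j' p' q'"
    and ti: "triangle_iso C sh shA (X, Y, Z, kl X Y u, v, w) (std X' Y' u' K' i' p')"
    using T unfolding Dist_iff by blast
  note D = coneD[OF K] and D' = coneD[OF K']
  note Zh = cone_i[OF K, THEN kl_in] cone_p[OF K, THEN kl_in] cone_i[OF K', THEN kl_in] cone_p[OF K', THEN kl_in]
  obtain a b c where a: "is_iso C X X' a" and b: "is_iso C Y Y' b" and c: "is_iso C Z K' c"
    and sq: "Cmp C X Y Y' b (kl X Y u) = Cmp C X X' Y' (kl X' Y' u') a"
      "Cmp C Y Z K' c v = Cmp C Y Y' K' (kl Y' K' i') b"
      "Cmp C Z (sh X) (sh X') (shA a) w = Cmp C Z K' (sh X') (kl K' (sh X') (S * p')) c"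
    using ti unfolding triangle_iso_def triangle_mor_def std_def by auto
  have ob: "Z \<in> Obj C" "v \<in> Hom C Y Z" "w \<in> Hom C Z (sh X)"
    using tr by (simp_all add: is_triangle_def)
  have shob: "sh X \<in> Obj C" "sh X' \<in> Obj C" using sh_obj D D' by blast+
  obtain k where k: "is_iso C K K' k" "Cmp C Y K K' k (kl Y K i) = Cmp C Y Y' K' (kl Y' K' i') b"
    "Cmp C K K' (sh X') (kl K' (sh X') (S * p')) k
      = Cmp C K (sh X) (sh X') (shA a) (kl K (sh X) (S * p))"
    using cone_map_iso[OF K K' a b sq(1)] by blast
  obtain k' where k': "k' \<in> Hom C K' K" "Cmp C K K' K k' k = Idt C K" "Cmp C K' K K' k k' = Idt C K'" "is_iso C K' K k'"
    using is_isoE[OF k(1)] by metis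
  obtain a' where a': "a' \<in> Hom C (sh X') (sh X)" "Cmp C (sh X) (sh X') (sh X) a' (shA a) = Idt C (sh X)"
    using is_isoE[OF is_iso_shA[OF D(7) D'(7) a]] by metis
  note H = is_iso_Hom[OF a] is_iso_Hom[OF b] is_iso_Hom[OF c] is_iso_Hom[OF k(1)]
    is_iso_Hom[OF is_iso_shA[OF D(7) D'(7) a]]
  have "is_iso C Z K (Cmp C Z K' K k' c)" using is_iso_Cmp[OF ob(1) D'(2) D(2) c k'(4)] .
  moreover have "Cmp C Y Z K (Cmp C Z K' K k' c) v = kl Y K i"
  proof -
    have "Cmp C Y Z K (Cmp C Z K' K k' c) v = Cmp C Y K' K k' (Cmp C Y Z K' c v)"
      using Cmp_assoc ob H k' D D' by metis
    also have "\<dots> = Cmp C Y K' K k' (Cmp C Y K K' k (kl Y K i))" using sq(2) k(2) by simp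
    also have "\<dots> = kl Y K i" using Cmp_assoc H k' D D' Zh Idt_Cmp by metis
    finally show ?thesis .
  qed
  moreover have "Cmp C Z K (sh X) (kl K (sh X) (S * p)) (Cmp C Z K' K k' c) = w"
  proof -
    have "Cmp C K' (sh X) (sh X') (shA a) (Cmp C K' K (sh X) (kl K (sh X) (S * p)) k')
       = Cmp C K' K (sh X') (Cmp C K (sh X) (sh X') (shA a) (kl K (sh X) (S * p))) k'"
      using Cmp_assoc H k' D D' Zh shob by metis
    also have "\<dots> = kl K' (sh X') (S * p')"
      unfolding k(3)[symmetric] using Cmp_assoc[of K' K K' "sh X'"] H k' D D' Zh shob Cmp_Idt by metis
    finally have pk: "Cmp C K' (sh X) (sh X') (shA a) (Cmp C K' K (sh X) (kl K (sh X) (S * p)) k') = kl K' (sh X') (S * p')" .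
    let ?l = "Cmp C Z K (sh X) (kl K (sh X) (S * p)) (Cmp C Z K' K k' c)"
    have l: "?l = Cmp C Z K' (sh X) (Cmp C K' K (sh X) (kl K (sh X) (S * p)) k') c"
      using Cmp_assoc H k' D D' Zh shob ob by metis
    have m: "Cmp C K' K (sh X) (kl K (sh X) (S * p)) k' \<in> Hom C K' (sh X)" "?l \<in> Hom C Z (sh X)"
      using Cmp_in H k' D D' Zh shob ob by metis+
    \<comment> \<open>The squares are known only after composing with \<open>shA a\<close>; its left
      inverse \<open>a'\<close> cancels it afterwards.\<close>
    have "Cmp C Z (sh X) (sh X') (shA a) ?l = Cmp C Z (sh X) (sh X') (shA a) w"
      unfolding l sq(3) pk[symmetric] using Cmp_assoc H m D D' shob ob by metis
    hence "Cmp C Z (sh X') (sh X) a' (Cmp C Z (sh X) (sh X') (shA a) ?l)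
        = Cmp C Z (sh X') (sh X) a' (Cmp C Z (sh X) (sh X') (shA a) w)" by simp
    thus ?thesis
      using Cmp_assoc[OF ob(1) shob(1,2,1) m(2) H(5) a'(1)] Cmp_assoc[OF ob(1) shob(1,2,1) ob(3) H(5) a'(1)]
        a'(2) Idt_Cmp ob shob m by metis
  qed
  ultimately show ?thesis by blast
qed

lemma std_DistI:
  assumes tr: "is_triangle C sh (X, Y, Z, kl X Y u, v, w)" and K: "cone X Y u K i j p q"
    and c: "is_iso C Z K c" "Cmp C Y Z K c v = kl Y K i" "Cmp C Z K (sh X) (kl K (sh X) (S * p)) c = w"
  shows "(X, Y, Z, kl X Y u, v, w) \<in> Dist"
  unfolding Dist_iff
  using triangle_isoI_third[OF tr std_triangle[OF K, unfolded std_def] c] tr K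
  unfolding std_def by blast

section \<open>Verdier's axioms\<close>

lemma Dist_triangle: "T \<in> Dist \<Longrightarrow> is_triangle C sh T"
  by (simp add: Dist_def)

lemma triangle_Neg:
  assumes "is_triangle C sh (X, Y, Z, u, v, w)"
  shows "is_triangle C sh (Y, Z, sh X, v, w, Neg C (sh X) (sh Y) (shA u))"
proof -
  obtain u0 where "u0 \<in> Zc X Y" "u = kl X Y u0"
    using assms by (auto simp: is_triangle_def elim: HomE)
  thus ?thesis
    using assms sh_obj by (auto simp: is_triangle_def kl_sh Neg_kl Zc_sh kl_in Zc_neg)
qed

text \<open>Replacing \<open>Z\<close> by a cone on a representative of \<open>u\<close> turns the
  rotated triangle into the one that \<open>rot_iso_std\<close> identifies with a cone
  triangle.\<close>

lemma Dist_rotate: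
  assumes T: "(X, Y, Z, u, v, w) \<in> Dist"
  shows "(Y, Z, sh X, v, w, Neg C (sh X) (sh Y) (shA u)) \<in> Dist"
proof -
  have tr: "is_triangle C sh (X, Y, Z, u, v, w)" using T by (rule Dist_triangle)
  then obtain u0 where u0: "u0 \<in> Zc X Y" "u = kl X Y u0"
    by (auto simp: is_triangle_def elim: HomE)
  obtain K i j p q where K: "cone X Y u0 K i j p q" using ex_cone[OF u0(1)] by blast
  obtain c where c: "is_iso C Z K c" "Cmp C Y Z K c v = kl Y K i"
    "Cmp C Z K (sh X) (kl K (sh X) (S * p)) c = w"
    using Dist_cone[OF T[unfolded u0(2)] K] by blast
  have Nu: "Neg C (sh X) (sh Y) (shA u) = kl (sh X) (sh Y) (- (S * u0 * S'))"
    using u0 by (simp add: kl_sh Neg_kl Zc_sh)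
  have tr': "is_triangle C sh (Y, Z, sh X, v, w, kl (sh X) (sh Y) (- (S * u0 * S')))"
    using triangle_Neg[OF tr] Nu by simp
  have i: "triangle_iso C sh shA (Y, Z, sh X, v, w, kl (sh X) (sh Y) (- (S * u0 * S')))
     (Y, K, sh X, kl Y K i, kl K (sh X) (S * p), kl (sh X) (sh Y) (- (S * u0 * S')))"
    by (rule triangle_isoI_second[OF tr' rot_triangle[OF K] c])
  obtain K2 I J P Q where K2: "cone Y K i K2 I J P Q" using ex_cone[OF cone_i[OF K]] by blast
  have "triangle_iso C sh shA (Y, Z, sh X, v, w, kl (sh X) (sh Y) (- (S * u0 * S'))) (std Y K i K2 I P)"
    using triangle_iso_trans[OF tr' rot_triangle[OF K] std_triangle[OF K2] i rot_iso_std[OF K K2]] .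
  thus ?thesis unfolding Nu Dist_iff using tr' K2 by blast
qed

text \<open>The hypothesis is about the third rotation of \<open>(X, Y, Z, u, v, w)\<close>: all
  vertices shifted, all arrows shifted and negated. Desuspending a cone on the negated first arrow
  gives a cone on \<open>u\<close> itself, since \<open>cone_unsh\<close> introduces a second
  sign.\<close>

lemma Dist_unshift:
  assumes T: "(sh X, sh Y, sh Z, Neg C (sh X) (sh Y) (shA u), Neg C (sh Y) (sh Z) (shA v),
      Neg C (sh Z) (sh (sh X)) (shA w)) \<in> Dist"
    and tr: "is_triangle C sh (X, Y, Z, u, v, w)"
  shows "(X, Y, Z, u, v, w) \<in> Dist"
proof -
  have ob: "X \<in> Obj C" "Y \<in> Obj C" "Z \<in> Obj C" using tr by (simp_all add: is_triangle_def)
  have shob: "sh X \<in> Obj C" "sh Y \<in> Obj C" "sh Z \<in> Obj C" "sh (sh X) \<in> Obj C" using ob sh_obj by blast+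
  obtain u0 where u0: "u0 \<in> Zc X Y" "u = kl X Y u0"
    using tr by (auto simp: is_triangle_def elim: HomE)
  obtain v0 where v0: "v0 \<in> Zc Y Z" "v = kl Y Z v0"
    using tr by (auto simp: is_triangle_def elim: HomE)
  obtain w0 where w0: "w0 \<in> Zc Z (sh X)" "w = kl Z (sh X) w0"
    using tr shob by (auto simp: is_triangle_def elim: HomE)
  note T' = T[unfolded u0(2) v0(2) w0(2), unfolded kl_sh[OF u0(1)] kl_sh[OF v0(1)] kl_sh[OF w0(1)]
      Neg_kl[OF Zc_sh[OF u0(1)]] Neg_kl[OF Zc_sh[OF v0(1)]] Neg_kl[OF Zc_sh[OF w0(1)]]]
  have u1: "- (S * u0 * S') \<in> Zc (sh X) (sh Y)" using Zc_neg Zc_sh u0 by blast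
  obtain K1 i j p q where K1: "cone (sh X) (sh Y) (- (S * u0 * S')) K1 i j p q"
    using ex_cone[OF u1] by blast
  obtain K where K: "K \<in> Obj C" "sh K = K1" using sh_surj coneD(2)[OF K1] by blast
  note K1 = K1[folded K(2)]
  note Z1 = cone_i[OF K1] cone_p[OF K1]
  obtain c where c: "is_iso C (sh Z) (sh K) c"
    "Cmp C (sh Y) (sh Z) (sh K) c (kl (sh Y) (sh Z) (- (S * v0 * S'))) = kl (sh Y) (sh K) i"
    "Cmp C (sh Z) (sh K) (sh (sh X)) (kl (sh K) (sh (sh X)) (S * p)) c = kl (sh Z) (sh (sh X)) (- (S * w0 * S'))"
    using Dist_cone[OF T' K1] by blast
  have shK: "sh K \<in> Obj C" using K sh_obj by blast
  obtain c0 where c0: "c0 \<in> Zc (sh Z) (sh K)" "c = kl (sh Z) (sh K) c0"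
    using HomE[OF is_iso_Hom[OF c(1)] shob(3) shK] by metis
  obtain c' where c': "c' \<in> Hom C (sh K) (sh Z)" "Cmp C (sh Z) (sh K) (sh Z) c' c = Idt C (sh Z)"
    "Cmp C (sh K) (sh Z) (sh K) c c' = Idt C (sh K)" using is_isoE[OF c(1)] by metis
  obtain c0' where c0': "c0' \<in> Zc (sh K) (sh Z)" "c' = kl (sh K) (sh Z) c0'"
    using HomE[OF c'(1) shK shob(3)] by metis
  have h: "htp (sh Z) (sh Z) (c0' * c0) (e (sh Z))" "htp (sh K) (sh K) (c0 * c0') (e (sh K))"
    "htp (sh Y) (sh K) (c0 * (- (S * v0 * S'))) i"
    "htp (sh Z) (sh (sh X)) (S * p * c0) (- (S * w0 * S'))"
    using c' c c0 c0' Z1 shob shK Zc_neg[OF Zc_sh[OF v0(1)]] Zc_neg[OF Zc_sh[OF w0(1)]]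
      Zc_comp[OF Zc_neg[OF Zc_sh[OF v0(1)]] c0(1)]
    by (simp_all add: kl_Cmp kl_Idt kl_eq Zc_comp Zc_e)
  \<comment> \<open>The sign of \<open>k\<close> absorbs those in front of \<open>v\<close> and
    \<open>w\<close>; the sign of \<open>u\<close> has already been absorbed by
    \<open>cone_unsh\<close>.\<close>
  define k where "k = - (S' * c0 * S)"
  define k' where "k' = - (S' * c0' * S)"
  have k: "k \<in> Zc Z K" "k' \<in> Zc K Z"
    unfolding k_def k'_def using Zc_neg Zc_unsh ob K c0 c0' by blast+
  have eq: "k' * k = S' * (c0' * c0) * S" "k * k' = S' * (c0 * c0') * S"
    "k * v0 = S' * (c0 * (- (S * v0 * S'))) * S" "p * S * k = - (S' * (S * p * c0) * S)"
    "e Z = S' * e (sh Z) * S" "e K = S' * e (sh K) * S" "w0 = - (S' * (- (S * w0 * S')) * S)"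
    unfolding k_def k'_def e_sh[OF ob(3)] e_sh[OF K(1)] by (simp_all add: ring_rules)
  have hk: "htp Z Z (k' * k) (e Z)" "htp K K (k * k') (e K)" "htp Y K (k * v0) (S' * i * S)"
    unfolding eq(1-3) eq(5,6) using htp_unsh h ob K by blast+
  have "htp Z (sh X) (- (S' * (S * p * c0) * S)) (- (S' * (- (S * w0 * S')) * S))"
    using htp_neg[OF htp_unsh[OF ob(3) shob(1) h(4)]] .
  hence hw: "htp Z (sh X) (p * S * k) w0" unfolding eq(4)[symmetric] eq(7)[symmetric] .
  have K0: "cone X Y (- (S' * (- (S * u0 * S')) * S)) K (S' * i * S) (S' * j * S) (S' * p * S) (S' * q * S)"
    by (rule cone_unsh[OF ob(1,2) K(1) K1])
  have "- (S' * (- (S * u0 * S')) * S) = u0" by (simp add: ring_rules)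
  note K0 = K0[unfolded this]
  have Sp: "S * (S' * p * S) = p * S" by (simp add: ring_rules)
  note Z0 = cone_i[OF K0] cone_p[OF K0, unfolded Sp]
  show ?thesis unfolding u0(2)
  proof (rule std_DistI[OF _ K0])
    show "is_triangle C sh (X, Y, Z, kl X Y u0, v, w)" using tr u0 by simp
    show "is_iso C Z K (kl Z K k)" using kl_isoI[OF k hk(1,2)] .
    show "Cmp C Y Z K (kl Z K k) v = kl Y K (S' * i * S)"
      unfolding v0(2) using k v0 hk Z0 by (simp add: kl_Cmp kl_eq Zc_comp)
    show "Cmp C Z K (sh X) (kl K (sh X) (S * (S' * p * S))) (kl Z K k) = w"
      unfolding Sp w0(2) using k w0 hw Z0 by (simp add: kl_Cmp kl_eq Zc_comp)
  qed
qed

text \<open>A fill-in exists between cones on representatives; it is transported to \<open>Z\<close>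
  and \<open>Z'\<close> along the comparison isomorphisms of \<open>Dist_cone\<close>.\<close>

lemma Dist_TR3:
  assumes T: "(X, Y, Z, u, v, w) \<in> Dist" and T': "(X', Y', Z', u', v', w') \<in> Dist"
    and a: "a \<in> Hom C X X'" and b: "b \<in> Hom C Y Y'"
    and sq: "Cmp C X Y Y' b u = Cmp C X X' Y' u' a"
  shows "\<exists>c. triangle_mor C sh shA (X, Y, Z, u, v, w) (X', Y', Z', u', v', w') a b c"
proof -
  have tr: "is_triangle C sh (X, Y, Z, u, v, w)" "is_triangle C sh (X', Y', Z', u', v', w')"
    using T T' Dist_triangle by blast+
  have m: "v \<in> Hom C Y Z" "w \<in> Hom C Z (sh X)" "v' \<in> Hom C Y' Z'" "w' \<in> Hom C Z' (sh X')"
    and ob: "X \<in> Obj C" "Y \<in> Obj C" "Z \<in> Obj C" "X' \<in> Obj C" "Y' \<in> Obj C" "Z' \<in> Obj C" "sh X \<in> Obj C" "sh X' \<in> Obj C"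
    using tr sh_obj by (auto simp: is_triangle_def)
  obtain u0 where u0: "u0 \<in> Zc X Y" "u = kl X Y u0"
    using tr(1) by (auto simp: is_triangle_def elim: HomE)
  obtain u0' where u0': "u0' \<in> Zc X' Y'" "u' = kl X' Y' u0'"
    using tr(2) by (auto simp: is_triangle_def elim: HomE)
  obtain K i j p q where K: "cone X Y u0 K i j p q" using ex_cone[OF u0(1)] by blast
  obtain K' i' j' p' q' where K': "cone X' Y' u0' K' i' j' p' q'" using ex_cone[OF u0'(1)] by blast
  note obK = coneD(2)[OF K] coneD(2)[OF K']
  note Zh = cone_i[OF K, THEN kl_in] cone_p[OF K, THEN kl_in] cone_i[OF K', THEN kl_in] cone_p[OF K', THEN kl_in]
  obtain k where k: "is_iso C Z K k" "Cmp C Y Z K k v = kl Y K i"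
    "Cmp C Z K (sh X) (kl K (sh X) (S * p)) k = w"
    using Dist_cone[OF T[unfolded u0(2)] K] by blast
  obtain k' where k': "is_iso C Z' K' k'" "Cmp C Y' Z' K' k' v' = kl Y' K' i'"
    "Cmp C Z' K' (sh X') (kl K' (sh X') (S * p')) k' = w'"
    using Dist_cone[OF T'[unfolded u0'(2)] K'] by blast
  obtain l where l: "l \<in> Hom C K' Z'" "Cmp C Z' K' Z' l k' = Idt C Z'" "Cmp C K' Z' K' k' l = Idt C K'"
    using is_isoE[OF k'(1)] by metis
  obtain c where c: "c \<in> Hom C K K'" "Cmp C Y K K' c (kl Y K i) = Cmp C Y Y' K' (kl Y' K' i') b"
    "Cmp C K K' (sh X') (kl K' (sh X') (S * p')) c
      = Cmp C K (sh X) (sh X') (shA a) (kl K (sh X) (S * p))"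
    using cone_map_arrow[OF K K' a b] sq u0 u0' by blast
  note H = is_iso_Hom[OF k(1)] is_iso_Hom[OF k'(1)] shA_in[OF ob(1,4) a]
  define t where "t = Cmp C Z K Z' (Cmp C K K' Z' l c) k"
  have lc: "Cmp C K K' Z' l c \<in> Hom C K Z'" using Cmp_in obK ob c l by blast
  have "t \<in> Hom C Z Z'" unfolding t_def using Cmp_in obK ob lc H by blast
  moreover have "Cmp C Y Z Z' t v = Cmp C Y Y' Z' v' b"
  proof -
    have "Cmp C Y Z Z' t v = Cmp C Y K Z' (Cmp C K K' Z' l c) (kl Y K i)"
      unfolding t_def k(2)[symmetric] using Cmp_assoc ob obK H m lc by metis
    also have "\<dots> = Cmp C Y Y' Z' (Cmp C Y' K' Z' l (kl Y' K' i')) b"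
      using Cmp_assoc c l ob obK Zh b by metis
    also have "Cmp C Y' K' Z' l (kl Y' K' i') = v'"
      unfolding k'(2)[symmetric] using Cmp_assoc l ob obK H m Idt_Cmp by metis
    finally show ?thesis .
  qed
  moreover have "Cmp C Z (sh X) (sh X') (shA a) w = Cmp C Z Z' (sh X') w' t"
  proof -
    have wl: "Cmp C K' Z' (sh X') w' l = kl K' (sh X') (S * p')"
      unfolding k'(3)[symmetric] using Cmp_assoc[of K' Z' K' "sh X'"] l ob obK H Zh Cmp_Idt by metis
    have "Cmp C Z Z' (sh X') w' t = Cmp C Z K (sh X') (Cmp C K K' (sh X') (Cmp C K' Z' (sh X') w' l) c) k"
      unfolding t_def using Cmp_assoc l lc c ob obK H m by metis
    also have "\<dots> = Cmp C Z (sh X) (sh X') (shA a) w"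
      unfolding wl c(3) k(3)[symmetric] using Cmp_assoc ob obK H Zh by metis
    finally show ?thesis by simp
  qed
  ultimately show ?thesis unfolding triangle_mor_def prod.case using a b sq by blast
qed

text \<open>Two further rotations of the hypothesis reach the signed shift of the original triangle,
  and \<open>Dist_unshift\<close> removes shift and signs.\<close>

lemma Dist_rotate_back:
  assumes "is_triangle C sh (X, Y, Z, u, v, w)" "(Y, Z, sh X, v, w, Neg C (sh X) (sh Y) (shA u)) \<in> Dist"
  shows "(X, Y, Z, u, v, w) \<in> Dist"
  using Dist_unshift[OF Dist_rotate[OF Dist_rotate[OF assms(2)]] assms(1)] .

text \<open>The vertex \<open>K2\<close> is not the cone on \<open>f\<close> but homotopy equivalent
  to it by \<theta>. The identity \<open>P * \<theta> = i1 * p2\<close> then yields the third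
  arrow.\<close>

lemma octahedron_Dist:
  assumes K1: "cone X Y u K1 i1 j1 p1 q1" and K2: "cone Y Z v K2 i2 j2 p2 q2"
    and K3: "cone X Z (v * u) K3 i3 j3 p3 q3"
  defines "f \<equiv> i3 * v * j1 + q3 * p1" and "g \<equiv> i2 * j3 + q2 * u * p3"
  shows "(K1, K3, K2, kl K1 K3 f, kl K3 K2 g, kl K2 (sh K1) (S * (i1 * p2))) \<in> Dist"
proof -
  note M = cone_octahedron_maps[OF K1 K2 K3, folded f_def g_def]
  note D1 = coneD[OF K1] and D2 = coneD[OF K2] and D3 = coneD[OF K3]
  obtain K I J P Q where K: "cone K1 K3 f K I J P Q" using ex_cone[OF M(1)] by blast
  note R = cone_octahedron[OF K1 K2 K3 K[unfolded f_def], folded g_def]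
  define \<theta> where "\<theta> = I * i3 * j2 + Q * i1 * p2"
  define \<psi> where "\<psi> = g * J + q2 * j1 * P"
  note R = R[folded \<theta>_def \<psi>_def]
  note D = coneD[OF K]
  have h: "htp K2 K2 (\<psi> * \<theta>) (e K2)" using R(3) htp_refl D2(2) by simp
  have iso: "is_iso C K2 K (kl K2 K \<theta>)" using kl_isoI[OF R(2,1) h R(4)] .
  have "htp K3 K (\<theta> * \<psi> * I) (e K * I)" using R(4) cone_i[OF K] by (rule htp_right)
  hence "htp K3 K (\<theta> * g) I" using R(5) Hm_e(1)[OF D(3)] by (simp add: mult.assoc)
  hence 1: "Cmp C K3 K2 K (kl K2 K \<theta>) (kl K3 K2 g) = kl K3 K I"
    using R(2) M(2) cone_i[OF K] by (simp add: kl_Cmp kl_eq Zc_comp)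
  have 2: "Cmp C K2 K (sh K1) (kl K (sh K1) (S * P)) (kl K2 K \<theta>) = kl K2 (sh K1) (S * (i1 * p2))"
    using R(2,6) cone_p[OF K] by (simp add: kl_Cmp mult.assoc)
  have "S * (i1 * p2) \<in> Zc K2 (sh K1)"
    using Zc_comp[OF R(2) cone_p[OF K]] R(6) by (simp add: mult.assoc)
  hence "is_triangle C sh (K1, K3, K2, kl K1 K3 f, kl K3 K2 g, kl K2 (sh K1) (S * (i1 * p2)))"
    unfolding is_triangle_def using D1 D2 D3 M by (simp add: kl_in)
  thus ?thesis using K iso 1 2 by (rule std_DistI)
qed

text \<open>For cones on representatives \<open>u0\<close>, \<open>v0\<close> and the product
  \<open>v0 * u0\<close>, the octahedron is given by explicit matrices. By \<open>Dist_cone\<close>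
  the vertices \<open>Z'\<close>, \<open>X'\<close>, \<open>Y'\<close> are isomorphic to these cones
  over the identities of \<open>X\<close>, \<open>Y\<close>, \<open>Z\<close>, so \<open>f\<close>
  and \<open>g\<close> are the matrices conjugated by \<open>c1\<close>, \<open>c2\<close>,
  \<open>c3\<close>.\<close>

lemma Dist_TR4:
  assumes T1: "(X, Y, Z', u, j, k) \<in> Dist" and T2: "(Y, Z, X', v, l, i) \<in> Dist"
    and T3: "(X, Z, Y', Cmp C X Y Z v u, m, n) \<in> Dist"
  shows "\<exists>f\<in>Hom C Z' Y'. \<exists>g\<in>Hom C Y' X'.
            (Z', Y', X', f, g, Cmp C X' (sh Y) (sh Z') (shA j) i) \<in> Dist \<and>
            Cmp C Y Z' Y' f j = Cmp C Y Z Y' m v \<and>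
            Cmp C Z' Y' (sh X) n f = k \<and>
            Cmp C Z Y' X' g m = l \<and>
            Cmp C Y' X' (sh Y) i g = Cmp C Y' (sh X) (sh Y) (shA u) n"
proof -
  note tr = T1[THEN Dist_triangle] T2[THEN Dist_triangle] T3[THEN Dist_triangle]
  have ob: "X \<in> Obj C" "Y \<in> Obj C" "Z \<in> Obj C" "X' \<in> Obj C" "Y' \<in> Obj C" "Z' \<in> Obj C"
      "sh X \<in> Obj C" "sh Y \<in> Obj C" "sh Z' \<in> Obj C"
    and mor: "j \<in> Hom C Y Z'" "k \<in> Hom C Z' (sh X)" "l \<in> Hom C Z X'" "i \<in> Hom C X' (sh Y)"
      "m \<in> Hom C Z Y'" "n \<in> Hom C Y' (sh X)"
    using tr sh_obj by (auto simp: is_triangle_def)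
  obtain u0 where u0: "u0 \<in> Zc X Y" "u = kl X Y u0"
    using tr(1) by (auto simp: is_triangle_def elim: HomE)
  obtain v0 where v0: "v0 \<in> Zc Y Z" "v = kl Y Z v0"
    using tr(2) by (auto simp: is_triangle_def elim: HomE)
  have vu: "v0 * u0 \<in> Zc X Z" "Cmp C X Y Z v u = kl X Z (v0 * u0)"
    using u0 v0 by (simp_all add: Zc_comp kl_Cmp)
  obtain K1 i1 j1 p1 q1 where K1: "cone X Y u0 K1 i1 j1 p1 q1" using ex_cone[OF u0(1)] by blast
  obtain K2 i2 j2 p2 q2 where K2: "cone Y Z v0 K2 i2 j2 p2 q2" using ex_cone[OF v0(1)] by blast
  obtain K3 i3 j3 p3 q3 where K3: "cone X Z (v0 * u0) K3 i3 j3 p3 q3" using ex_cone[OF vu(1)] by blast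
  note obK = coneD(2)[OF K1] coneD(2)[OF K2] coneD(2)[OF K3]
  obtain c1 where c1: "is_iso C Z' K1 c1" "Cmp C Y Z' K1 c1 j = kl Y K1 i1"
    "Cmp C Z' K1 (sh X) (kl K1 (sh X) (S * p1)) c1 = k"
    using Dist_cone[OF T1[unfolded u0(2)] K1] by blast
  obtain c2 where c2: "is_iso C X' K2 c2" "Cmp C Z X' K2 c2 l = kl Z K2 i2"
    "Cmp C X' K2 (sh Y) (kl K2 (sh Y) (S * p2)) c2 = i"
    using Dist_cone[OF T2[unfolded v0(2)] K2] by blast
  obtain c3 where c3: "is_iso C Y' K3 c3" "Cmp C Z Y' K3 c3 m = kl Z K3 i3"
    "Cmp C Y' K3 (sh X) (kl K3 (sh X) (S * p3)) c3 = n"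
    using Dist_cone[OF T3[unfolded vu(2)] K3] by blast
  obtain d1 where d1: "d1 \<in> Hom C K1 Z'" "Cmp C Z' K1 Z' d1 c1 = Idt C Z'" "Cmp C K1 Z' K1 c1 d1 = Idt C K1"
    using is_isoE[OF c1(1)] by metis
  obtain d2 where d2: "d2 \<in> Hom C K2 X'" "Cmp C X' K2 X' d2 c2 = Idt C X'" "Cmp C K2 X' K2 c2 d2 = Idt C K2"
    using is_isoE[OF c2(1)] by metis
  obtain d3 where d3: "d3 \<in> Hom C K3 Y'" "Cmp C Y' K3 Y' d3 c3 = Idt C Y'" "Cmp C K3 Y' K3 c3 d3 = Idt C K3"
    using is_isoE[OF c3(1)] by metis
  define f0 where "f0 = i3 * v0 * j1 + q3 * p1"
  define g0 where "g0 = i2 * j3 + q2 * u0 * p3"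
  note M = cone_octahedron_maps[OF K1 K2 K3, folded f0_def g0_def]
  note Z1 = cone_i[OF K1] cone_p[OF K1] and Z2 = cone_i[OF K2] cone_p[OF K2] and Z3 = cone_i[OF K3] cone_p[OF K3]
  let ?f = "kl K1 K3 f0" and ?g = "kl K3 K2 g0"
  have fg: "?f \<in> Hom C K1 K3" "?g \<in> Hom C K3 K2" using M kl_in by blast+
  have e1: "Cmp C Y K1 K3 ?f (kl Y K1 i1) = Cmp C Y Z K3 (kl Z K3 i3) v"
    using M Z1 Z3 v0 by (simp add: kl_Cmp)
  have e2: "Cmp C K1 K3 (sh X) (kl K3 (sh X) (S * p3)) ?f = kl K1 (sh X) (S * p1)"
    using M Z1 Z3 by (simp add: kl_Cmp mult.assoc)
  have e3: "Cmp C Z K3 K2 ?g (kl Z K3 i3) = kl Z K2 i2"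
    using M Z2 Z3 by (simp add: kl_Cmp)
  have "S * u0 * S' * (S * p3) = S * p2 * g0" using M(6) by (simp add: ring_rules)
  hence e4: "Cmp C K3 K2 (sh Y) (kl K2 (sh Y) (S * p2)) ?g = Cmp C K3 (sh X) (sh Y) (shA u) (kl K3 (sh X) (S * p3))"
    using M Z2 Z3 u0 Zc_sh[OF u0(1)] by (simp add: kl_Cmp kl_sh)
  have "S * i1 * S' * (S * p2) = S * (i1 * p2)" by (simp add: ring_rules)
  hence e5: "Cmp C K2 (sh Y) (sh K1) (shA (kl Y K1 i1)) (kl K2 (sh Y) (S * p2)) = kl K2 (sh K1) (S * (i1 * p2))"
    using Z1 Z2 Zc_sh[OF Z1(1)] by (simp add: kl_Cmp kl_sh)
  have shK: "sh K1 \<in> Obj C" using obK sh_obj by blast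
  note Zh = Z1[THEN kl_in] Z2[THEN kl_in] Z3[THEN kl_in]
  note vh = v0(1)[THEN kl_in, folded v0(2)] and uh = u0(1)[THEN kl_in, folded u0(2)]
  note H = is_iso_Hom[OF c1(1)] is_iso_Hom[OF c2(1)] is_iso_Hom[OF c3(1)]
  note sH = shA_in[OF ob(2,6) mor(1)] shA_in[OF ob(6) obK(1) H(1)] shA_in[OF ob(1,2) uh]
    shA_in[OF ob(2) obK(1) Zh(1)]
  define f where "f = Cmp C Z' K1 Y' (Cmp C K1 K3 Y' d3 ?f) c1"
  define g where "g = Cmp C Y' K3 X' (Cmp C K3 K2 X' d2 ?g) c3"
  have df: "Cmp C K1 K3 Y' d3 ?f \<in> Hom C K1 Y'" and dg: "Cmp C K3 K2 X' d2 ?g \<in> Hom C K3 X'"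
    using Cmp_in obK ob d2 d3 fg by blast+
  have f: "f \<in> Hom C Z' Y'" and g: "g \<in> Hom C Y' X'"
    unfolding f_def g_def using Cmp_in obK ob df dg H by blast+
  have cf: "Cmp C Z' Y' K3 c3 f = Cmp C Z' K1 K3 ?f c1"
  proof -
    have "Cmp C Z' Y' K3 c3 f = Cmp C Z' K1 K3 (Cmp C K1 Y' K3 c3 (Cmp C K1 K3 Y' d3 ?f)) c1"
      unfolding f_def using Cmp_assoc ob obK H df by metis
    also have "Cmp C K1 Y' K3 c3 (Cmp C K1 K3 Y' d3 ?f) = ?f"
      using Cmp_assoc ob obK H fg d3 Idt_Cmp by metis
    finally show ?thesis .
  qed
  have cg: "Cmp C Y' X' K2 c2 g = Cmp C Y' K3 K2 ?g c3"
  proof -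
    have "Cmp C Y' X' K2 c2 g = Cmp C Y' K3 K2 (Cmp C K3 X' K2 c2 (Cmp C K3 K2 X' d2 ?g)) c3"
      unfolding g_def using Cmp_assoc ob obK H dg by metis
    also have "Cmp C K3 X' K2 c2 (Cmp C K3 K2 X' d2 ?g) = ?g"
      using Cmp_assoc ob obK H fg d2 Idt_Cmp by metis
    finally show ?thesis .
  qed
  have di: "Cmp C Z K3 Y' d3 (kl Z K3 i3) = m" "Cmp C Z K2 X' d2 (kl Z K2 i2) = l"
    unfolding c3(2)[symmetric] c2(2)[symmetric] using Cmp_assoc ob obK H mor d2 d3 Idt_Cmp by metis+
  have fj: "Cmp C Y Z' Y' f j = Cmp C Y Z Y' m v"
  proof -
    have "Cmp C Y Z' Y' f j = Cmp C Y K1 Y' (Cmp C K1 K3 Y' d3 ?f) (kl Y K1 i1)"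
      unfolding f_def c1(2)[symmetric] using Cmp_assoc ob obK H mor df by metis
    also have "\<dots> = Cmp C Y K3 Y' d3 (Cmp C Y Z K3 (kl Z K3 i3) v)"
      unfolding e1[symmetric] using Cmp_assoc ob obK Zh fg d3 by metis
    also have "\<dots> = Cmp C Y Z Y' m v"
      unfolding di(1)[symmetric] using Cmp_assoc ob obK Zh d3 vh by metis
    finally show ?thesis .
  qed
  have nf: "Cmp C Z' Y' (sh X) n f = k"
  proof -
    have "Cmp C Z' Y' (sh X) n f = Cmp C Z' K3 (sh X) (kl K3 (sh X) (S * p3)) (Cmp C Z' Y' K3 c3 f)"
      unfolding c3(3)[symmetric] using Cmp_assoc ob obK H Zh f by metis
    also have "\<dots> = k"
      unfolding cf c1(3)[symmetric] e2[symmetric] using Cmp_assoc ob obK H Zh fg by metis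
    finally show ?thesis .
  qed
  have gm: "Cmp C Z Y' X' g m = l"
  proof -
    have "Cmp C Z Y' X' g m = Cmp C Z K3 X' (Cmp C K3 K2 X' d2 ?g) (kl Z K3 i3)"
      unfolding g_def c3(2)[symmetric] using Cmp_assoc ob obK H mor dg by metis
    also have "\<dots> = Cmp C Z K2 X' d2 (kl Z K2 i2)"
      unfolding e3[symmetric] using Cmp_assoc ob obK Zh fg d2 by metis
    finally show ?thesis unfolding di(2) .
  qed
  have ig: "Cmp C Y' X' (sh Y) i g = Cmp C Y' (sh X) (sh Y) (shA u) n"
  proof -
    have "Cmp C Y' X' (sh Y) i g = Cmp C Y' K2 (sh Y) (kl K2 (sh Y) (S * p2)) (Cmp C Y' X' K2 c2 g)"
      unfolding c2(3)[symmetric] using Cmp_assoc ob obK H Zh g by metis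
    also have "\<dots> = Cmp C Y' K3 (sh Y) (Cmp C K3 K2 (sh Y) (kl K2 (sh Y) (S * p2)) ?g) c3"
      unfolding cg using Cmp_assoc ob obK H Zh fg by metis
    also have "\<dots> = Cmp C Y' (sh X) (sh Y) (shA u) n"
      unfolding e4 c3(3)[symmetric] using Cmp_assoc ob obK H Zh sH by metis
    finally show ?thesis .
  qed
  have ji: "Cmp C X' (sh Y) (sh Z') (shA j) i \<in> Hom C X' (sh Z')" using Cmp_in ob sH mor by blast
  have oct: "(K1, K3, K2, ?f, ?g, kl K2 (sh K1) (S * (i1 * p2))) \<in> Dist"
    using octahedron_Dist[OF K1 K2 K3] unfolding f0_def g0_def .
  have tri: "is_triangle C sh (Z', Y', X', f, g, Cmp C X' (sh Y) (sh Z') (shA j) i)"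
    unfolding is_triangle_def using ob f g ji by simp
  have "Cmp C X' (sh Z') (sh K1) (shA c1) (Cmp C X' (sh Y) (sh Z') (shA j) i)
      = Cmp C X' K2 (sh K1) (kl K2 (sh K1) (S * (i1 * p2))) c2"
  proof -
    have "Cmp C (sh Y) (sh Z') (sh K1) (shA c1) (shA j) = shA (kl Y K1 i1)"
      unfolding c1(2)[symmetric] using shA_Cmp ob obK mor H by metis
    hence "Cmp C X' (sh Z') (sh K1) (shA c1) (Cmp C X' (sh Y) (sh Z') (shA j) i)
      = Cmp C X' (sh Y) (sh K1) (shA (kl Y K1 i1)) i"
      using Cmp_assoc ob shK mor sH by metis
    also have "\<dots> = Cmp C X' K2 (sh K1) (kl K2 (sh K1) (S * (i1 * p2))) c2"
      unfolding c2(3)[symmetric] e5[symmetric] using Cmp_assoc ob obK shK H sH Zh by metis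
    finally show ?thesis .
  qed
  \<comment> \<open>The three squares are \<open>cf\<close>, \<open>cg\<close> and the identity just
    proved.\<close>
  hence "triangle_iso C sh shA (Z', Y', X', f, g, Cmp C X' (sh Y) (sh Z') (shA j) i)
    (K1, K3, K2, ?f, ?g, kl K2 (sh K1) (S * (i1 * p2)))"
    unfolding triangle_iso_def triangle_mor_def prod.case using cf cg c1(1) c2(1) c3(1) H by blast
  hence "(Z', Y', X', f, g, Cmp C X' (sh Y) (sh Z') (shA j) i) \<in> Dist"
    using Dist_iso[OF oct tri] triangle_iso_sym[OF tri Dist_triangle[OF oct]] by blast
  thus ?thesis using f g fj nf gm ig by blast
qed

text \<open>The cone on an identity is contractible, hence a zero object, hence isomorphic to
  \<open>Z\<close> by the zero arrow. The remaining equations compare arrows into or out of zero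
  objects.\<close>

lemma Dist_TR1_id:
  assumes X: "X \<in> Obj C" and Z: "is_zero_object C Z"
  shows "(X, X, Z, Idt C X, Zer C X Z, Zer C Z (sh X)) \<in> Dist"
proof -
  have obZ: "Z \<in> Obj C" "sh X \<in> Obj C" using Z X sh_obj by (auto simp: is_zero_object_def)
  obtain K i j p q where K: "cone X X (e X) K i j p q" using ex_cone[OF Zc_e[OF X]] by blast
  note D = coneD[OF K]
  have K0: "is_zero_object C K" using zero_object_iff[OF D(2)] cone_contractible[OF K] by blast
  have uni: "f = g" if "is_zero_object C W" "V \<in> Obj C" "f \<in> Hom C V W" "g \<in> Hom C V W" for V W f g
    using that unfolding is_zero_object_def by blast
  have uni': "f = g" if "is_zero_object C W" "V \<in> Obj C" "f \<in> Hom C W V" "g \<in> Hom C W V" for V W f g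
    using that unfolding is_zero_object_def by blast
  have z: "Zer C A B \<in> Hom C A B" if "A \<in> Obj C" "B \<in> Obj C" for A B
    using that by (simp add: kl_Zer kl_in Zc_0)
  have "is_iso C Z K (Zer C Z K)"
    unfolding is_iso_def using obZ D uni[OF Z] uni[OF K0] z Idt_in Cmp_in by metis
  moreover have "Cmp C X Z K (Zer C Z K) (Zer C X Z) = kl X K i"
    using uni[OF K0] obZ D X z Cmp_in kl_in[OF cone_i[OF K]] by metis
  moreover have "Cmp C Z K (sh X) (kl K (sh X) (S * p)) (Zer C Z K) = Zer C Z (sh X)"
    using uni'[OF Z] obZ D X z Cmp_in kl_in[OF cone_p[OF K]] by metis
  moreover have "is_triangle C sh (X, X, Z, kl X X (e X), Zer C X Z, Zer C Z (sh X))"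
    unfolding is_triangle_def using X obZ z kl_in[OF Zc_e] by simp
  ultimately show ?thesis
    unfolding kl_Idt[OF X] using std_DistI[OF _ K] by blast
qed

theorem triangulated: "triangulated_category C sh shA Dist"
proof (unfold_locales, goal_cases)
  case 1 show ?case by (rule sh_bij)
next
  case (2 X Y) thus ?case by (rule shA_bij)
next
  case (3 X) thus ?case by (rule shA_Idt)
next
  case (4 X Y Z f g) thus ?case by (rule shA_Cmp)
next
  case (5 X Y f f') thus ?case by (rule shA_Add)
next
  case (6 T) thus ?case by (rule Dist_triangle)
next
  case (7 T T') thus ?case by (rule Dist_iso)
next
  case (8 X Z) thus ?case by (rule Dist_TR1_id)
next
  case (9 X Y u)
  then obtain u0 where u0: "u0 \<in> Zc X Y" "u = kl X Y u0" using HomE by metis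
  obtain K i j p q where K: "cone X Y u0 K i j p q" using ex_cone[OF u0(1)] by blast
  show ?case using std_Dist[OF K] unfolding std_def u0(2) by blast
next
  case (10 X Y Z u v w) thus ?case using Dist_rotate Dist_rotate_back by blast
next
  case (11 X Y Z u v w X' Y' Z' u' v' w' a b) thus ?case by (rule Dist_TR3)
next
  case (12 X Y Z' u j k Z X' v l i Y' m n) thus ?case by (rule Dist_TR4)
qed

end

section \<open>Additive endomorphisms and projections\<close>

text \<open>The ambient ring of the dg model. Additivity makes composition distribute over sums on
  both sides; linearity over power series is part of the condition for lying in
  \<open>HmS\<close>.\<close>

typedef (overloaded) 'a aend = "{f :: 'a::ab_group_add \<Rightarrow> 'a. \<forall>x y. f (x + y) = f x + f y}"
  morphisms app Aend
  by (rule exI[of _ "\<lambda>x. x"]) simp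

lemma app_add: "app f (x + y) = app f x + app f y"
  using app[of f] by simp

lemma app_Aend: "(\<And>x y. f (x + y) = f x + f y) \<Longrightarrow> app (Aend f) = f"
  by (simp add: Aend_inverse)

lemma aend_eqI: "(\<And>x. app f x = app g x) \<Longrightarrow> f = g"
  by (simp add: app_inject[symmetric] fun_eq_iff)

instantiation aend :: (ab_group_add) "{ring, monoid_mult}"
begin

definition "0 = Aend (\<lambda>x. 0 :: 'a)"
definition "1 = Aend (\<lambda>x. x :: 'a)"
definition "f + g = Aend (\<lambda>x. app f x + app g x)" for f g :: "'a aend"
definition "f - g = Aend (\<lambda>x. app f x - app g x)" for f g :: "'a aend"
definition "- f = Aend (\<lambda>x. - app f x)" for f :: "'a aend"
definition "f * g = Aend (\<lambda>x. app f (app g x))" for f g :: "'a aend"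

lemma app_simps [simp]:
  "app 0 x = (0 :: 'a)" "app 1 x = x"
  "app (f + g) x = app f x + app g x" "app (f - g) x = app f x - app g x"
  "app (- f) x = - app f x" "app (f * g) x = app f (app g x)"
  unfolding zero_aend_def one_aend_def plus_aend_def minus_aend_def uminus_aend_def times_aend_def
  by (subst app_Aend; simp add: app_add)+

instance
  by standard (auto intro!: aend_eqI simp: app_add add.assoc add.commute)

end

lemma sum_fun_app: "(\<Sum>k\<in>I. g k) x = (\<Sum>k\<in>I. g k x)" for g :: "'a \<Rightarrow> 'c \<Rightarrow> 'd::comm_monoid_add"
  by (induction I rule: infinite_finite_induct) auto

section \<open>Projections onto subspaces\<close>

definition cscale :: "'k::field \<Rightarrow> ('b, 's, 'k) hcofree \<Rightarrow> ('b, 's, 'k) hcofree" where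
  "cscale c F = (\<lambda>n w. vscale c (F n w))"

lemma cscale_vector_space: "vector_space (cscale :: 'k::field \<Rightarrow> ('b, 's, 'k) hcofree \<Rightarrow> _)"
  by unfold_locales (auto simp: cscale_def vscale_def fun_eq_iff algebra_simps)

definition is_hsub :: "('b, 's, 'k::field) hcofree set \<Rightarrow> bool" where
  "is_hsub W \<longleftrightarrow> 0 \<in> W \<and> (\<forall>F\<in>W. \<forall>G\<in>W. F + G \<in> W) \<and> (\<forall>c. \<forall>F\<in>W. cscale c F \<in> W)"

text \<open>The projection is chosen over the field, where every subspace has a complement; no
  compatibility with \<hbar> is asked of it. It only serves to extend maps from a comodule to all
  functions.\<close>

definition proj :: "('b, 's, 'k::field) hcofree set \<Rightarrow> ('b, 's, 'k) hcofree \<Rightarrow> ('b, 's, 'k) hcofree" where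
  "proj W = (SOME P. (\<forall>x y. P (x + y) = P x + P y) \<and> range P \<subseteq> W \<and> (\<forall>x\<in>W. P x = x))"

lemma proj_props:
  fixes W :: "('b, 's, 'k::field) hcofree set"
  assumes "is_hsub W"
  shows "proj W (x + y) = proj W x + proj W y" "proj W x \<in> W" "x \<in> W \<Longrightarrow> proj W x = x"
proof -
  interpret V: vector_space "cscale :: 'k \<Rightarrow> ('b, 's, 'k) hcofree \<Rightarrow> _" by (rule cscale_vector_space)
  interpret VP: vector_space_pair "cscale :: 'k \<Rightarrow> ('b, 's, 'k) hcofree \<Rightarrow> _" "cscale :: 'k \<Rightarrow> ('b, 's, 'k) hcofree \<Rightarrow> _" ..
  have "V.subspace W" using assms unfolding is_hsub_def V.subspace_def by blast
  \<comment> \<open>A left inverse of the identity on \<open>W\<close> whose range lies in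
    \<open>W\<close> is a projection onto \<open>W\<close>.\<close>
  then obtain P where "range P \<subseteq> W" "Vector_Spaces.linear cscale cscale P" "\<forall>x\<in>W. P x = x"
    using VP.linear_exists_left_inverse_on[OF V.linear_ident, of W] by auto
  hence "(\<forall>x y. P (x + y) = P x + P y) \<and> range P \<subseteq> W \<and> (\<forall>x\<in>W. P x = x)"
    using VP.linear_add by (metis (no_types, lifting))
  hence "(\<forall>x y. proj W (x + y) = proj W x + proj W y) \<and> range (proj W) \<subseteq> W \<and> (\<forall>x\<in>W. proj W x = x)"
    unfolding proj_def
    by (rule someI[where P = "\<lambda>P. (\<forall>x y. P (x + y) = P x + P y) \<and> range P \<subseteq> W \<and> (\<forall>x\<in>W. P x = x)"])
  thus "proj W (x + y) = proj W x + proj W y" "proj W x \<in> W" "x \<in> W \<Longrightarrow> proj W x = x" by auto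
qed

lemma vscale_simps [simp]: "vscale c 0 = 0" "vscale 0 x = 0" "vscale 1 x = x"
  by (auto simp: vscale_def fun_eq_iff)

lemma vscale_distrib: "vscale c (x + y) = vscale c x + vscale c y"
  by (auto simp: vscale_def fun_eq_iff algebra_simps)

lemma vscale_neg: "vscale (- c) x = - vscale c x" "vscale c (- x) = - vscale c x"
  by (auto simp: vscale_def fun_eq_iff)

lemma hscale_X_power: "hscale (fps_X ^ m) F = (\<lambda>k w. if k < m then 0 else F (k - m) w)"
proof (intro ext, goal_cases)
  case (1 k w s)
  have "hscale (fps_X ^ m) F k w = (\<Sum>l\<le>k. if l = m then F (k - l) w else 0)"
    unfolding hscale_def by (intro sum.cong refl) (simp add: fps_X_power_nth)
  thus ?case by (simp add: sum.delta not_less)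
qed

lemma hscale_const: "hscale (fps_const c) F = cscale c F"
proof (intro ext, goal_cases)
  case (1 k w s)
  have "hscale (fps_const c) F k w = (\<Sum>l\<le>k. if l = 0 then vscale c (F k w) else 0)"
    unfolding hscale_def by (intro sum.cong refl) simp
  thus ?case by (simp add: cscale_def)
qed

section \<open>Graded linear maps and comodule maps over a fixed algebra\<close>

locale halg_ctxt =
  fixes A :: "('b, 'k::field) halg"
  assumes uni_bas: "uni A \<in> bas A" and uni_deg: "cdeg A (uni A) = 0" "wdeg A (uni A) = 0"
begin

abbreviation sub_mod :: "('b, 's, 'k) hmod \<Rightarrow> bool" where
  "sub_mod M \<equiv> \<forall>i j. is_subspace (spc M i j)"

lemma comodI:
  assumes "\<And>n. finite {w. F n w \<noteq> 0}"
    and "\<And>n w. w \<in> lists (bas A) \<Longrightarrow> F n w \<in> spc M (i + 1 - word_cdeg A w) (j - word_wdeg A w)"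
    and "\<And>n w. w \<notin> lists (bas A) \<Longrightarrow> F n w = 0"
  shows "F \<in> comod A M i j"
  using assms by (simp add: comod_def)

lemma comodD:
  assumes "F \<in> comod A M i j"
  shows "finite {w. F n w \<noteq> 0}"
    "w \<in> lists (bas A) \<Longrightarrow> F n w \<in> spc M (i + 1 - word_cdeg A w) (j - word_wdeg A w)"
    "w \<notin> lists (bas A) \<Longrightarrow> F n w = 0"
  using assms by (auto simp: comod_def split: if_splits)

lemma comod_zero: "sub_mod M \<Longrightarrow> 0 \<in> comod A M i j"
  by (rule comodI) (simp_all add: is_subspace_def)

lemma comod_add:
  assumes M: "sub_mod M" and F: "F \<in> comod A M i j" and G: "G \<in> comod A M i j"
  shows "F + G \<in> comod A M i j"
proof (rule comodI)
  fix n
  have "{w. (F + G) n w \<noteq> 0} \<subseteq> {w. F n w \<noteq> 0} \<union> {w. G n w \<noteq> 0}" by auto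
  thus "finite {w. (F + G) n w \<noteq> 0}"
    using comodD(1)[OF F, of n] comodD(1)[OF G, of n] finite_subset by blast
qed (use M comodD(2,3)[OF F] comodD(2,3)[OF G] in \<open>auto simp: is_subspace_def\<close>)

lemma spc_sum:
  assumes "is_subspace V" "\<And>k. k \<in> I \<Longrightarrow> x k \<in> V" shows "sum x I \<in> V"
  using assms(2) by (induction I rule: infinite_finite_induct) (use assms(1) in \<open>auto simp: is_subspace_def\<close>)

lemma comod_hscale:
  assumes M: "sub_mod M" and F: "F \<in> comod A M i j"
  shows "hscale c F \<in> comod A M i j"
proof (rule comodI)
  fix n
  have "{w. hscale c F n w \<noteq> 0} \<subseteq> (\<Union>k\<le>n. {w. F (n - k) w \<noteq> 0})"
  proof
    fix w assume "w \<in> {w. hscale c F n w \<noteq> 0}"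
    then obtain k where "k \<le> n" "vscale (fps_nth c k) (F (n - k) w) \<noteq> 0"
      unfolding hscale_def by (metis (mono_tags, lifting) atMost_iff mem_Collect_eq sum.neutral)
    thus "w \<in> (\<Union>k\<le>n. {w. F (n - k) w \<noteq> 0})" by auto
  qed
  thus "finite {w. hscale c F n w \<noteq> 0}"
    by (rule finite_subset) (use comodD(1)[OF F] in blast)
next
  fix n w assume "w \<in> lists (bas A)"
  thus "hscale c F n w \<in> spc M (i + 1 - word_cdeg A w) (j - word_wdeg A w)"
    unfolding hscale_def using M comodD(2)[OF F]
    by (intro spc_sum) (auto simp: is_subspace_def)
next
  fix n w assume "w \<notin> lists (bas A)"
  thus "hscale c F n w = 0"
    unfolding hscale_def using comodD(3)[OF F] by simp
qed

lemma comod_cscale: "sub_mod M \<Longrightarrow> F \<in> comod A M i j \<Longrightarrow> cscale c F \<in> comod A M i j"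
  using comod_hscale[of M F i j "fps_const c"] by (simp add: hscale_const)

lemma neg_cscale: "- F = cscale (- 1) F"
  by (auto simp: cscale_def vscale_def fun_eq_iff)

lemma comod_neg: "sub_mod M \<Longrightarrow> F \<in> comod A M i j \<Longrightarrow> - F \<in> comod A M i j"
  using comod_cscale neg_cscale by metis

lemma comod_diff: "sub_mod M \<Longrightarrow> F \<in> comod A M i j \<Longrightarrow> G \<in> comod A M i j \<Longrightarrow> F - G \<in> comod A M i j"
  using comod_add[of M F i j "- G"] comod_neg[of M G i j] by simp

lemma comod_hsub: "sub_mod M \<Longrightarrow> is_hsub (comod A M i j)"
  unfolding is_hsub_def using comod_zero comod_add comod_cscale by blast

lemma comod_sum: "sub_mod M \<Longrightarrow> (\<And>l. l \<in> I \<Longrightarrow> F l \<in> comod A M i j) \<Longrightarrow> sum F I \<in> comod A M i j"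
  by (induction I rule: infinite_finite_induct) (auto simp: comod_zero comod_add)

lemma word_deg_append:
  "word_cdeg A (u @ v) = word_cdeg A u + word_cdeg A v" "word_wdeg A (u @ v) = word_wdeg A u + word_wdeg A v"
  by (simp_all add: word_cdeg_def word_wdeg_def)

lemma word_deg_Nil [simp]: "word_cdeg A [] = 0" "word_wdeg A [] = 0"
  by (simp_all add: word_cdeg_def word_wdeg_def)

lemma comod_coact:
  assumes F: "F \<in> comod A M i j" and v: "v \<in> lists (bas A)"
  shows "coact v F \<in> comod A M (i - word_cdeg A v) (j - word_wdeg A v)"
proof (rule comodI)
  fix n
  have "(\<lambda>u. u @ v) ` {u. F n (u @ v) \<noteq> 0} \<subseteq> {w. F n w \<noteq> 0}" by auto
  hence "finite ((\<lambda>u. u @ v) ` {u. F n (u @ v) \<noteq> 0})" using comodD(1)[OF F] finite_subset by blast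
  hence "finite {u. F n (u @ v) \<noteq> 0}" by (rule finite_imageD) (simp add: inj_on_def)
  thus "finite {w. coact v F n w \<noteq> 0}" by (simp add: coact_def)
next
  fix n w assume "w \<in> lists (bas A)"
  thus "coact v F n w \<in> spc M (i - word_cdeg A v + 1 - word_cdeg A w) (j - word_wdeg A v - word_wdeg A w)"
    using comodD(2)[OF F, of "w @ v" n] v by (simp add: coact_def word_deg_append algebra_simps)
next
  fix n w assume "w \<notin> lists (bas A)"
  thus "coact v F n w = 0" using comodD(3)[OF F, of "w @ v" n] v by (simp add: coact_def)
qed

lemma coact_simps:
  "coact v (F + G) = coact v F + coact v G" "coact v (- F) = - coact v F" "coact v 0 = 0"
  "coact v (F - G) = coact v F - coact v G"
  by (auto simp: coact_def fun_eq_iff)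

lemma hlinearD:
  assumes "hlinear A M N r f" "F \<in> comod A M i j"
  shows "f i j F \<in> comod A N (i + r) j"
    "G \<in> comod A M i j \<Longrightarrow> f i j (F + G) = f i j F + f i j G"
    "f i j (hscale c F) = hscale c (f i j F)"
  using assms unfolding hlinear_def by blast+

lemma hlinear_more:
  assumes f: "hlinear A M N r f" and M: "sub_mod M"
  shows "f i j 0 = 0" "F \<in> comod A M i j \<Longrightarrow> f i j (- F) = - f i j F"
    "F \<in> comod A M i j \<Longrightarrow> G \<in> comod A M i j \<Longrightarrow> f i j (F - G) = f i j F - f i j G"
proof -
  have "f i j (0 + 0) = f i j 0 + f i j 0"
    using hlinearD(2)[OF f] comod_zero[OF M] by blast
  thus 0: "f i j 0 = 0" by simp
  show neg: "f i j (- F) = - f i j F" if "F \<in> comod A M i j" for F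
  proof -
    have "f i j (F + (- F)) = f i j F + f i j (- F)"
      using that hlinearD(2)[OF f] comod_neg[OF M] by blast
    thus ?thesis using 0 by (simp add: eq_neg_iff_add_eq_0 add.commute)
  qed
  show "F \<in> comod A M i j \<Longrightarrow> G \<in> comod A M i j \<Longrightarrow> f i j (F - G) = f i j F - f i j G"
    using hlinearD(2)[OF f, of F i j "- G"] comod_neg[OF M] neg by simp
qed

lemma hlinear_sum:
  assumes f: "hlinear A M N r f" and M: "sub_mod M" and F: "\<And>l. l \<in> I \<Longrightarrow> F l \<in> comod A M i j"
  shows "f i j (sum F I) = (\<Sum>l\<in>I. f i j (F l))"
  using F
proof (induction I rule: infinite_finite_induct)
  case (insert x I)
  have "sum F I \<in> comod A M i j" using comod_sum[OF M, of I F i j] insert.prems by blast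
  hence "f i j (F x + sum F I) = f i j (F x) + f i j (sum F I)"
    using hlinearD(2)[OF f, of "F x" i j "sum F I"] insert.prems by blast
  moreover have "f i j (sum F I) = (\<Sum>l\<in>I. f i j (F l))" using insert by blast
  ultimately show ?case unfolding sum.insert[OF insert.hyps(1,2)] by (simp add: plus_fun_def)
qed (auto simp: hlinear_more[OF f M])

text \<open>This is \<hbar>-adic continuity, a consequence of linearity over power series: elements
  that agree up to order \<open>n\<close> differ by \<open>\<hbar>^(n+1)\<close> times an element
  \<open>H\<close> of the comodule.\<close>

lemma hlinear_cong_upto:
  assumes f: "hlinear A M N r f" and M: "sub_mod M"
    and F: "F \<in> comod A M i j" and G: "G \<in> comod A M i j" and eq: "\<And>k. k \<le> n \<Longrightarrow> F k = G k"
  shows "f i j F n = f i j G n"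
proof -
  define H where "H = (\<lambda>k. (F - G) (k + Suc n))"
  have FG: "F - G \<in> comod A M i j" by (rule comod_diff[OF M F G])
  have H: "H \<in> comod A M i j" using FG unfolding comod_def H_def by blast
  have "F - G = hscale (fps_X ^ Suc n) H"
    unfolding hscale_X_power H_def by (auto simp: fun_eq_iff eq less_Suc_eq_le)
  hence "f i j (F - G) = hscale (fps_X ^ Suc n) (f i j H)"
    using hlinearD(3)[OF f H] by metis
  hence "f i j (F - G) n = 0"
    unfolding hscale_X_power by (simp add: zero_fun_def)
  thus ?thesis using hlinear_more(3)[OF f M F G] by simp
qed

definition len_part :: "nat \<Rightarrow> ('b, 's, 'k) hcofree \<Rightarrow> ('b, 's, 'k) hcofree" where
  "len_part l F = (\<lambda>n w. if length w = l then F n w else 0)"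

lemma len_part_comod: "sub_mod M \<Longrightarrow> F \<in> comod A M i j \<Longrightarrow> len_part l F \<in> comod A M i j"
  by (rule comodI) (auto simp: len_part_def is_subspace_def dest: comodD elim: finite_subset[rotated, OF comodD(1)])

lemma len_part_of_length: "len_part l F \<in> of_length l"
  by (simp add: len_part_def of_length_def)

lemma len_part_with_unit: "F \<in> with_unit A \<Longrightarrow> len_part l F \<in> with_unit A"
  by (auto simp: len_part_def with_unit_def)

text \<open>Taylor components test elements of a single word length, but the lengths in
  \<open>F\<close> may grow with the power of \<hbar>, so \<open>F\<close> need not be a finite sum
  of its length parts. Up to order \<open>n\<close> it is one, and continuity then determines the
  coefficient of \<open>\<hbar>^n\<close>.\<close>

lemma hlinear_len_parts:
  assumes f: "hlinear A M N r f" and M: "sub_mod M" and F: "F \<in> comod A M i j"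
    and 0: "\<And>l. corestr (f i j (len_part l F)) = 0"
  shows "corestr (f i j F) = 0"
proof
  fix n
  have "finite (length ` (\<Union>k\<le>n. {w. F k w \<noteq> 0}))" using comodD(1)[OF F] by blast
  then obtain L where L: "\<forall>l\<in>length ` (\<Union>k\<le>n. {w. F k w \<noteq> 0}). l \<le> L"
    using finite_nat_set_iff_bounded_le by blast
  define G where "G = (\<Sum>l\<le>L. len_part l F)"
  have lp: "\<And>l. len_part l F \<in> comod A M i j" using len_part_comod[OF M F] .
  have G: "G \<in> comod A M i j" unfolding G_def by (rule comod_sum[OF M lp])
  have "F k = G k" if "k \<le> n" for k
  proof
    fix w
    have "G k w = (\<Sum>l\<le>L. if length w = l then F k w else 0)"
      unfolding G_def sum_fun_app len_part_def ..
    also have "\<dots> = (if length w \<le> L then F k w else 0)" by simp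
    also have "\<dots> = F k w" using L that by force
    finally show "F k w = G k w" ..
  qed
  hence "f i j F n = f i j G n" using hlinear_cong_upto[OF f M F G] by blast
  also have "f i j G = (\<Sum>l\<le>L. f i j (len_part l F))"
    unfolding G_def by (rule hlinear_sum[OF f M lp])
  finally have "f i j F n [] = (\<Sum>l\<le>L. corestr (f i j (len_part l F)) n)"
    by (simp add: sum_fun_app corestr_def fun_eq_iff)
  also have "\<dots> = 0" unfolding 0 by simp
  finally show "corestr (f i j F) n = 0 n" by (simp add: corestr_def)
qed

lemma unital_corestr:
  assumes f: "hlinear A M N r f" and M: "sub_mod M" and u: "unital_map A M f"
    and F: "F \<in> comod A M i j" "F \<in> with_unit A"
  shows "corestr (f i j F) = 0"
proof (rule hlinear_len_parts[OF f M F(1)])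
  fix l
  show "corestr (f i j (len_part l F)) = 0"
  proof (cases "l = 0")
    case True
    \<comment> \<open>Length zero is outside the scope of \<open>unital_map\<close>, but the empty
      word contains no unit, so this part of \<open>F\<close> vanishes.\<close>
    have "len_part l F = 0"
      using F(2) True by (auto simp: len_part_def with_unit_def fun_eq_iff) (metis list.set(1) empty_iff zero_fun_def)
    hence "f i j (len_part l F) = 0" using hlinear_more(1)[OF f M] by metis
    thus ?thesis unfolding corestr_def by (simp add: zero_fun_def)
  next
    case False
    hence "1 \<le> l" by simp
    thus ?thesis
      using u len_part_comod[OF M F(1)] len_part_of_length len_part_with_unit[OF F(2)]
      unfolding unital_map_def by blast
  qed
qed

lemma comodule_mapD:
  assumes "comodule_map A M N r f"
  shows "hlinear A M N r f"
    "F \<in> comod A M i j \<Longrightarrow> v \<in> lists (bas A) \<Longrightarrow> coact v (f i j F) = f (i - word_cdeg A v) (j - word_wdeg A v) (coact v F)"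
  using assms unfolding comodule_map_def by blast+

text \<open>Together with compatibility with \<open>coact\<close>, this identity says that a
  comodule map is determined by its corestriction.\<close>

lemma coeff_corestr: "F n v = corestr (coact v F) n"
  by (simp add: coact_def corestr_def)

text \<open>If a word \<open>v\<close> of the image contained no unit, then every word of
  \<open>coact v F\<close> would still contain one, and unitality would make the coefficient at
  \<open>v\<close> zero. This gives closure of unital maps under composition.\<close>

lemma unital_preserves:
  assumes f: "comodule_map A M N r f" and M: "sub_mod M" and u: "unital_map A M f"
    and F: "F \<in> comod A M i j" "F \<in> with_unit A"
  shows "f i j F \<in> with_unit A"
  unfolding with_unit_def
proof (intro CollectI allI impI)
  fix n v assume nz: "f i j F n v \<noteq> 0"
  note fD = comodule_mapD[OF f]
  have v: "v \<in> lists (bas A)" using nz comodD(3)[OF hlinearD(1)[OF fD(1) F(1)]] by blast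
  show "uni A \<in> set v"
  proof (rule ccontr)
    assume "uni A \<notin> set v"
    moreover have "uni A \<in> set (u @ v)" if "F n (u @ v) \<noteq> 0" for n u
      using F(2) that by (simp add: with_unit_def del: set_append)
    ultimately have "coact v F \<in> with_unit A" by (auto simp: with_unit_def coact_def)
    hence "corestr (f (i - word_cdeg A v) (j - word_wdeg A v) (coact v F)) = 0"
      using unital_corestr[OF fD(1) M u comod_coact[OF F(1) v]] by blast
    thus False using nz coeff_corestr[of "f i j F" n v] fD(2)[OF F(1) v] by simp
  qed
qed

lemma hlinear_comp:
  assumes f: "hlinear A M N r f" and g: "hlinear A N P s g"
  shows "hlinear A M P (r + s) (\<lambda>i j F. g (i + r) j (f i j F))"
  unfolding hlinear_def
  using hlinearD[OF f] hlinearD[OF g] by (simp add: add.assoc[symmetric])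

lemma comodule_map_comp:
  assumes f: "comodule_map A M N r f" and g: "comodule_map A N P s g"
  shows "comodule_map A M P (r + s) (\<lambda>i j F. g (i + r) j (f i j F))"
  unfolding comodule_map_def
  using hlinear_comp[OF comodule_mapD(1)[OF f] comodule_mapD(1)[OF g]]
    comodule_mapD(2)[OF f] comodule_mapD(2)[OF g] hlinearD(1)[OF comodule_mapD(1)[OF f]]
  by (simp add: algebra_simps)

lemma unital_comp:
  assumes f: "comodule_map A M N r f" and M: "sub_mod M" and uf: "unital_map A M f"
    and g: "comodule_map A N P s g" and N: "sub_mod N" and ug: "unital_map A N g"
  shows "unital_map A M (\<lambda>i j F. g (i + r) j (f i j F))"
  unfolding unital_map_def
  using unital_corestr[OF comodule_mapD(1)[OF g] N ug] unital_preserves[OF f M uf]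
    hlinearD(1)[OF comodule_mapD(1)[OF f]] by blast

lemma hscale_simps:
  "hscale c (F + G) = hscale c F + hscale c G" "hscale c (- F) = - hscale c F" "hscale c 0 = 0"
  by (auto simp: hscale_def vscale_def fun_eq_iff sum_fun_app sum.distrib algebra_simps sum_negf)

end

section \<open>Cones of modules\<close>

definition lin :: "(('s \<Rightarrow> 'k::field) \<Rightarrow> 's \<Rightarrow> 'k) \<Rightarrow> bool" where
  "lin \<phi> \<longleftrightarrow> (\<forall>x y. \<phi> (x + y) = \<phi> x + \<phi> y) \<and> (\<forall>c x. \<phi> (vscale c x) = vscale c (\<phi> x))"

text \<open>The strict comodule map with the given zeroth component; all inclusions and projections
  of cones have this form.\<close>

definition lmap :: "(('s \<Rightarrow> 'k) \<Rightarrow> 's \<Rightarrow> 'k) \<Rightarrow> ('b, 's, 'k) hcofree \<Rightarrow> ('b, 's, 'k) hcofree" where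
  "lmap \<phi> F = (\<lambda>n w. \<phi> (F n w))"

lemma linD:
  assumes "lin \<phi>"
  shows "\<phi> (x + y) = \<phi> x + \<phi> y" "\<phi> (vscale c x) = vscale c (\<phi> x)" "\<phi> 0 = 0" "\<phi> (- x) = - \<phi> x"
    "\<phi> (x - y) = \<phi> x - \<phi> y"
proof -
  show 1: "\<phi> (x + y) = \<phi> x + \<phi> y" and 2: "\<phi> (vscale c x) = vscale c (\<phi> x)" for x y c
    using assms by (simp_all add: lin_def)
  show "\<phi> 0 = 0" using 2[of 0 0] by simp
  show 3: "\<phi> (- x) = - \<phi> x" for x using 2[of "-1" x] by (simp add: vscale_neg)
  show "\<phi> (x - y) = \<phi> x - \<phi> y" using 1[of x "- y"] 3 by simp
qed

lemma lin_sum: "lin \<phi> \<Longrightarrow> \<phi> (sum x I) = (\<Sum>k\<in>I. \<phi> (x k))"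
  by (induction I rule: infinite_finite_induct) (auto simp: linD)

lemma lmap_simps:
  assumes "lin \<phi>"
  shows "lmap \<phi> (F + G) = lmap \<phi> F + lmap \<phi> G" "lmap \<phi> (- F) = - lmap \<phi> F" "lmap \<phi> 0 = 0"
    "lmap \<phi> (F - G) = lmap \<phi> F - lmap \<phi> G"
    "lmap \<phi> (hscale c F) = hscale c (lmap \<phi> F)" "lmap \<phi> (pure m w) = pure (\<lambda>n. \<phi> (m n)) w"
    "lmap \<phi> (coact v F) = coact v (lmap \<phi> F)" "corestr (lmap \<phi> F) = (\<lambda>n. \<phi> (corestr F n))"
  by (intro ext; simp add: lmap_def linD[OF assms] lin_sum[OF assms] hscale_def pure_def coact_def corestr_def)+

lemma lmap_support: "lin \<phi> \<Longrightarrow> lmap \<phi> F n w \<noteq> 0 \<Longrightarrow> F n w \<noteq> 0"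
  unfolding lmap_def using linD(3) by metis

lemma lmap_id: "lmap (\<lambda>x. x) F = F"
  by (simp add: lmap_def)

lemma lin_id: "lin (\<lambda>x. x)"
  by (simp add: lin_def)

definition fin_supp :: "('b, 's, 'k::zero) hcofree \<Rightarrow> bool" where
  "fin_supp F \<longleftrightarrow> (\<forall>n. finite {w. F n w \<noteq> 0})"

lemma fin_supp_append: "fin_supp F \<Longrightarrow> finite {v. F n (u @ v) \<noteq> 0}"
proof -
  assume "fin_supp F"
  moreover have "(\<lambda>v. u @ v) ` {v. F n (u @ v) \<noteq> 0} \<subseteq> {w. F n w \<noteq> 0}" by auto
  ultimately have "finite ((\<lambda>v. u @ v) ` {v. F n (u @ v) \<noteq> 0})"
    unfolding fin_supp_def using finite_subset by blast
  thus ?thesis by (rule finite_imageD) (simp add: inj_on_def)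
qed

text \<open>The inner sum of \<open>id_bar\<close> runs over the support of \<open>F\<close>, which
  varies with \<open>F\<close>. A common finite index set makes the sums for different elements
  comparable.\<close>

lemma id_bar_superset:
  assumes "\<And>k. finite (V k)" "\<And>k v'. F (n - k) (u @ v') \<noteq> 0 \<Longrightarrow> v' \<in> V k"
  shows "id_bar A i F n u v = (\<Sum>k\<le>n. \<Sum>v'\<in>V k.
     vscale (ksgn (i - word_cdeg A v') * bar_coeff A k v' v) (F (n - k) (u @ v')))"
  unfolding id_bar_def
  by (intro sum.cong refl sum.mono_neutral_left) (use assms in auto)

lemma id_bar_add:
  assumes F: "fin_supp F" and G: "fin_supp G"
  shows "id_bar A i (F + G) n u v = id_bar A i F n u v + id_bar A i G n u v"
proof -
  define V where "V = (\<lambda>k. {v. F (n - k) (u @ v) \<noteq> 0} \<union> {v. G (n - k) (u @ v) \<noteq> 0})"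
  have V: "finite (V k)" for k unfolding V_def using fin_supp_append F G by blast
  show ?thesis
    by (subst (1 2 3) id_bar_superset[where V = V]; (rule V)?)
      (auto simp: V_def vscale_distrib sum.distrib)
qed

lemma id_bar_lmap:
  assumes \<phi>: "lin \<phi>" and F: "fin_supp F"
  shows "id_bar A i (lmap \<phi> F) n u v = \<phi> (id_bar A i F n u v)"
proof -
  define V where "V = (\<lambda>k. {v. F (n - k) (u @ v) \<noteq> 0})"
  have V: "finite (V k)" for k unfolding V_def using fin_supp_append F by blast
  have "id_bar A i (lmap \<phi> F) n u v = (\<Sum>k\<le>n. \<Sum>v'\<in>V k.
     vscale (ksgn (i - word_cdeg A v') * bar_coeff A k v' v) (lmap \<phi> F (n - k) (u @ v')))"
    by (rule id_bar_superset[OF V]) (auto simp: V_def dest: lmap_support[OF \<phi>])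
  also have "\<dots> = \<phi> (id_bar A i F n u v)"
    unfolding id_bar_def V_def by (simp add: lin_sum[OF \<phi>] linD[OF \<phi>] lmap_def)
  finally show ?thesis .
qed

lemma ksgn_plus1: "ksgn (i + 1) = - (ksgn i :: 'k::ring_1)"
  by (simp add: ksgn_def)

text \<open>Moving \<open>d_A\<close> past an element whose degree has changed by one flips the
  Koszul sign; it is this flip that the minus sign in the shifted differential compensates.\<close>

lemma id_bar_shift:
  fixes A :: "('b, 'k::field) halg"
  shows "id_bar A (i + 1) F n u v = - id_bar A i F n u v"
proof -
  have "ksgn (i + 1 - word_cdeg A w) = (- ksgn (i - word_cdeg A w) :: 'k)" for w
    using ksgn_plus1[of "i - word_cdeg A w"] by (simp add: algebra_simps)
  thus ?thesis unfolding id_bar_def by (simp add: vscale_neg sum_negf)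
qed

text \<open>Modules live in \<open>'s \<Rightarrow> 'k\<close> for a fixed type \<open>'s\<close>.
  The direct sum of two of them has coordinates in \<open>'s + 's\<close>, and only the infinity of
  \<open>'s\<close> allows these to be encoded in \<open>'s\<close> again.\<close>

lemma ex_sum_bij:
  includes cardinal_syntax
  shows "\<exists>f :: 's::infinite + 's \<Rightarrow> 's. bij f"
proof -
  have "|UNIV <+> UNIV :: ('s + 's) set| =o |UNIV :: 's set|"
    using card_of_Plus_infinite1[OF infinite_UNIV card_of_mono1[OF subset_UNIV]] by blast
  hence "|UNIV :: ('s + 's) set| =o |UNIV :: 's set|" by simp
  thus ?thesis using card_of_ordIso by blast
qed

definition sum_code :: "'s::infinite + 's \<Rightarrow> 's" where
  "sum_code = (SOME f. bij f)"

lemma sum_code_bij: "bij sum_code"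
  unfolding sum_code_def using ex_sum_bij by (rule someI_ex)

definition inl :: "('s \<Rightarrow> 'k) \<Rightarrow> 's::infinite \<Rightarrow> 'k::field" where
  "inl x = (\<lambda>s. case inv_into UNIV sum_code s of Inl t \<Rightarrow> x t | Inr t \<Rightarrow> 0)"
definition inr :: "('s \<Rightarrow> 'k) \<Rightarrow> 's::infinite \<Rightarrow> 'k::field" where
  "inr x = (\<lambda>s. case inv_into UNIV sum_code s of Inl t \<Rightarrow> 0 | Inr t \<Rightarrow> x t)"
definition prl :: "('s \<Rightarrow> 'k) \<Rightarrow> 's::infinite \<Rightarrow> 'k::field" where
  "prl x = (\<lambda>t. x (sum_code (Inl t)))"
definition prr :: "('s \<Rightarrow> 'k) \<Rightarrow> 's::infinite \<Rightarrow> 'k::field" where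
  "prr x = (\<lambda>t. x (sum_code (Inr t)))"

lemma inv_sum_code: "inv_into UNIV sum_code (sum_code x) = x" "sum_code (inv_into UNIV sum_code s) = s"
  by (rule inv_f_f[OF bij_is_inj[OF sum_code_bij]], rule surj_f_inv_f[OF bij_is_surj[OF sum_code_bij]])

lemma inl_lin: "lin inl" "lin inr" "lin prl" "lin prr"
  by (auto simp: lin_def inl_def inr_def prl_def prr_def vscale_def fun_eq_iff split: sum.splits)

lemma prl_inl [simp]: "prl (inl x) = x" "prr (inr x) = x" "prl (inr x) = 0" "prr (inl x) = 0"
  by (auto simp: inl_def inr_def prl_def prr_def inv_sum_code fun_eq_iff)

lemma inl_prl: "inl (prl x) + inr (prr x) = x"
  by (auto simp: inl_def inr_def prl_def prr_def fun_eq_iff split: sum.splits) (metis inv_sum_code(2))+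

lemma lmap_inl [simp]: "lmap prl (lmap inl F) = F" "lmap prr (lmap inr F) = F" "lmap prl (lmap inr F) = 0"
  "lmap prr (lmap inl F) = 0" "lmap inl (lmap prl F) + lmap inr (lmap prr F) = F"
  by (auto simp: lmap_def fun_eq_iff simp flip: plus_fun_apply) (simp add: inl_prl)

text \<open>The upper triangular matrix with diagonal \<open>d_Y\<close>, \<open>- d_X\<close> and
  corner \<open>u\<close> on \<open>Y \<oplus> X[1]\<close>. The summand of \<open>X\<close> sits
  one degree higher, whence \<open>i + 1\<close>, and its sign is that of
  \<open>shift_mod\<close>.\<close>

definition cone_mod :: "('b, 's, 'k) hmod \<Rightarrow> ('b, 's, 'k) hmod \<Rightarrow> ('b, 's, 'k) hmap \<Rightarrow> ('b, 's::infinite, 'k::field) hmod" where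
  "cone_mod X Y u = \<lparr>spc = (\<lambda>i j. {z. prl z \<in> spc Y i j \<and> prr z \<in> spc X (i + 1) j}),
     dif = (\<lambda>i j F. lmap inl (dif Y i j (lmap prl F) + u (i + 1) j (lmap prr F)) - lmap inr (dif X (i + 1) j (lmap prr F)))\<rparr>"

lemma corestr_simps:
  "corestr (F + G) = corestr F + corestr G" "corestr (F - G) = corestr F - corestr G"
  "corestr (- F) = - corestr F" "corestr 0 = 0"
  by (auto simp: corestr_def fun_eq_iff)

context halg_ctxt
begin

lemma comod_fin_supp: "F \<in> comod A M i j \<Longrightarrow> fin_supp F"
  by (simp add: fin_supp_def comod_def)

lemma comod_pure:
  assumes "sub_mod M" "m \<in> hspc M p q" "w \<in> lists (bas A)" "p = i + 1 - word_cdeg A w" "q = j - word_wdeg A w"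
  shows "pure m w \<in> comod A M i j"
proof (rule comodI)
  fix n
  have "{w'. pure m w n w' \<noteq> 0} \<subseteq> {w}" by (auto simp: pure_def)
  thus "finite {w'. pure m w n w' \<noteq> 0}" using finite_subset by blast
qed (use assms in \<open>auto simp: pure_def hspc_def is_subspace_def\<close>)

lemma comod_lmap:
  assumes \<phi>: "lin \<phi>" and sp: "\<And>p q. \<phi> ` spc M p q \<subseteq> spc N (p + r) q"
    and F: "F \<in> comod A M i j" and i': "i' = i + r"
  shows "lmap \<phi> F \<in> comod A N i' j"
proof (rule comodI)
  fix n
  have "{w. lmap \<phi> F n w \<noteq> 0} \<subseteq> {w. F n w \<noteq> 0}" using lmap_support[OF \<phi>] by blast
  thus "finite {w. lmap \<phi> F n w \<noteq> 0}" using comodD(1)[OF F] finite_subset by blast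
next
  fix n w assume "w \<in> lists (bas A)"
  hence "\<phi> (F n w) \<in> spc N (i + 1 - word_cdeg A w + r) (j - word_wdeg A w)"
    using comodD(2)[OF F] sp by blast
  thus "lmap \<phi> F n w \<in> spc N (i' + 1 - word_cdeg A w) (j - word_wdeg A w)"
    by (simp add: lmap_def i' algebra_simps)
next
  fix n w assume "w \<notin> lists (bas A)"
  thus "lmap \<phi> F n w = 0" using comodD(3)[OF F] linD(3)[OF \<phi>] by (simp add: lmap_def)
qed

lemma comodule_map_lmap:
  assumes "lin \<phi>" "\<And>p q. \<phi> ` spc M p q \<subseteq> spc N (p + r) q"
  shows "comodule_map A M N r (\<lambda>i j. lmap \<phi>)"
  unfolding comodule_map_def hlinear_def
  by (auto simp: lmap_simps[OF assms(1)] intro!: comod_lmap[OF assms])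

lemma of_length_corestr: "F \<in> of_length l \<Longrightarrow> 1 \<le> l \<Longrightarrow> F n [] = 0"
  unfolding of_length_def by (metis (mono_tags, lifting) list.size(3) mem_Collect_eq not_one_le_zero)

lemma strict_lmap: "lin \<phi> \<Longrightarrow> strict_map A M (\<lambda>i j. lmap \<phi>)"
  unfolding strict_map_def corestr_def lmap_def
  by (auto simp: of_length_corestr linD(3) zero_fun_def[symmetric] simp del: One_nat_def)

lemma strict_unital: "strict_map A M f \<Longrightarrow> unital_map A M f"
  unfolding strict_map_def unital_map_def by blast

lemma tfD:
  assumes "M \<in> tf_modules A"
  shows "sub_mod M" "codifferential A M" "unital_module A M" "hlinear A M M 1 (dif M)"
    "F \<in> comod A M i j \<Longrightarrow> v \<in> lists (bas A) \<Longrightarrow>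
      coact v (dif M i j F) = dif M (i - word_cdeg A v) (j - word_wdeg A v) (coact v F) + (\<lambda>n u. id_bar A i F n u v)"
    "F \<in> comod A M i j \<Longrightarrow> dif M (i + 1) j (dif M i j F) = 0"
  using assms unfolding tf_modules_def codifferential_def by blast+

lemma tf_morD:
  assumes "f \<in> tf_morphisms A M N"
  shows "comodule_map A M N 0 f" "unital_map A M f" "hlinear A M N 0 f"
    "F \<in> comod A M i j \<Longrightarrow> f (i + 1) j (dif M i j F) = dif N i j (f i j F)"
    "F \<in> comod A M i j \<Longrightarrow> f i j F \<in> comod A N i j"
proof -
  show 1: "comodule_map A M N 0 f" "unital_map A M f"
    "F \<in> comod A M i j \<Longrightarrow> f (i + 1) j (dif M i j F) = dif N i j (f i j F)"
    using assms unfolding tf_morphisms_def by blast+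
  show "hlinear A M N 0 f" using comodule_mapD(1)[OF 1(1)] .
  thus "F \<in> comod A M i j \<Longrightarrow> f i j F \<in> comod A N i j" using hlinearD(1)[of M N 0 f] by fastforce
qed

lemma comod_shift_mod: "comod A (shift_mod M) i j = comod A M (i + 1) j"
  unfolding comod_def shift_mod_def by (simp add: algebra_simps)

context
  fixes X Y :: "('b, 's::infinite, 'k) hmod" and u
  assumes X: "X \<in> tf_modules A" and Y: "Y \<in> tf_modules A" and u: "u \<in> tf_morphisms A X Y"
begin

private abbreviation "K \<equiv> cone_mod X Y u"

lemma cone_spc:
  "prl ` spc K p q \<subseteq> spc Y p q" "prr ` spc K p q \<subseteq> spc X (p + 1) q"
  "inl ` spc Y p q \<subseteq> spc K p q" "inr ` spc X p q \<subseteq> spc K (p - 1) q"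
  using tfD(1)[OF X] tfD(1)[OF Y] by (auto simp: cone_mod_def is_subspace_def)

lemma cone_comod:
  "F \<in> comod A K i j \<Longrightarrow> lmap prl F \<in> comod A Y i j"
  "F \<in> comod A K i j \<Longrightarrow> i' = i + 1 \<Longrightarrow> lmap prr F \<in> comod A X i' j"
  "F \<in> comod A Y i j \<Longrightarrow> lmap inl F \<in> comod A K i j"
  "F \<in> comod A X i j \<Longrightarrow> i' = i - 1 \<Longrightarrow> lmap inr F \<in> comod A K i' j"
  using comod_lmap[of prl K Y 0 F i j i] comod_lmap[of prr K X 1 F i j i']
    comod_lmap[of inl Y K 0 F i j i] comod_lmap[of inr X K "-1" F i j i'] cone_spc inl_lin by simp_all

lemma cone_comodule_maps:
  "comodule_map A K Y 0 (\<lambda>i j. lmap prl)" "comodule_map A K X 1 (\<lambda>i j. lmap prr)"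
  "comodule_map A Y K 0 (\<lambda>i j. lmap inl)" "comodule_map A X K (- 1) (\<lambda>i j. lmap inr)"
  by (rule comodule_map_lmap; use cone_spc inl_lin in auto)+

lemma cone_sub: "sub_mod K"
proof (intro allI)
  fix i j
  have "is_subspace (spc X (i + 1) j)" "is_subspace (spc Y i j)"
    using tfD(1)[OF X] tfD(1)[OF Y] by blast+
  thus "is_subspace (spc K i j)"
    by (simp add: is_subspace_def cone_mod_def linD[OF inl_lin(3)] linD[OF inl_lin(4)])
qed

lemma cone_dif:
  "dif K i j F = lmap inl (dif Y i j (lmap prl F) + u (i + 1) j (lmap prr F)) - lmap inr (dif X (i + 1) j (lmap prr F))"
  by (simp add: cone_mod_def)

lemma cone_dif_proj:
  "lmap prl (dif K i j F) = dif Y i j (lmap prl F) + u (i + 1) j (lmap prr F)"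
  "lmap prr (dif K i j F) = - dif X (i + 1) j (lmap prr F)"
  unfolding cone_dif by (simp_all add: lmap_simps inl_lin)

lemma cone_mem:
  assumes F: "F \<in> comod A K i j"
  shows "dif Y i j (lmap prl F) \<in> comod A Y (i + 1) j" "u (i + 1) j (lmap prr F) \<in> comod A Y (i + 1) j"
    "dif X (i + 1) j (lmap prr F) \<in> comod A X (i + 1 + 1) j"
  using hlinearD(1)[OF tfD(4)[OF X] cone_comod(2)[OF F refl]] hlinearD(1)[OF tfD(4)[OF Y] cone_comod(1)[OF F]]
    tf_morD(5)[OF u cone_comod(2)[OF F refl]] by simp_all

lemma cone_hlinear: "hlinear A K K 1 (dif K)"
  unfolding hlinear_def
proof (intro allI ballI conjI)
  fix i j F assume F: "F \<in> comod A K i j"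
  note m = cone_mem[OF F] and c = cone_comod(1)[OF F] cone_comod(2)[OF F refl]
  show "dif K i j F \<in> comod A K (i + 1) j"
    unfolding cone_dif
    by (intro comod_diff cone_sub cone_comod comod_add tfD(1)[OF Y] m(1,2) cone_comod(4)[OF m(3)]) simp
  show "dif K i j (hscale c F) = hscale c (dif K i j F)" for c
    unfolding cone_dif
    by (simp add: lmap_simps inl_lin hlinearD(3)[OF tfD(4)[OF Y] c(1)] hlinearD(3)[OF tf_morD(3)[OF u] c(2)]
        hlinearD(3)[OF tfD(4)[OF X] c(2)] hscale_simps diff_conv_add_uminus del: add_uminus_conv_diff)
  fix G assume G: "G \<in> comod A K i j"
  note c' = cone_comod(1)[OF G] cone_comod(2)[OF G refl]
  show "dif K i j (F + G) = dif K i j F + dif K i j G"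
    unfolding cone_dif
    by (simp add: lmap_simps inl_lin hlinearD(2)[OF tfD(4)[OF Y] c(1) c'(1)]
        hlinearD(2)[OF tf_morD(3)[OF u] c(2) c'(2)] hlinearD(2)[OF tfD(4)[OF X] c(2) c'(2)])
qed

lemma cone_codifferential: "codifferential A K"
  unfolding codifferential_def
proof (intro conjI allI ballI cone_hlinear)
  fix i j F assume F: "F \<in> comod A K i j"
  note m = cone_mem[OF F] and c = cone_comod(1)[OF F] cone_comod(2)[OF F refl]
  have "dif K (i + 1) j (dif K i j F) =
      lmap inl (dif Y (i + 1) j (dif Y i j (lmap prl F) + u (i + 1) j (lmap prr F)) + u (i + 1 + 1) j (- dif X (i + 1) j (lmap prr F)))
      - lmap inr (dif X (i + 1 + 1) j (- dif X (i + 1) j (lmap prr F)))"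
    unfolding cone_dif[of "i + 1" j] cone_dif_proj ..
  also have "dif X (i + 1 + 1) j (- dif X (i + 1) j (lmap prr F)) = 0"
    using hlinear_more(2)[OF tfD(4)[OF X] tfD(1)[OF X]] m(3) tfD(6)[OF X c(2)] by simp
  \<comment> \<open>Since \<open>u\<close> is a morphism, the corner contributes the negative of the
    term that \<open>dif Y\<close> produces from \<open>u\<close>, and the two cancel.\<close>
  also have "u (i + 1 + 1) j (- dif X (i + 1) j (lmap prr F)) = - dif Y (i + 1) j (u (i + 1) j (lmap prr F))"
    using hlinear_more(2)[OF tf_morD(3)[OF u] tfD(1)[OF X]] m(3) tf_morD(4)[OF u c(2)] by simp
  also have "dif Y (i + 1) j (dif Y i j (lmap prl F) + u (i + 1) j (lmap prr F)) = dif Y (i + 1) j (u (i + 1) j (lmap prr F))"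
    using hlinearD(2)[OF tfD(4)[OF Y] m(1,2)] tfD(6)[OF Y c(1)] by simp
  finally show "dif K (i + 1) j (dif K i j F) = 0"
    by (simp only: right_minus lmap_simps inl_lin diff_self)
  fix v assume v: "v \<in> lists (bas A)"
  let ?i = "i - word_cdeg A v" and ?j = "j - word_wdeg A v"
  define B where "B = (\<lambda>F. (\<lambda>n u. id_bar A i F n u v) :: ('b, 's, 'k) hcofree)"
  have cY: "coact v (dif Y i j (lmap prl F)) = dif Y ?i ?j (lmap prl (coact v F)) + B (lmap prl F)"
    using tfD(5)[OF Y c(1) v] by (simp add: B_def lmap_simps inl_lin)
  \<comment> \<open>The component in \<open>X\<close> is taken in degree \<open>i + 1\<close>, so
    the term from \<open>d_A\<close> comes with the opposite Koszul sign. The minus sign of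
    \<open>dif X\<close> in the cone restores it.\<close>
  have cX: "coact v (dif X (i + 1) j (lmap prr F)) = dif X (?i + 1) ?j (lmap prr (coact v F)) - B (lmap prr F)"
  proof -
    have e: "i + 1 - word_cdeg A v = ?i + 1" by simp
    have "(\<lambda>n u. id_bar A (i + 1) (lmap prr F) n u v) = - B (lmap prr F)"
      unfolding B_def id_bar_shift by (simp add: fun_eq_iff)
    thus ?thesis using tfD(5)[OF X c(2) v] unfolding e by (simp add: lmap_simps inl_lin)
  qed
  have cu: "coact v (u (i + 1) j (lmap prr F)) = u (?i + 1) ?j (lmap prr (coact v F))"
  proof -
    have e: "i + 1 - word_cdeg A v = ?i + 1" by simp
    show ?thesis
      using comodule_mapD(2)[OF tf_morD(1)[OF u] c(2) v] unfolding e by (simp add: lmap_simps inl_lin)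
  qed
  have f: "fin_supp (lmap prl F)" "fin_supp (lmap prr F)" using comod_fin_supp c by blast+
  have f': "fin_supp (lmap inl (lmap prl F))" "fin_supp (lmap inr (lmap prr F))"
    using comod_fin_supp cone_comod(3)[OF c(1)] cone_comod(4)[OF c(2) refl] by blast+
  have "lmap inl (B (lmap prl F)) + lmap inr (B (lmap prr F)) = B (lmap inl (lmap prl F) + lmap inr (lmap prr F))"
    unfolding B_def
    by (intro ext) (simp add: id_bar_add[OF f'] id_bar_lmap[OF inl_lin(1) f(1)] id_bar_lmap[OF inl_lin(2) f(2)] lmap_def[of _ "\<lambda>n u. id_bar A i _ n u v"] del: lmap_inl)
  hence B: "lmap inl (B (lmap prl F)) + lmap inr (B (lmap prr F)) = B F" by simp
  have "coact v (dif K i j F) = lmap inl (coact v (dif Y i j (lmap prl F)) + coact v (u (i + 1) j (lmap prr F)))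
      - lmap inr (coact v (dif X (i + 1) j (lmap prr F)))"
    unfolding cone_dif by (simp add: lmap_simps inl_lin coact_simps)
  also have "\<dots> = dif K ?i ?j (coact v F) + (lmap inl (B (lmap prl F)) + lmap inr (B (lmap prr F)))"
    unfolding cY cX cu cone_dif by (simp add: lmap_simps inl_lin algebra_simps)
  finally show "coact v (dif K i j F) = dif K ?i ?j (coact v F) + (\<lambda>n u. id_bar A i F n u v)"
    unfolding B unfolding B_def .
qed

lemma lmap_unit: "lin \<phi> \<Longrightarrow> F \<in> with_unit A \<Longrightarrow> lmap \<phi> F \<in> with_unit A"
  unfolding with_unit_def using lmap_support by blast

lemma lmap_length: "lin \<phi> \<Longrightarrow> F \<in> of_length l \<Longrightarrow> lmap \<phi> F \<in> of_length l"
  unfolding of_length_def using lmap_support by blast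

lemma cone_unital: "unital_module A K"
  unfolding unital_module_def
proof (intro conjI allI impI ballI)
  fix p q m assume m: "m \<in> hspc K p q"
  define ml where "ml = (\<lambda>n. prl (m n))"
  define mr where "mr = (\<lambda>n. prr (m n))"
  have ml: "ml \<in> hspc Y p q" and mr: "mr \<in> hspc X (p + 1) q"
    using m by (auto simp: hspc_def cone_mod_def ml_def mr_def)
  have w: "[uni A] \<in> lists (bas A)" "word_cdeg A [uni A] = - 1" "word_wdeg A [uni A] = 0"
    using uni_bas uni_deg by (simp_all add: word_cdeg_def word_wdeg_def)
  have "pure mr [uni A] \<in> comod A X (p - 1) q"
    by (rule comod_pure[OF tfD(1)[OF X] mr w(1)]) (simp_all add: w)
  moreover have "pure mr [uni A] \<in> of_length 1" "pure mr [uni A] \<in> with_unit A"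
    by (simp_all add: pure_def of_length_def with_unit_def)
  ultimately have 1: "corestr (u (p - 1) q (pure mr [uni A])) = 0"
    using tf_morD(2)[OF u] unfolding unital_map_def by blast
  have 2: "corestr (dif Y (p - 2) q (pure ml [uni A])) = (\<lambda>n. vscale (ksgn p) (ml n))"
    using tfD(3)[OF Y] ml unfolding unital_module_def by blast
  \<comment> \<open>The component in \<open>X\<close> has degree \<open>p + 1\<close>, so the unit
    acts with the opposite sign, which cancels against the minus sign of \<open>dif X\<close> in the
    cone.\<close>
  have "corestr (dif X (p + 1 - 2) q (pure mr [uni A])) = (\<lambda>n. vscale (ksgn (p + 1)) (mr n))"
    using tfD(3)[OF X] mr unfolding unital_module_def by blast
  hence 3: "corestr (dif X (p - 1) q (pure mr [uni A])) = (\<lambda>n. - vscale (ksgn p) (mr n))"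
    by (simp add: ksgn_plus1 vscale_neg)
  have p: "p - 2 + 1 = p - 1" by simp
  have "corestr (dif K (p - 2) q (pure m [uni A])) = (\<lambda>n. inl (corestr (dif Y (p - 2) q (pure ml [uni A])) n
       + corestr (u (p - 1) q (pure mr [uni A])) n) - inr (corestr (dif X (p - 1) q (pure mr [uni A])) n))"
    unfolding cone_dif p ml_def mr_def lmap_simps(6)[OF inl_lin(3)] lmap_simps(6)[OF inl_lin(4)]
    by (simp add: corestr_def lmap_def fun_eq_iff)
  also have "\<dots> = (\<lambda>n. vscale (ksgn p) (inl (ml n) + inr (mr n)))"
    unfolding 1 2 3 by (simp add: linD inl_lin vscale_distrib fun_eq_iff)
  finally show "corestr (dif K (p - 2) q (pure m [uni A])) = (\<lambda>n. vscale (ksgn p) (m n))"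
    by (simp add: ml_def mr_def inl_prl)
next
  fix l :: nat and i j F assume l: "2 \<le> l" and F: "F \<in> comod A K i j \<inter> of_length l \<inter> with_unit A"
  hence F': "F \<in> comod A K i j" "F \<in> of_length l" "F \<in> with_unit A" by auto
  have l': "1 \<le> l" using l by simp
  have r: "lmap prr F \<in> comod A X (i + 1) j \<inter> of_length l \<inter> with_unit A"
    and s: "lmap prl F \<in> comod A Y i j \<inter> of_length l \<inter> with_unit A"
    by (intro IntI cone_comod(1)[OF F'(1)] cone_comod(2)[OF F'(1) refl] lmap_unit lmap_length inl_lin F')+
  have "corestr (dif Y i j (lmap prl F)) = 0" "corestr (dif X (i + 1) j (lmap prr F)) = 0"
    "corestr (u (i + 1) j (lmap prr F)) = 0"
    using tfD(3)[OF X] tfD(3)[OF Y] tf_morD(2)[OF u] r s l l'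
    unfolding unital_module_def unital_map_def by blast+
  thus "corestr (dif K i j F) = 0"
    unfolding cone_dif
    by (simp add: corestr_simps lmap_simps(8)[OF inl_lin(1)] lmap_simps(8)[OF inl_lin(2)]
        linD(3)[OF inl_lin(1)] linD(3)[OF inl_lin(2)])
qed

lemma cone_tf: "K \<in> tf_modules A"
  unfolding tf_modules_def using cone_sub cone_codifferential cone_unital by blast

end

section \<open>The shift of modules\<close>

lemma comodule_map_zero: "sub_mod N \<Longrightarrow> comodule_map A M N r 0"
  unfolding comodule_map_def hlinear_def by (auto simp: comod_zero hscale_simps coact_simps)

lemma comodule_map_add:
  assumes N: "sub_mod N" and f: "comodule_map A M N r f" and g: "comodule_map A M N r g"
  shows "comodule_map A M N r (f + g)"
  unfolding comodule_map_def hlinear_def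
  using hlinearD[OF comodule_mapD(1)[OF f]] hlinearD[OF comodule_mapD(1)[OF g]]
    comodule_mapD(2)[OF f] comodule_mapD(2)[OF g] comod_add[OF N]
  by (auto simp: hscale_simps coact_simps algebra_simps)

lemma hlinear_neg: "sub_mod N \<Longrightarrow> hlinear A M N r f \<Longrightarrow> hlinear A M N r (- f)"
  unfolding hlinear_def using comod_neg[of N] by (auto simp: hscale_simps)

lemma comodule_map_neg:
  assumes N: "sub_mod N" and f: "comodule_map A M N r f"
  shows "comodule_map A M N r (- f)"
  unfolding comodule_map_def hlinear_def
  using hlinearD[OF comodule_mapD(1)[OF f]] comodule_mapD(2)[OF f] comod_neg[OF N]
  by (auto simp: hscale_simps coact_simps algebra_simps)

lemma comodule_map_id: "comodule_map A M M 0 (\<lambda>i j F. F)"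
  unfolding comodule_map_def hlinear_def by simp

lemma unital_zero: "unital_map A M 0"
  and unital_add: "unital_map A M f \<Longrightarrow> unital_map A M g \<Longrightarrow> unital_map A M (f + g)"
  and unital_neg: "unital_map A M f \<Longrightarrow> unital_map A M (- f)"
  unfolding unital_map_def by (simp_all add: corestr_simps)

lemma unital_id: "unital_map A M (\<lambda>i j F. F)"
proof -
  have "(\<lambda>i j F. F) = (\<lambda>i j. lmap (\<lambda>x. x))" by (simp add: lmap_id fun_eq_iff)
  thus ?thesis using strict_unital[OF strict_lmap[OF lin_id]] by metis
qed

lemma tf_morI:
  assumes "comodule_map A M N 0 f" "unital_map A M f"
    "\<And>i j F. F \<in> comod A M i j \<Longrightarrow> f (i + 1) j (dif M i j F) = dif N i j (f i j F)"
  shows "f \<in> tf_morphisms A M N"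
  unfolding tf_morphisms_def using assms by blast

lemma tf_mor_neg:
  assumes M: "M \<in> tf_modules A" and N: "N \<in> tf_modules A" and f: "f \<in> tf_morphisms A M N"
  shows "- f \<in> tf_morphisms A M N"
proof (rule tf_morI)
  show "comodule_map A M N 0 (- f)" using comodule_map_neg[OF tfD(1)[OF N] tf_morD(1)[OF f]] .
  show "unital_map A M (- f)" using unital_neg tf_morD(2) f by blast
  fix i j F assume F: "F \<in> comod A M i j"
  show "(- f) (i + 1) j (dif M i j F) = dif N i j ((- f) i j F)"
    using tf_morD(4)[OF f F] hlinear_more(2)[OF tfD(4)[OF N] tfD(1)[OF N] tf_morD(5)[OF f F]] by simp
qed

lemma shift_mod_simps:
  "spc (shift_mod M) i j = spc M (i + 1) j" "dif (shift_mod M) i j F = - dif M (i + 1) j F"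
  by (simp_all add: shift_mod_def)

lemma hlinear_shift_right: "hlinear A M (shift_mod N) r f \<longleftrightarrow> hlinear A M N (r + 1) f"
  unfolding hlinear_def comod_shift_mod by (simp add: add.assoc)

lemma comodule_map_shift_right: "comodule_map A M (shift_mod N) r f \<longleftrightarrow> comodule_map A M N (r + 1) f"
  unfolding comodule_map_def hlinear_shift_right ..

text \<open>Conditions on a shifted module in degree \<open>i\<close> are those on the module in
  degree \<open>i + 1\<close>. Isolating them as a predicate of the degree reduces each comparison
  to this reindexing.\<close>

lemma all_int_shift: "(\<forall>i::int. P (i + 1)) \<longleftrightarrow> (\<forall>i. P i)"
  by (metis diff_add_cancel)

lemma hlinear_shift_left: "hlinear A (shift_mod M) N r (shift_map f) \<longleftrightarrow> hlinear A M N (r - 1) f"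
proof -
  define P where "P = (\<lambda>i. \<forall>j. \<forall>F\<in>comod A M i j. f i j F \<in> comod A N (i + (r - 1)) j \<and>
     (\<forall>G\<in>comod A M i j. f i j (F + G) = f i j F + f i j G) \<and>
     (\<forall>c. f i j (hscale c F) = hscale c (f i j F)))"
  have "hlinear A (shift_mod M) N r (shift_map f) = (\<forall>i. P (i + 1))"
    unfolding hlinear_def P_def comod_shift_mod shift_map_def by (simp add: algebra_simps)
  thus ?thesis unfolding all_int_shift unfolding hlinear_def P_def .
qed

lemma comodule_map_shift_left:
  "comodule_map A (shift_mod M) N r (shift_map f) \<longleftrightarrow> comodule_map A M N (r - 1) f"
proof -
  define P where "P = (\<lambda>i. \<forall>j. \<forall>F\<in>comod A M i j. \<forall>v\<in>lists (bas A).
        coact v (f i j F) = f (i - word_cdeg A v) (j - word_wdeg A v) (coact v F))"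
  have "comodule_map A (shift_mod M) N r (shift_map f) \<longleftrightarrow> hlinear A M N (r - 1) f \<and> (\<forall>i. P (i + 1))"
    unfolding comodule_map_def hlinear_shift_left P_def comod_shift_mod
    unfolding shift_map_def by (simp add: algebra_simps)
  thus ?thesis unfolding all_int_shift unfolding comodule_map_def P_def .
qed

lemma unital_shift_left: "unital_map A (shift_mod M) (shift_map f) \<longleftrightarrow> unital_map A M f"
proof -
  have "unital_map A (shift_mod M) (shift_map f) \<longleftrightarrow>
     (\<forall>i. \<forall>l\<ge>1. \<forall>j. \<forall>F\<in>comod A M (i + 1) j \<inter> of_length l \<inter> with_unit A. corestr (f (i + 1) j F) = 0)"
    unfolding unital_map_def comod_shift_mod shift_map_def by blast
  also have "\<dots> \<longleftrightarrow> (\<forall>i. \<forall>l\<ge>1. \<forall>j. \<forall>F\<in>comod A M i j \<inter> of_length l \<inter> with_unit A. corestr (f i j F) = 0)"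
    by (rule all_int_shift)
  also have "\<dots> \<longleftrightarrow> unital_map A M f" unfolding unital_map_def by blast
  finally show ?thesis .
qed

lemma tf_mor_shift:
  assumes M: "M \<in> tf_modules A"
  shows "shift_map f \<in> tf_morphisms A (shift_mod M) (shift_mod N) \<longleftrightarrow> f \<in> tf_morphisms A M N"
proof -
  have "(\<forall>i j. \<forall>F\<in>comod A M (i + 1) j. f (i + 1 + 1) j (- dif M (i + 1) j F) = - dif N (i + 1) j (f (i + 1) j F)) \<longleftrightarrow>
    (\<forall>i j. \<forall>F\<in>comod A M i j. f (i + 1) j (- dif M i j F) = - dif N i j (f i j F))"
    by (rule all_int_shift)
  hence *: "shift_map f \<in> tf_morphisms A (shift_mod M) (shift_mod N) \<longleftrightarrow> comodule_map A M N 0 f \<and> unital_map A M f \<and>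
     (\<forall>i j. \<forall>F\<in>comod A M i j. f (i + 1) j (- dif M i j F) = - dif N i j (f i j F))"
    unfolding tf_morphisms_def mem_Collect_eq comodule_map_shift_right comodule_map_shift_left unital_shift_left
      shift_mod_simps comod_shift_mod
    by (simp add: shift_map_def)
  have "f (i + 1) j (- dif M i j F) = - f (i + 1) j (dif M i j F)"
    if "comodule_map A M N 0 f" "F \<in> comod A M i j" for i j F
    using hlinear_more(2)[OF comodule_mapD(1)[OF that(1)] tfD(1)[OF M] hlinearD(1)[OF tfD(4)[OF M] that(2)]] .
  hence "f \<in> tf_morphisms A M N \<longleftrightarrow> comodule_map A M N 0 f \<and> unital_map A M f \<and>
     (\<forall>i j. \<forall>F\<in>comod A M i j. f (i + 1) j (- dif M i j F) = - dif N i j (f i j F))"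
    unfolding tf_morphisms_def by auto
  thus ?thesis using * by blast
qed

lemma shift_map_surj: "\<exists>g. f = shift_map g"
  by (rule exI[of _ "\<lambda>i j. f (i - 1) j"]) (simp add: shift_map_def)

lemma shift_mod_inj: "shift_mod M = shift_mod N \<Longrightarrow> M = N"
proof -
  assume eq: "shift_mod M = shift_mod N"
  have "spc M i j = spc N i j" for i j
    using shift_mod_simps(1)[of M "i - 1" j] shift_mod_simps(1)[of N "i - 1" j] eq by simp
  moreover have "dif M i j F = dif N i j F" for i j F
    using shift_mod_simps(2)[of M "i - 1" j F] shift_mod_simps(2)[of N "i - 1" j F] eq by simp
  ultimately show "M = N" by (intro hmod.equality) (auto simp: fun_eq_iff)
qed

lemma shift_mod_surj: "\<exists>M. shift_mod M = N"
  by (rule exI[of _ "\<lparr>spc = (\<lambda>i j. spc N (i - 1) j), dif = (\<lambda>i j F. - dif N (i - 1) j F)\<rparr>"])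
    (simp add: shift_mod_def)

lemma neg_eq_neg_add: "(- a = - b + c) = (a = b + - c)" for a b c :: "'a::ab_group_add"
  by (subst neg_equal_iff_equal[symmetric]) simp

text \<open>An equivalence is needed because the shift has to be bijective on objects. The negated
  differential matches the sign flips of \<open>id_bar\<close> and of \<open>ksgn\<close> in the
  neighbouring degree, so every condition is only reindexed.\<close>

lemma tf_shift: "shift_mod M \<in> tf_modules A \<longleftrightarrow> M \<in> tf_modules A"
proof -
  define D where "D = (\<lambda>i j F. - dif M i j F)"
  have dif: "dif (shift_mod M) = shift_map D" by (simp add: shift_mod_def shift_map_def D_def fun_eq_iff)
  have sub: "sub_mod (shift_mod M) \<longleftrightarrow> sub_mod M"
    unfolding shift_mod_simps by (rule all_int_shift)
  have hl: "hlinear A M M 1 D \<longleftrightarrow> hlinear A M M 1 (dif M)" if M: "sub_mod M"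
  proof -
    have "D = - dif M" by (simp add: D_def fun_eq_iff)
    thus ?thesis
      using hlinear_neg[OF M, of M 1 "dif M"] hlinear_neg[OF M, of M 1 "- dif M"] by auto
  qed
  define P where "P = (\<lambda>i. \<forall>j. \<forall>F\<in>comod A M i j. \<forall>v\<in>lists (bas A).
        coact v (dif M i j F) = dif M (i - word_cdeg A v) (j - word_wdeg A v) (coact v F) + (\<lambda>n u. id_bar A i F n u v))"
  define Q where "Q = (\<lambda>i. \<forall>j. \<forall>F\<in>comod A M i j. dif M (i + 1) j (dif M i j F) = 0)"
  define U where "U = (\<lambda>p. \<forall>q. \<forall>m\<in>hspc M p q.
        corestr (dif M (p - 2) q (pure m [uni A])) = (\<lambda>n. vscale (ksgn p) (m n)))"
  define V where "V = (\<lambda>i. \<forall>l\<ge>2. \<forall>j. \<forall>F\<in>comod A M i j \<inter> of_length l \<inter> with_unit A. corestr (dif M i j F) = 0)"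
  have nb: "(\<lambda>n u. id_bar A (i + 1) F n u v) = - (\<lambda>n u. id_bar A i F n u v)" for F :: "('b, 'c, 'k) hcofree" and i v
    unfolding id_bar_shift by (simp add: fun_eq_iff)
  have P: "(\<forall>i j. \<forall>F\<in>comod A (shift_mod M) i j. \<forall>v\<in>lists (bas A).
      coact v (dif (shift_mod M) i j F) = dif (shift_mod M) (i - word_cdeg A v) (j - word_wdeg A v) (coact v F)
        + (\<lambda>n u. id_bar A i F n u v)) \<longleftrightarrow> (\<forall>i. P (i + 1))"
  proof -
    have i: "i - word_cdeg A v + 1 = i + 1 - word_cdeg A v" for i and v :: "'b list" by simp
    show ?thesis unfolding P_def comod_shift_mod shift_mod_simps coact_simps nb i neg_eq_neg_add by blast
  qed
  have Q: "(\<forall>i j. \<forall>F\<in>comod A (shift_mod M) i j. dif (shift_mod M) (i + 1) j (dif (shift_mod M) i j F) = 0) \<longleftrightarrow> (\<forall>i. Q (i + 1))"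
    if M: "sub_mod M" "hlinear A M M 1 (dif M)"
    unfolding Q_def comod_shift_mod shift_mod_simps
    by (intro iff_allI ball_cong refl) (simp only: hlinear_more(2)[OF M(2,1) hlinearD(1)[OF M(2)]] neg_equal_0_iff_equal)
  have cod: "codifferential A (shift_mod M) \<longleftrightarrow> codifferential A M" if "sub_mod M"
  proof -
    have "hlinear A (shift_mod M) (shift_mod M) 1 (dif (shift_mod M)) \<longleftrightarrow> hlinear A M M 1 (dif M)"
      unfolding dif hlinear_shift_left hlinear_shift_right using hl[OF that] by simp
    thus ?thesis
      unfolding codifferential_def P using Q[OF that] all_int_shift[of P] all_int_shift[of Q]
      unfolding P_def Q_def by blast
  qed
  have "unital_module A (shift_mod M) \<longleftrightarrow> (\<forall>p. U (p + 1)) \<and> (\<forall>i. V (i + 1))"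
  proof -
    have h: "hspc (shift_mod M) p q = hspc M (p + 1) q" for p q by (simp add: hspc_def shift_mod_simps)
    have i: "p - 2 + 1 = p + 1 - (2::int)" for p by simp
    have cor: "(corestr (- x) = (\<lambda>n. vscale (ksgn p) (m n))) = (corestr x = (\<lambda>n. vscale (ksgn (p + 1)) (m n)))"
      for x :: "('b, 'c, 'k) hcofree" and p m
      by (simp add: corestr_simps ksgn_plus1 vscale_neg fun_eq_iff minus_equation_iff) (metis minus_minus)
    have "(\<forall>p q. \<forall>m\<in>hspc (shift_mod M) p q.
        corestr (dif (shift_mod M) (p - 2) q (pure m [uni A])) = (\<lambda>n. vscale (ksgn p) (m n))) \<longleftrightarrow> (\<forall>p. U (p + 1))"
      unfolding U_def h shift_mod_simps i cor ..
    moreover have "(\<forall>l\<ge>2. \<forall>i j. \<forall>F\<in>comod A (shift_mod M) i j \<inter> of_length l \<inter> with_unit A.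
        corestr (dif (shift_mod M) i j F) = 0) \<longleftrightarrow> (\<forall>i. V (i + 1))"
      unfolding V_def comod_shift_mod shift_mod_simps corestr_simps neg_equal_0_iff_equal by blast
    ultimately show ?thesis unfolding unital_module_def by blast
  qed
  moreover have "unital_module A M \<longleftrightarrow> (\<forall>p. U p) \<and> (\<forall>i. V i)"
    unfolding unital_module_def U_def V_def by blast
  ultimately have uni: "unital_module A (shift_mod M) \<longleftrightarrow> unital_module A M"
    using all_int_shift[of U] all_int_shift[of V] by simp
  show ?thesis unfolding tf_modules_def mem_Collect_eq using sub cod uni by blast
qed

section \<open>Semi-split sequences\<close>

lemma hspc_coeff: "F \<in> comod A M i j \<Longrightarrow> v \<in> lists (bas A) \<Longrightarrow>
    (\<lambda>n. F n v) \<in> hspc M (i + 1 - word_cdeg A v) (j - word_wdeg A v)"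
  unfolding hspc_def using comodD(2) by blast

lemma comod_pure_Nil: "sub_mod M \<Longrightarrow> m \<in> hspc M p q \<Longrightarrow> pure m [] \<in> comod A M (p - 1) q"
  by (rule comod_pure) auto

lemma comod_eqI:
  assumes "F \<in> comod A M i j" "G \<in> comod A M i j"
    and "\<And>v. v \<in> lists (bas A) \<Longrightarrow> (\<lambda>n. F n v) = (\<lambda>n. G n v)"
  shows "F = G"
proof (intro ext)
  fix n v s
  show "F n v s = G n v s"
  proof (cases "v \<in> lists (bas A)")
    case True
    thus ?thesis using fun_cong[OF assms(3)[OF True], of n] by simp
  next
    case False
    thus ?thesis using comodD(3)[OF assms(1) False] comodD(3)[OF assms(2) False] by simp
  qed
qed

lemma comod_eq_zeroI:
  assumes "F \<in> comod A M i j" and "\<And>v. v \<in> lists (bas A) \<Longrightarrow> (\<lambda>n. F n v) = 0"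
  shows "F = 0"
proof (intro ext)
  fix n v s
  show "F n v s = 0 n v s"
    using fun_cong[OF assms(2), of v n] comodD(3)[OF assms(1), of v n] by (cases "v \<in> lists (bas A)") simp_all
qed

text \<open>Removing the empty-word coefficient leaves an element all of whose length parts are
  killed by strictness; \<open>hlinear_len_parts\<close> assembles them.\<close>

lemma strict_corestr:
  assumes f: "hlinear A M N r f" and M: "sub_mod M" and s: "strict_map A M f" and F: "F \<in> comod A M i j"
  shows "corestr (f i j F) = corestr (f i j (pure (\<lambda>n. F n []) []))"
proof -
  have 0: "len_part 0 F = pure (\<lambda>n. F n []) []"
    by (auto simp: len_part_def pure_def fun_eq_iff)
  have F0: "len_part 0 F \<in> comod A M i j" by (rule len_part_comod[OF M F])
  have "corestr (f i j (F - len_part 0 F)) = 0"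
  proof (rule hlinear_len_parts[OF f M comod_diff[OF M F F0]])
    fix l
    show "corestr (f i j (len_part l (F - len_part 0 F))) = 0"
    proof (cases "l = 0")
      case True
      have "len_part l (F - len_part 0 F) = 0" using True by (auto simp: len_part_def fun_eq_iff)
      thus ?thesis using hlinear_more(1)[OF f M, of i j] by (metis corestr_simps(4))
    next
      case False
      hence "1 \<le> l" by simp
      thus ?thesis
        using s len_part_comod[OF M comod_diff[OF M F F0]] len_part_of_length
        unfolding strict_map_def by blast
    qed
  qed
  thus ?thesis using hlinear_more(3)[OF f M F F0] 0 by (simp add: corestr_simps)
qed

text \<open>A strict comodule map acts word by word through its zeroth component. This is the bridge
  from exactness, which is assumed for the modules, to exactness on the comodules.\<close>

lemma strict_coeff:
  assumes f: "comodule_map A M N r f" and M: "sub_mod M" and s: "strict_map A M f"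
    and F: "F \<in> comod A M i j" and v: "v \<in> lists (bas A)"
  shows "(\<lambda>n. f i j F n v) = zeroth f (i + 1 - word_cdeg A v) (j - word_wdeg A v) (\<lambda>n. F n v)"
proof -
  have "(\<lambda>n. f i j F n v) = corestr (coact v (f i j F))" by (simp add: corestr_def coact_def)
  also have "\<dots> = corestr (f (i - word_cdeg A v) (j - word_wdeg A v) (coact v F))"
    using comodule_mapD(2)[OF f F v] by simp
  also have "\<dots> = corestr (f (i - word_cdeg A v) (j - word_wdeg A v) (pure (\<lambda>n. F n v) []))"
    using strict_corestr[OF comodule_mapD(1)[OF f] M s comod_coact[OF F v]] by (simp add: coact_def)
  finally show ?thesis by (simp add: zeroth_def algebra_simps)
qed

lemma zeroth_zero:
  assumes "hlinear A M N r f" "sub_mod M"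
  shows "zeroth f p q 0 = 0"
proof -
  have "pure (0 :: nat \<Rightarrow> 'c \<Rightarrow> 'k) [] = (0 :: ('b, 'c, 'k) hcofree)" by (auto simp: pure_def fun_eq_iff)
  thus ?thesis unfolding zeroth_def using hlinear_more(1)[OF assms] by (metis corestr_simps(4))
qed

text \<open>Prepares the strictness of the section below: it truncates an element to the empty word
  without leaving the kernel of a strict map.\<close>

lemma strict_pure_zero:
  assumes f: "comodule_map A M N r f" and M: "sub_mod M" and s: "strict_map A M f"
    and G: "G \<in> comod A M i j" and 0: "corestr (f i j G) = 0"
  shows "f i j (pure (\<lambda>n. G n []) []) = 0"
proof -
  let ?P = "pure (\<lambda>n. G n []) []"
  have "(\<lambda>n. G n []) \<in> hspc M (i + 1) j" using hspc_coeff[OF G, of "[]"] by simp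
  hence P: "?P \<in> comod A M i j" using comod_pure_Nil[OF M, of _ "i + 1" j] by simp
  show ?thesis
  proof (rule comod_eq_zeroI[OF hlinearD(1)[OF comodule_mapD(1)[OF f] P]])
    fix v assume v: "v \<in> lists (bas A)"
    show "(\<lambda>n. f i j ?P n v) = 0"
    proof (cases "v = []")
      case True
      have "corestr (f i j ?P) = 0" using strict_corestr[OF comodule_mapD(1)[OF f] M s G] 0 by simp
      thus ?thesis using True by (simp add: corestr_def zero_fun_def)
    next
      case False
      hence "(\<lambda>n. ?P n v) = 0" by (simp add: pure_def zero_fun_def)
      thus ?thesis
        unfolding strict_coeff[OF f M s P v]
        using zeroth_zero[OF comodule_mapD(1)[OF f] M] by (simp add: zero_fun_def)
    qed
  qed
qed

context
  fixes L M N :: "('b, 's, 'k) hmod" and f g \<rho>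
  assumes ss: "semi_split A L M N f g \<rho>"
begin

lemma ssD:
  "L \<in> tf_modules A" "M \<in> tf_modules A" "N \<in> tf_modules A"
  "f \<in> tf_morphisms A L M" "strict_map A L f" "g \<in> tf_morphisms A M N" "strict_map A M g"
  "zeroth f p q ` hspc L p q = {m \<in> hspc M p q. zeroth g p q m = 0}"
  "zeroth g p q ` hspc M p q = hspc N p q"
  "comodule_map A M L 0 \<rho>" "strict_map A M \<rho>"
  "F \<in> comod A L i j \<Longrightarrow> \<rho> i j (f i j F) = F"
  using ss unfolding semi_split_def by blast+

lemmas ss_lin = tfD(1)[OF ssD(1)] tfD(1)[OF ssD(2)] tfD(1)[OF ssD(3)] tf_morD(1)[OF ssD(4)] tf_morD(1)[OF ssD(6)]
  tf_morD(3)[OF ssD(4)] tf_morD(3)[OF ssD(6)] comodule_mapD(1)[OF ssD(10)]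

lemma ss_mem:
  "F \<in> comod A L i j \<Longrightarrow> f i j F \<in> comod A M i j"
  "F \<in> comod A M i j \<Longrightarrow> g i j F \<in> comod A N i j"
  "F \<in> comod A M i j \<Longrightarrow> \<rho> i j F \<in> comod A L i j"
  using hlinearD(1)[OF ss_lin(6)] hlinearD(1)[OF ss_lin(7)] hlinearD(1)[OF ss_lin(8)] by fastforce+

lemma ss_gf: 
  assumes F: "F \<in> comod A L i j"
  shows "g i j (f i j F) = 0"
proof (rule comod_eq_zeroI[OF ss_mem(2)[OF ss_mem(1)[OF F]]])
  fix v assume v: "v \<in> lists (bas A)"
  have "(\<lambda>n. f i j F n v) \<in> zeroth f (i + 1 - word_cdeg A v) (j - word_wdeg A v) ` hspc L (i + 1 - word_cdeg A v) (j - word_wdeg A v)"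
    unfolding strict_coeff[OF ss_lin(4,1) ssD(5) F v] using hspc_coeff[OF F v] by blast
  hence "zeroth g (i + 1 - word_cdeg A v) (j - word_wdeg A v) (\<lambda>n. f i j F n v) = 0"
    unfolding ssD(8) by blast
  thus "(\<lambda>n. g i j (f i j F) n v) = 0"
    unfolding strict_coeff[OF ss_lin(5,2) ssD(7) ss_mem(1)[OF F] v] .
qed

lemma ss_zeroth:
  assumes l: "l \<in> hspc L p q"
  shows "zeroth \<rho> p q (zeroth f p q l) = l"
proof -
  have P: "pure l [] \<in> comod A L (p - 1) q" by (rule comod_pure_Nil[OF ss_lin(1) l])
  have "(\<lambda>n. \<rho> (p - 1) q (f (p - 1) q (pure l [])) n []) = zeroth \<rho> p q (\<lambda>n. f (p - 1) q (pure l []) n [])"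
    using strict_coeff[OF ssD(10) ss_lin(2) ssD(11) ss_mem(1)[OF P], of "[]"] by simp
  moreover have "(\<lambda>n. f (p - 1) q (pure l []) n []) = zeroth f p q l" by (simp add: zeroth_def corestr_def)
  moreover have "(\<lambda>n. \<rho> (p - 1) q (f (p - 1) q (pure l [])) n []) = l"
    unfolding ssD(12)[OF P] by (simp add: pure_def)
  ultimately show ?thesis by simp
qed

lemma ss_ker:
  assumes F: "F \<in> comod A M i j" and gF: "g i j F = 0"
  shows "f i j (\<rho> i j F) = F"
proof (rule comod_eqI[OF ss_mem(1)[OF ss_mem(3)[OF F]] F])
  fix v assume v: "v \<in> lists (bas A)"
  let ?p = "i + 1 - word_cdeg A v" and ?q = "j - word_wdeg A v"
  have "zeroth g ?p ?q (\<lambda>n. F n v) = 0"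
    unfolding strict_coeff[OF ss_lin(5,2) ssD(7) F v, symmetric] gF by (simp add: zero_fun_def)
  hence "(\<lambda>n. F n v) \<in> zeroth f ?p ?q ` hspc L ?p ?q"
    unfolding ssD(8) using hspc_coeff[OF F v] by blast
  then obtain l where l: "l \<in> hspc L ?p ?q" "(\<lambda>n. F n v) = zeroth f ?p ?q l" by blast
  thus "(\<lambda>n. f i j (\<rho> i j F) n v) = (\<lambda>n. F n v)"
    unfolding strict_coeff[OF ss_lin(4,1) ssD(5) ss_mem(3)[OF F] v] strict_coeff[OF ssD(10) ss_lin(2) ssD(11) F v] l(2)
    using ss_zeroth[OF l(1)] by simp
qed

text \<open>
  Lifting each coefficient after dividing it by the largest possible power of \<open>\<hbar>\<close> keeps the
  support of the lift finite in every \<open>\<hbar>\<close>-degree.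
\<close>

lemma ss_surj:
  assumes F: "F \<in> comod A N i j"
  shows "\<exists>G\<in>comod A M i j. g i j G = F"
proof -
  let ?p = "\<lambda>v. i + 1 - word_cdeg A v" and ?q = "\<lambda>v. j - word_wdeg A v"
  define k where "k = (\<lambda>v. LEAST k. F k v \<noteq> 0)"
  have "\<exists>m\<in>hspc M (?p v) (?q v). zeroth g (?p v) (?q v) m = (\<lambda>n. F (n + k v) v)" if v: "v \<in> lists (bas A)" for v
  proof -
    have "(\<lambda>n. F (n + k v) v) \<in> hspc N (?p v) (?q v)"
      using hspc_coeff[OF F v] by (simp add: hspc_def)
    thus ?thesis unfolding ssD(9)[symmetric] by (metis (no_types, lifting) imageE)
  qed
  then obtain m where m: "\<And>v. v \<in> lists (bas A) \<Longrightarrow> m v \<in> hspc M (?p v) (?q v)"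
    "\<And>v. v \<in> lists (bas A) \<Longrightarrow> zeroth g (?p v) (?q v) (m v) = (\<lambda>n. F (n + k v) v)" by metis
  define G where "G = (\<lambda>n v. if v \<in> lists (bas A) \<and> (\<exists>l. F l v \<noteq> 0) \<and> k v \<le> n then m v (n - k v) else 0)"
  have kL: "F (k v) v \<noteq> 0" if "\<exists>l. F l v \<noteq> 0" for v
    unfolding k_def using that by (rule LeastI_ex)
  have k_less: "F n v = 0" if "n < k v" for n v
    using not_less_Least[OF that[unfolded k_def]] by simp
  have G: "G \<in> comod A M i j"
  proof (rule comodI)
    fix n
    have "{v. G n v \<noteq> 0} \<subseteq> (\<Union>l\<le>n. {v. F l v \<noteq> 0})"
      using kL unfolding G_def by (auto split: if_splits)
    thus "finite {v. G n v \<noteq> 0}" by (rule finite_subset) (use comodD(1)[OF F] in blast)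
  next
    fix n v assume v: "v \<in> lists (bas A)"
    have "0 \<in> spc M (?p v) (?q v)" using ss_lin(2) unfolding is_subspace_def by blast
    thus "G n v \<in> spc M (?p v) (?q v)" using m(1)[OF v] unfolding G_def hspc_def by simp
  next
    fix n v assume "v \<notin> lists (bas A)"
    thus "G n v = 0" unfolding G_def by (simp only: simp_thms if_False)
  qed
  have "g i j G = F"
  proof (rule comod_eqI[OF ss_mem(2)[OF G] F])
    fix v assume v: "v \<in> lists (bas A)"
    show "(\<lambda>n. g i j G n v) = (\<lambda>n. F n v)"
    proof (cases "\<exists>l. F l v \<noteq> 0")
      case False
      hence "(\<lambda>n. G n v) = 0" "(\<lambda>n. F n v) = 0" by (auto simp: G_def zero_fun_def)
      thus ?thesis unfolding strict_coeff[OF ss_lin(5,2) ssD(7) G v] using zeroth_zero[OF ss_lin(7,2)] by simp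
    next
      case True
      define p q where "p = ?p v" and "q = ?q v"
      note mv = m[OF v, folded p_def q_def]
      have P: "pure (m v) [] \<in> comod A M (p - 1) q" by (rule comod_pure_Nil[OF ss_lin(2) mv(1)])
      have "pure (\<lambda>n. G n v) [] = (hscale (fps_X ^ k v) (pure (m v) []) :: ('b, 's, 'k) hcofree)"
        unfolding hscale_X_power G_def pure_def using True v by (auto simp: fun_eq_iff)
      hence "zeroth g p q (\<lambda>n. G n v) = corestr (hscale (fps_X ^ k v) (g (p - 1) q (pure (m v) [])))"
        unfolding zeroth_def using hlinearD(3)[OF ss_lin(7) P] by simp
      also have "\<dots> = (\<lambda>n. if n < k v then 0 else zeroth g p q (m v) (n - k v))"
        unfolding hscale_X_power zeroth_def corestr_def by simp
      also have "\<dots> = (\<lambda>n. F n v)" unfolding mv(2) using k_less by (auto simp: fun_eq_iff)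
      finally show ?thesis unfolding strict_coeff[OF ss_lin(5,2) ssD(7) G v] p_def q_def .
    qed
  qed
  thus ?thesis using G by blast
qed

text \<open>\<open>g\<close> and \<rho> are jointly injective: an element of the kernel of
  \<open>g\<close> comes from \<open>L\<close> and is recovered from its image under \<rho>.\<close>

lemma ss_unique:
  assumes "G \<in> comod A M i j" "G' \<in> comod A M i j" "g i j G = g i j G'" "\<rho> i j G = \<rho> i j G'"
  shows "G = G'"
proof -
  have d: "G - G' \<in> comod A M i j" using comod_diff[OF ss_lin(2)] assms by blast
  have "g i j (G - G') = 0" "\<rho> i j (G - G') = 0"
    using hlinear_more(3)[OF ss_lin(7,2)] hlinear_more(3)[OF ss_lin(8,2)] assms by simp_all
  hence "G - G' = f i j 0" using ss_ker[OF d] by simp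
  thus ?thesis using hlinear_more(1)[OF ss_lin(6,1)] by simp
qed

text \<open>The section of \<open>g\<close> with values in the kernel of \<rho>. The lifts found in
  \<open>ss_surj\<close> are chosen separately for each word, with no linearity; singling out the
  lift by uniqueness makes all compatibilities of the section automatic.\<close>

definition ssec :: "('b, 's, 'k) hmap" where
  "ssec = (\<lambda>i j F. THE G. G \<in> comod A M i j \<and> g i j G = F \<and> \<rho> i j G = 0)"

lemma ssec:
  assumes F: "F \<in> comod A N i j"
  shows "ssec i j F \<in> comod A M i j" "g i j (ssec i j F) = F" "\<rho> i j (ssec i j F) = 0"
proof -
  obtain G0 where G0: "G0 \<in> comod A M i j" "g i j G0 = F" using ss_surj[OF F] by blast
  note r = ss_mem(3)[OF G0(1)] ss_mem(1)[OF ss_mem(3)[OF G0(1)]]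
  define G where "G = G0 - f i j (\<rho> i j G0)"
  have "G \<in> comod A M i j" "g i j G = F" "\<rho> i j G = 0"
    unfolding G_def using comod_diff[OF ss_lin(2) G0(1) r(2)] hlinear_more(3)[OF ss_lin(7,2) G0(1) r(2)]
      hlinear_more(3)[OF ss_lin(8,2) G0(1) r(2)] ss_gf[OF r(1)] ssD(12)[OF r(1)] G0(2) by simp_all
  hence "\<exists>!G. G \<in> comod A M i j \<and> g i j G = F \<and> \<rho> i j G = 0" using ss_unique by metis
  hence "ssec i j F \<in> comod A M i j \<and> g i j (ssec i j F) = F \<and> \<rho> i j (ssec i j F) = 0"
    unfolding ssec_def by (rule theI')
  thus "ssec i j F \<in> comod A M i j" "g i j (ssec i j F) = F" "\<rho> i j (ssec i j F) = 0" by blast+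
qed

lemma ssec_eqI:
  assumes "F \<in> comod A N i j" "G \<in> comod A M i j" "g i j G = F" "\<rho> i j G = 0"
  shows "ssec i j F = G"
  using ss_unique[OF ssec(1)[OF assms(1)] assms(2)] ssec[OF assms(1)] assms by simp

lemma ssec_comodule_map: "comodule_map A N M 0 ssec"
  unfolding comodule_map_def hlinear_def
proof (intro conjI allI ballI)
  fix i j F assume F: "F \<in> comod A N i j"
  note s = ssec[OF F]
  show "ssec i j F \<in> comod A M (i + 0) j" using s by simp
  show "ssec i j (hscale c F) = hscale c (ssec i j F)" for c
    using comod_hscale[OF ss_lin(3) F] comod_hscale[OF ss_lin(2) s(1)]
      hlinearD(3)[OF ss_lin(7) s(1)] hlinearD(3)[OF ss_lin(8) s(1)] s
    by (intro ssec_eqI) (simp_all add: hscale_simps)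
next
  fix i j F G assume F: "F \<in> comod A N i j" and G: "G \<in> comod A N i j"
  note s = ssec[OF F] and t = ssec[OF G]
  show "ssec i j (F + G) = ssec i j F + ssec i j G"
    using comod_add[OF ss_lin(3) F G] comod_add[OF ss_lin(2) s(1) t(1)]
      hlinearD(2)[OF ss_lin(7) s(1) t(1)] hlinearD(2)[OF ss_lin(8) s(1) t(1)] s t
    by (intro ssec_eqI) simp_all
next
  fix i j F v assume F: "F \<in> comod A N i j" and v: "v \<in> lists (bas A)"
  note s = ssec[OF F]
  show "coact v (ssec i j F) = ssec (i - word_cdeg A v) (j - word_wdeg A v) (coact v F)"
    using comod_coact[OF F v] comod_coact[OF s(1) v] comodule_mapD(2)[OF ss_lin(5) s(1) v]
      comodule_mapD(2)[OF ssD(10) s(1) v] s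
    by (intro ssec_eqI[symmetric]) (simp_all add: coact_simps(3))
qed

text \<open>If \<open>F\<close> has no empty-word coefficient, then the empty-word part of its lift
  is killed by both \<open>g\<close> and \<rho>, hence is zero by joint injectivity. Strictness is
  what makes the section unital.\<close>

lemma ssec_strict: "strict_map A N ssec"
  unfolding strict_map_def
proof (intro allI impI ballI)
  fix l :: nat and i j F assume l: "1 \<le> l" and "F \<in> comod A N i j \<inter> of_length l"
  hence F: "F \<in> comod A N i j" "F \<in> of_length l" by auto
  note s = ssec[OF F(1)]
  let ?P = "pure (\<lambda>n. ssec i j F n []) [] :: ('b, 's, 'k) hcofree"
  have "corestr F = 0" using of_length_corestr[OF F(2) l] by (simp add: corestr_def zero_fun_def)
  hence "g i j ?P = 0" "\<rho> i j ?P = 0"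
    using strict_pure_zero[OF ss_lin(5,2) ssD(7) s(1)] strict_pure_zero[OF ssD(10) ss_lin(2) ssD(11) s(1)] s(2,3)
    by (simp_all add: corestr_simps)
  moreover have "(\<lambda>n. ssec i j F n []) \<in> hspc M (i + 1) j" using hspc_coeff[OF s(1), of "[]"] by simp
  hence "?P \<in> comod A M i j" using comod_pure_Nil[OF ss_lin(2), of _ "i + 1" j] by simp
  ultimately have "?P = 0"
    using ss_unique[OF _ comod_zero[OF ss_lin(2)], of ?P i j] hlinear_more(1)[OF ss_lin(7,2)] hlinear_more(1)[OF ss_lin(8,2)]
    by simp
  hence "corestr ?P = 0" by (simp only: corestr_simps)
  thus "corestr (ssec i j F) = 0" by (simp add: corestr_def pure_def)
qed

lemma ssec_decomp:
  assumes F: "F \<in> comod A M i j"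
  shows "f i j (\<rho> i j F) + ssec i j (g i j F) = F"
proof -
  note r = ss_mem(3)[OF F] ss_mem(1)[OF ss_mem(3)[OF F]]
  have "ssec i j (g i j F) = F - f i j (\<rho> i j F)"
    using hlinear_more(3)[OF ss_lin(7,2) F r(2)] hlinear_more(3)[OF ss_lin(8,2) F r(2)] ss_gf[OF r(1)] ssD(12)[OF r(1)]
      comod_diff[OF ss_lin(2) F r(2)] ss_mem(2)[OF F]
    by (intro ssec_eqI) simp_all
  thus ?thesis by simp
qed

end

end

section \<open>The endomorphism ring model of the homotopy category\<close>

text \<open>The suspension is the identity on elements, so in the ring it is a mere reindexing of
  families, without a sign.\<close>

definition shS :: "(int \<Rightarrow> int \<Rightarrow> 'a::ab_group_add) aend" where
  "shS = Aend (\<lambda>x i j. x (i + 1) j)"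
definition shS' :: "(int \<Rightarrow> int \<Rightarrow> 'a::ab_group_add) aend" where
  "shS' = Aend (\<lambda>x i j. x (i - 1) j)"

lemma app_shS [simp]: "app shS x i j = x (i + 1) j" "app shS' x i j = x (i - 1) j"
  unfolding shS_def shS'_def by (subst app_Aend; auto simp: fun_eq_iff)+

lemma shS_inv: "shS * shS' = 1" "shS' * shS = 1"
  by (auto intro!: aend_eqI simp: fun_eq_iff)

type_synonym ('b, 's, 'k) hring = "(int \<Rightarrow> int \<Rightarrow> ('b, 's, 'k) hcofree) aend"

context halg_ctxt
begin

definition hadd :: "('b, 's, 'k) hmod \<Rightarrow> ('b, 's, 'k) hmap \<Rightarrow> bool" where
  "hadd M f \<longleftrightarrow> (\<forall>i j. \<forall>F\<in>comod A M i j. \<forall>G\<in>comod A M i j. f i j (F + G) = f i j F + f i j G)"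

text \<open>
  Graded maps act on families of elements, one in each bidegree. Precomposing with a projection
  onto the comodule makes maps between different modules elements of a single ring, in which two of
  them are equal iff they agree on the comodule.
\<close>

definition hat :: "('b, 's, 'k) hmod \<Rightarrow> int \<Rightarrow> ('b, 's, 'k) hmap \<Rightarrow> ('b, 's, 'k) hring" where
  "hat M r f = Aend (\<lambda>x i j. f (i - r) j (proj (comod A M (i - r) j) (x (i - r) j)))"

lemma hlinear_hadd: "hlinear A M N r f \<Longrightarrow> hadd M f"
  unfolding hadd_def hlinear_def by blast

lemma app_hat:
  assumes M: "sub_mod M" and f: "hadd M f"
  shows "app (hat M r f) x i j = f (i - r) j (proj (comod A M (i - r) j) (x (i - r) j))"
proof -
  have "app (hat M r f) = (\<lambda>x i j. f (i - r) j (proj (comod A M (i - r) j) (x (i - r) j)))"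
    unfolding hat_def
  proof (rule app_Aend, intro ext, goal_cases)
    case (1 x y i j n w s)
    note P = proj_props[OF comod_hsub[OF M, of "i - r" j]]
    show ?case
      using f P(1,2) unfolding hadd_def by simp
  qed
  thus ?thesis by simp
qed

lemma hat_eq_iff:
  assumes M: "sub_mod M" and f: "hadd M f" and g: "hadd M g"
  shows "hat M r f = hat M r g \<longleftrightarrow> (\<forall>i j. \<forall>F\<in>comod A M i j. f i j F = g i j F)"
proof (intro iffI allI ballI)
  fix i j F assume h: "hat M r f = hat M r g" and F: "F \<in> comod A M i j"
  have "app (hat M r f) (\<lambda>_ _. F) (i + r) j = app (hat M r g) (\<lambda>_ _. F) (i + r) j" using h by simp
  thus "f i j F = g i j F"
    using proj_props(3)[OF comod_hsub[OF M] F] by (simp add: app_hat[OF M f] app_hat[OF M g])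
next
  assume "\<forall>i j. \<forall>F\<in>comod A M i j. f i j F = g i j F"
  thus "hat M r f = hat M r g"
    using proj_props(2)[OF comod_hsub[OF M]]
    by (intro aend_eqI ext) (simp add: app_hat[OF M f] app_hat[OF M g])
qed

lemma hat_comp:
  assumes M: "sub_mod M" and N: "sub_mod N" and f: "hlinear A M N r f" and g: "hadd N g" and t: "t = r + s"
  shows "hat N s g * hat M r f = hat M t (\<lambda>i j F. g (i + r) j (f i j F))"
proof -
  have c: "hadd M (\<lambda>i j F. g (i + r) j (f i j F))"
    using f g unfolding hadd_def hlinear_def by simp
  show ?thesis
  proof (intro aend_eqI ext, goal_cases)
    case (1 x i j n w)
    have i: "i - s - r = i - t" "i - t + r = i - s" using t by simp_all
    have "f (i - t) j (proj (comod A M (i - t) j) (x (i - t) j)) \<in> comod A N (i - s) j"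
      using hlinearD(1)[OF f proj_props(2)[OF comod_hsub[OF M]], of "i - t" j] i by metis
    thus ?case
      using proj_props(3)[OF comod_hsub[OF N]]
      by (simp add: app_hat[OF N g] app_hat[OF M hlinear_hadd[OF f]] app_hat[OF M c] i)
  qed
qed

lemma hat_add:
  assumes M: "sub_mod M" and f: "hadd M f" and g: "hadd M g"
  shows "hat M r f + hat M r g = hat M r (f + g)" "hadd M (f + g)"
proof -
  show h: "hadd M (f + g)" using f g unfolding hadd_def by simp
  show "hat M r f + hat M r g = hat M r (f + g)"
    by (intro aend_eqI ext) (simp add: app_hat[OF M f] app_hat[OF M g] app_hat[OF M h])
qed

lemma hat_neg:
  assumes M: "sub_mod M" and f: "hadd M f"
  shows "- hat M r f = hat M r (- f)" "hadd M (- f)"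
proof -
  show h: "hadd M (- f)" using f unfolding hadd_def by simp
  show "- hat M r f = hat M r (- f)"
    by (intro aend_eqI ext) (simp add: app_hat[OF M f] app_hat[OF M h])
qed

lemma hat_zero: "sub_mod M \<Longrightarrow> hat M r 0 = 0" "hadd M 0"
proof -
  show h: "hadd M 0" unfolding hadd_def by simp
  assume M: "sub_mod M"
  show "hat M r 0 = 0" by (intro aend_eqI ext) (simp add: app_hat[OF M h])
qed

lemma hat_diff:
  assumes M: "sub_mod M" and f: "hadd M f" and g: "hadd M g"
  shows "hat M r f - hat M r g = hat M r (f - g)"
  unfolding diff_conv_add_uminus hat_neg(1)[OF M g] hat_add(1)[OF M f hat_neg(2)[OF M g]] ..

lemma shS_hat:
  assumes M: "sub_mod M" and f: "hadd M f" and t: "t = r - 1"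
  shows "shS * hat M r f = hat M t f" "shS' * hat M t f = hat M r f"
proof -
  have 1: "i + 1 - r = i - t" "i - 1 - t = i - r" for i using t by simp_all
  show "shS * hat M r f = hat M t f" "shS' * hat M t f = hat M r f"
    by (intro aend_eqI ext; simp add: app_hat[OF M f] 1)+
qed

lemma hat_shS:
  assumes M: "sub_mod M" and f: "hadd M f" and t: "t = r + 1"
  shows "hat M r f * shS' = hat (shift_mod M) t (shift_map f)"
    "hat (shift_mod M) t (shift_map f) * shS = hat M r f"
proof -
  have sM: "sub_mod (shift_mod M)" using M by (simp add: shift_mod_simps)
  have sf: "hadd (shift_mod M) (shift_map f)"
    using f unfolding hadd_def comod_shift_mod by (simp add: shift_map_def)
  have i: "i - r - 1 = i - t" "i - r = i - t + 1" for i using t by simp_all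
  show "hat M r f * shS' = hat (shift_mod M) t (shift_map f)"
    by (intro aend_eqI ext) (simp add: app_hat[OF M f] app_hat[OF sM sf] comod_shift_mod i, simp add: shift_map_def)
  from this[symmetric] show "hat (shift_mod M) t (shift_map f) * shS = hat M r f"
    by (simp add: mult.assoc shS_inv)
qed

text \<open>Empty unless both modules are objects, so that membership carries this information, as
  \<open>Hm_obj\<close> demands.\<close>

definition HmS :: "('b, 's, 'k) hmod \<Rightarrow> ('b, 's, 'k) hmod \<Rightarrow> int \<Rightarrow> ('b, 's, 'k) hring set" where
  "HmS M N r = (if M \<in> tf_modules A \<and> N \<in> tf_modules A
     then hat M r ` {f. comodule_map A M N r f \<and> unital_map A M f} else {})"

definition eM :: "('b, 's, 'k) hmod \<Rightarrow> ('b, 's, 'k) hring" where "eM M = hat M 0 (\<lambda>i j F. F)"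
definition dM :: "('b, 's, 'k) hmod \<Rightarrow> ('b, 's, 'k) hring" where "dM M = hat M 1 (dif M)"

text \<open>\<open>ZcS\<close>, \<open>htpS\<close> and \<open>coneS\<close> spell out the constants
  that \<open>dg_base\<close> introduces by \<open>defines\<close>; they name these constants when
  the locale is interpreted.\<close>

definition ZcS :: "('b, 's, 'k) hmod \<Rightarrow> ('b, 's, 'k) hmod \<Rightarrow> ('b, 's, 'k) hring set" where
  "ZcS = (\<lambda>X Y. {f \<in> HmS X Y 0. dM Y * f = f * dM X})"
definition htpS :: "('b, 's, 'k) hmod \<Rightarrow> ('b, 's, 'k) hmod \<Rightarrow> ('b, 's, 'k) hring \<Rightarrow> ('b, 's, 'k) hring \<Rightarrow> bool" where
  "htpS = (\<lambda>X Y f g. \<exists>H\<in>HmS X Y (-1). f - g = dM Y * H + H * dM X)"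
definition coneS :: "('b, 's, 'k) hmod \<Rightarrow> ('b, 's, 'k) hmod \<Rightarrow> ('b, 's, 'k) hring \<Rightarrow> ('b, 's, 'k) hmod
    \<Rightarrow> ('b, 's, 'k) hring \<Rightarrow> ('b, 's, 'k) hring \<Rightarrow> ('b, 's, 'k) hring \<Rightarrow> ('b, 's, 'k) hring \<Rightarrow> bool" where
  "coneS = (\<lambda>X Y u K i j p q. u \<in> ZcS X Y \<and> K \<in> Obj (Htf A) \<and>
      i \<in> HmS Y K 0 \<and> j \<in> HmS K Y 0 \<and> p \<in> HmS K X 1 \<and> q \<in> HmS X K (-1) \<and>
      j * i = eM Y \<and> p * q = eM X \<and> j * q = 0 \<and> p * i = 0 \<and> i * j + q * p = eM K \<and>
      dM K = i * dM Y * j + i * u * p - q * dM X * p)"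

lemma Obj_Htf [simp]: "Obj (Htf A) = tf_modules A"
  by (simp add: Htf_def)

lemma HmSI:
  "M \<in> tf_modules A \<Longrightarrow> N \<in> tf_modules A \<Longrightarrow> comodule_map A M N r f \<Longrightarrow> unital_map A M f \<Longrightarrow> hat M r f \<in> HmS M N r"
  by (simp add: HmS_def)

lemma HmSE:
  assumes "x \<in> HmS M N r"
  obtains f where "M \<in> tf_modules A" "N \<in> tf_modules A" "comodule_map A M N r f" "unital_map A M f" "x = hat M r f"
    "hlinear A M N r f" "hadd M f" "sub_mod M" "sub_mod N"
  using assms unfolding HmS_def
  by (auto split: if_splits dest: tfD(1) comodule_mapD(1) intro: hlinear_hadd[OF comodule_mapD(1)])

lemma dg_base_Htf: "dg_base (Htf A) HmS eM dM shS shS' (shift_mod :: ('b, 's, 'k) hmod \<Rightarrow> _)"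
proof (unfold_locales, goal_cases)
  case 1 show ?case by (rule shS_inv)
next
  case 2 show ?case by (rule shS_inv)
next
  case (3 f X Y r) thus ?case by (auto elim: HmSE)
next
  case (4 X Y r)
  hence "hat X r 0 \<in> HmS X Y r" by (intro HmSI) (auto simp: tfD(1) comodule_map_zero unital_zero)
  thus ?case using 4 by (simp add: hat_zero(1) tfD(1))
next
  case (5 f X Y r g)
  thus ?case
    by (elim HmSE) (auto simp: hat_add intro!: HmSI comodule_map_add unital_add)
next
  case (6 f X Y r)
  thus ?case
    by (elim HmSE) (auto simp: hat_neg intro!: HmSI comodule_map_neg unital_neg)
next
  case (7 f X Y r g Z s t)
  show ?case
    using 7(1) 7(2)
  proof (elim HmSE)
    fix f0 g0 assume *: "X \<in> tf_modules A" "Y \<in> tf_modules A" "comodule_map A X Y r f0" "unital_map A X f0" "f = hat X r f0"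
       "hlinear A X Y r f0" "Z \<in> tf_modules A" "comodule_map A Y Z s g0" "unital_map A Y g0"
       "g = hat Y s g0" "hadd Y g0" "sub_mod X" "sub_mod Y"
    have "g * f = hat X t (\<lambda>i j F. g0 (i + r) j (f0 i j F))"
      unfolding * by (rule hat_comp) (use * 7(3) in auto)
    moreover have "comodule_map A X Z t (\<lambda>i j F. g0 (i + r) j (f0 i j F))"
      using comodule_map_comp[OF *(3,8)] 7(3) by simp
    moreover have "unital_map A X (\<lambda>i j F. g0 (i + r) j (f0 i j F))"
      by (rule unital_comp[OF *(3,12,4,8,13,9)])
    ultimately show "g * f \<in> HmS X Z t" using HmSI * by simp
  qed
next
  case (8 X) thus ?case unfolding eM_def by (auto intro: HmSI comodule_map_id unital_id)
next
  case (9 f X Y r)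
  thus ?case
  proof (elim HmSE)
    fix f0 assume *: "Y \<in> tf_modules A" "f = hat X r f0" "hlinear A X Y r f0" "sub_mod X" "sub_mod Y"
    show "eM Y * f = f"
      unfolding * eM_def using hat_comp[OF *(4,5,3) hlinear_hadd[OF comodule_mapD(1)[OF comodule_map_id]], of r 0] by simp
  qed
next
  case (10 f X Y r)
  thus ?case
  proof (elim HmSE)
    fix f0 assume *: "Y \<in> tf_modules A" "f = hat X r f0" "hadd X f0" "sub_mod X"
    show "f * eM X = f"
      unfolding * eM_def using hat_comp[OF *(4,4) comodule_mapD(1)[OF comodule_map_id] *(3), of r r] by simp
  qed
next
  case (11 X)
  hence X: "sub_mod X" "hlinear A X X 1 (dif X)" using tfD(1,4) by auto
  show ?case unfolding eM_def dM_def
    using hat_comp[OF X(1,1,2) hlinear_hadd[OF comodule_mapD(1)[OF comodule_map_id]], of 1 0] by simp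
next
  case (12 X)
  hence X: "sub_mod X" "hlinear A X X 1 (dif X)" using tfD(1,4) by auto
  show ?case unfolding eM_def dM_def
    using hat_comp[OF X(1,1) comodule_mapD(1)[OF comodule_map_id] hlinear_hadd[OF X(2)], of 1 1] by simp
next
  case (13 X)
  hence X: "X \<in> tf_modules A" "sub_mod X" "hlinear A X X 1 (dif X)" using tfD(1,4) by auto
  have "dM X * dM X = hat X 2 (\<lambda>i j F. dif X (i + 1) j (dif X i j F))"
    unfolding dM_def by (rule hat_comp[OF X(2,2,3) hlinear_hadd[OF X(3)]]) simp
  also have "\<dots> = hat X 2 0"
    using tfD(6)[OF X(1)] by (subst hat_eq_iff[OF X(2) hlinear_hadd[OF hlinear_comp[OF X(3,3)]] hat_zero(2)]) auto
  finally show ?case using hat_zero(1)[OF X(2)] by metis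
next
  case 14
  have "N \<in> shift_mod ` tf_modules A" if "N \<in> tf_modules A" for N :: "('b, 's, 'k) hmod"
    using shift_mod_surj[of N] that tf_shift by blast
  thus ?case unfolding bij_betw_def Obj_Htf using shift_mod_inj tf_shift by (auto simp: inj_on_def)
next
  case (15 X)
  hence X: "sub_mod X" using tfD(1) by auto
  note i = hlinear_hadd[OF comodule_mapD(1)[OF comodule_map_id]]
  have "shS * eM X * shS' = hat X (-1) (\<lambda>i j F. F) * shS'"
    unfolding eM_def using shS_hat(1)[OF X i, of "-1" 0] by simp
  also have "\<dots> = hat (shift_mod X) 0 (shift_map (\<lambda>i j F. F))" by (rule hat_shS(1)[OF X i]) simp
  finally show ?case unfolding eM_def by (simp add: shift_map_def)
next
  case (16 X)
  hence X: "sub_mod X" "hadd X (dif X)" using tfD(1) hlinear_hadd[OF tfD(4)] by auto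
  have "- (shS * dM X * shS') = - hat X 0 (dif X) * shS'"
    unfolding dM_def using shS_hat(1)[OF X, of 0 1] by simp
  also have "\<dots> = hat X 0 (- dif X) * shS'" using hat_neg(1)[OF X] by simp
  also have "\<dots> = hat (shift_mod X) 1 (shift_map (- dif X))"
    by (rule hat_shS(1)[OF X(1) hat_neg(2)[OF X]]) simp
  also have "shift_map (- dif X) = dif (shift_mod X)"
    by (simp add: shift_map_def shift_mod_def fun_eq_iff)
  finally show ?case unfolding dM_def by simp
next
  case (17 f X Y r t)
  thus ?case
    by (elim HmSE) (auto simp: shS_hat(1) comodule_map_shift_right tf_shift intro!: HmSI)
next
  case (18 Y f X r t)
  have Y: "Y \<in> tf_modules A" using 18 by simp
  show ?case
    using 18(2)
  proof (elim HmSE)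
    fix f0 assume *: "X \<in> tf_modules A" "comodule_map A X (shift_mod Y) r f0" "unital_map A X f0" "f = hat X r f0"
      "hadd X f0" "sub_mod X"
    have "shS' * f = hat X t f0" unfolding * using shS_hat(2)[OF *(6,5), of r t] 18(3) by simp
    thus "shS' * f \<in> HmS X Y t" using HmSI[OF *(1) Y _ *(3), of t] *(2) 18(3) by (simp add: comodule_map_shift_right)
  qed
next
  case (19 f X Y r t)
  thus ?case
    by (elim HmSE) (auto simp: hat_shS(1) comodule_map_shift_left unital_shift_left tf_shift intro!: HmSI)
next
  case (20 X f Y r t)
  have X: "X \<in> tf_modules A" "sub_mod X" using 20 tfD(1) by auto
  show ?case
    using 20(2)
  proof (elim HmSE)
    fix f0 assume *: "Y \<in> tf_modules A" "comodule_map A (shift_mod X) Y r f0" "unital_map A (shift_mod X) f0"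
      "f = hat (shift_mod X) r f0"
    obtain f1 where f1: "f0 = shift_map f1" using shift_map_surj by blast
    have f1': "comodule_map A X Y t f1" "unital_map A X f1"
      using *(2,3) 20(3) unfolding f1 comodule_map_shift_left unital_shift_left by auto
    have "f * shS = hat X t f1"
      unfolding * f1 using hat_shS(2)[OF X(2) hlinear_hadd[OF comodule_mapD(1)[OF f1'(1)]], of r t] 20(3) by simp
    thus "f * shS \<in> HmS X Y t" using HmSI[OF X(1) *(1) f1'] by simp
  qed
qed

lemma tf_hadd: "f \<in> tf_morphisms A M N \<Longrightarrow> hadd M f"
  using hlinear_hadd[OF tf_morD(3)] .

lemma dif_hadd: "M \<in> tf_modules A \<Longrightarrow> hadd M (dif M)"
  using hlinear_hadd[OF tfD(4)] .

lemma htpS_hat: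
  assumes M: "M \<in> tf_modules A" and N: "N \<in> tf_modules A" and f: "hadd M f" and g: "hadd M g"
  shows "htpS M N (hat M 0 f) (hat M 0 g) \<longleftrightarrow> homotopic A M N f g"
proof -
  note M' = tfD(1)[OF M] and N' = tfD(1)[OF N]
  have eq: "hat M 0 f - hat M 0 g = dM N * hat M (-1) H + hat M (-1) H * dM M \<longleftrightarrow>
     (\<forall>i j. \<forall>F\<in>comod A M i j. f i j F - g i j F = dif N (i - 1) j (H i j F) + H (i + 1) j (dif M i j F))"
    if H: "comodule_map A M N (-1) H" for H
  proof -
    note Hl = comodule_mapD(1)[OF H]
    note hl = hlinear_comp[OF Hl tfD(4)[OF N]] hlinear_comp[OF tfD(4)[OF M] Hl]
    have "dM N * hat M (-1) H = hat M 0 (\<lambda>i j F. dif N (i + -1) j (H i j F))"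
      unfolding dM_def by (rule hat_comp[OF M' N' Hl dif_hadd[OF N]]) simp
    moreover have "hat M (-1) H * dM M = hat M 0 (\<lambda>i j F. H (i + 1) j (dif M i j F))"
      unfolding dM_def by (rule hat_comp[OF M' M' tfD(4)[OF M] hlinear_hadd[OF Hl]]) simp
    ultimately have "dM N * hat M (-1) H + hat M (-1) H * dM M =
        hat M 0 ((\<lambda>i j F. dif N (i + -1) j (H i j F)) + (\<lambda>i j F. H (i + 1) j (dif M i j F)))"
      using hat_add(1)[OF M' hlinear_hadd[OF hl(1)] hlinear_hadd[OF hl(2)]] by simp
    moreover have "hadd M (f - g)" using f g unfolding hadd_def by simp
    ultimately show ?thesis
      unfolding hat_diff[OF M' f g]
      using hat_eq_iff[OF M' _ hat_add(2)[OF M' hlinear_hadd[OF hl(1)] hlinear_hadd[OF hl(2)]], of "f - g" 0] by simp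
  qed
  show ?thesis
    unfolding htpS_def homotopic_def HmS_def using M N eq by auto
qed

lemma ZcS_iff:
  assumes M: "M \<in> tf_modules A" and N: "N \<in> tf_modules A"
  shows "ZcS M N = hat M 0 ` tf_morphisms A M N"
proof -
  note M' = tfD(1)[OF M] and N' = tfD(1)[OF N]
  have eq: "dM N * hat M 0 f = hat M 0 f * dM M \<longleftrightarrow>
     (\<forall>i j. \<forall>F\<in>comod A M i j. f (i + 1) j (dif M i j F) = dif N i j (f i j F))"
    if f: "comodule_map A M N 0 f" for f
  proof -
    note fl = comodule_mapD(1)[OF f]
    have "dM N * hat M 0 f = hat M 1 (\<lambda>i j F. dif N (i + 0) j (f i j F))"
      unfolding dM_def by (rule hat_comp[OF M' N' fl dif_hadd[OF N]]) simp
    moreover have "hat M 0 f * dM M = hat M 1 (\<lambda>i j F. f (i + 1) j (dif M i j F))"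
      unfolding dM_def by (rule hat_comp[OF M' M' tfD(4)[OF M] hlinear_hadd[OF fl]]) simp
    ultimately show ?thesis
      using hat_eq_iff[OF M' hlinear_hadd[OF hlinear_comp[OF fl tfD(4)[OF N]]] hlinear_hadd[OF hlinear_comp[OF tfD(4)[OF M] fl]], of 1]
      by auto
  qed
  show ?thesis
    unfolding ZcS_def HmS_def tf_morphisms_def using M N eq by auto
qed

text \<open>Ring elements forget the values of a map outside the comodule, whereas an arrow of
  \<open>Htf\<close> is a set of functions. \<open>KL\<close> returns all functions that represent
  the class of a ring element.\<close>

definition KL :: "('b, 's, 'k) hmod \<Rightarrow> ('b, 's, 'k) hmod \<Rightarrow> ('b, 's, 'k) hring \<Rightarrow> ('b, 's, 'k) hmap set" where
  "KL M N x = {g \<in> tf_morphisms A M N. htpS M N x (hat M 0 g)}"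

lemma hclass_KL:
  assumes "M \<in> tf_modules A" "N \<in> tf_modules A" "hadd M f"
  shows "hclass A M N f = KL M N (hat M 0 f)"
  unfolding hclass_def KL_def using htpS_hat[OF assms] tf_hadd by blast

lemma cone_coneS:
  fixes X Y :: "('b, 's::infinite, 'k) hmod"
  assumes X: "X \<in> tf_modules A" and Y: "Y \<in> tf_modules A" and u: "u \<in> tf_morphisms A X Y"
  defines "K \<equiv> cone_mod X Y u"
  shows "coneS X Y (hat X 0 u) K (hat Y 0 (\<lambda>i j. lmap inl)) (hat K 0 (\<lambda>i j. lmap prl))
     (hat K 1 (\<lambda>i j. lmap prr)) (hat X (-1) (\<lambda>i j. lmap inr))"
proof -
  have K: "K \<in> tf_modules A" unfolding K_def by (rule cone_tf[OF X Y u])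
  note X' = tfD(1)[OF X] and Y' = tfD(1)[OF Y] and K' = tfD(1)[OF K]
  note cm = cone_comodule_maps[OF X Y u, folded K_def]
  note cl = cm[THEN comodule_mapD(1)]
  note ca = cl[THEN hlinear_hadd]
  note un = inl_lin[THEN strict_lmap, THEN strict_unital]
  note ul = tf_morD(3)[OF u]
  have m: "hat Y 0 (\<lambda>i j. lmap inl) \<in> HmS Y K 0" "hat K 0 (\<lambda>i j. lmap prl) \<in> HmS K Y 0"
    "hat K 1 (\<lambda>i j. lmap prr) \<in> HmS K X 1" "hat X (-1) (\<lambda>i j. lmap inr) \<in> HmS X K (-1)"
    by (intro HmSI X Y K cm un)+
  have z: "hat X 0 u \<in> ZcS X Y" using ZcS_iff[OF X Y] u by blast
  have "hat K 0 (\<lambda>i j. lmap prl) * hat Y 0 (\<lambda>i j. lmap inl) = hat Y 0 (\<lambda>i j F. lmap prl (lmap inl F))"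
    by (rule hat_comp[OF Y' K' cl(3) ca(1)]) simp
  hence 1: "hat K 0 (\<lambda>i j. lmap prl) * hat Y 0 (\<lambda>i j. lmap inl) = eM Y" by (simp add: eM_def)
  have "hat K 1 (\<lambda>i j. lmap prr) * hat X (-1) (\<lambda>i j. lmap inr) = hat X 0 (\<lambda>i j F. lmap prr (lmap inr F))"
    by (rule hat_comp[OF X' K' cl(4) ca(2)]) simp
  hence 2: "hat K 1 (\<lambda>i j. lmap prr) * hat X (-1) (\<lambda>i j. lmap inr) = eM X" by (simp add: eM_def)
  have "hat K 0 (\<lambda>i j. lmap prl) * hat X (-1) (\<lambda>i j. lmap inr) = hat X (-1) (\<lambda>i j F. lmap prl (lmap inr F))"
    by (rule hat_comp[OF X' K' cl(4) ca(1)]) simp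
  moreover have "(\<lambda>i j F. lmap prl (lmap inr F)) = (0 :: ('b, 's, 'k) hmap)"
    by (intro ext) (simp only: lmap_inl zero_fun_def)
  ultimately have 3: "hat K 0 (\<lambda>i j. lmap prl) * hat X (-1) (\<lambda>i j. lmap inr) = 0" by (simp only: hat_zero(1)[OF X'])
  have "hat K 1 (\<lambda>i j. lmap prr) * hat Y 0 (\<lambda>i j. lmap inl) = hat Y 1 (\<lambda>i j F. lmap prr (lmap inl F))"
    by (rule hat_comp[OF Y' K' cl(3) ca(2)]) simp
  moreover have "(\<lambda>i j F. lmap prr (lmap inl F)) = (0 :: ('b, 's, 'k) hmap)"
    by (intro ext) (simp only: lmap_inl zero_fun_def)
  ultimately have 4: "hat K 1 (\<lambda>i j. lmap prr) * hat Y 0 (\<lambda>i j. lmap inl) = 0" by (simp only: hat_zero(1)[OF Y'])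
  note h1 = hlinear_comp[OF cl(1) cl(3)] hlinear_comp[OF cl(2) cl(4)]
  have "hat Y 0 (\<lambda>i j. lmap inl) * hat K 0 (\<lambda>i j. lmap prl) + hat X (-1) (\<lambda>i j. lmap inr) * hat K 1 (\<lambda>i j. lmap prr)
     = hat K 0 ((\<lambda>i j F. lmap inl (lmap prl F)) + (\<lambda>i j F. lmap inr (lmap prr F)))"
    using hat_comp[OF K' Y' cl(1) ca(3), of 0] hat_comp[OF K' X' cl(2) ca(4), of 0]
      hat_add(1)[OF K' h1[THEN hlinear_hadd]] by simp
  also have "(\<lambda>i j F. lmap inl (lmap prl F)) + (\<lambda>i j F. lmap inr (lmap prr F)) = (\<lambda>i j F. F :: ('b, 's, 'k) hcofree)"
    by (intro ext) (simp add: lmap_def fun_cong[OF inl_prl, unfolded plus_fun_apply])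
  finally have 5: "hat Y 0 (\<lambda>i j. lmap inl) * hat K 0 (\<lambda>i j. lmap prl) + hat X (-1) (\<lambda>i j. lmap inr) * hat K 1 (\<lambda>i j. lmap prr) = eM K"
    by (simp add: eM_def)
  have a: "hat Y 0 (\<lambda>i j. lmap inl) * dM Y * hat K 0 (\<lambda>i j. lmap prl) = hat K 1 (\<lambda>i j F. lmap inl (dif Y i j (lmap prl F)))"
    "hadd K (\<lambda>i j F. lmap inl (dif Y i j (lmap prl F)))"
  proof -
    note l = hlinear_comp[OF cl(1) tfD(4)[OF Y]]
    have "dM Y * hat K 0 (\<lambda>i j. lmap prl) = hat K 1 (\<lambda>i j F. dif Y (i + 0) j (lmap prl F))"
      unfolding dM_def by (rule hat_comp[OF K' Y' cl(1) dif_hadd[OF Y]]) simp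
    thus "hat Y 0 (\<lambda>i j. lmap inl) * dM Y * hat K 0 (\<lambda>i j. lmap prl) = hat K 1 (\<lambda>i j F. lmap inl (dif Y i j (lmap prl F)))"
      using hat_comp[OF K' Y' l ca(3), of 1] by (simp add: mult.assoc)
    show "hadd K (\<lambda>i j F. lmap inl (dif Y i j (lmap prl F)))"
      using hlinear_hadd[OF hlinear_comp[OF l cl(3)]] by simp
  qed
  have b: "hat Y 0 (\<lambda>i j. lmap inl) * hat X 0 u * hat K 1 (\<lambda>i j. lmap prr) = hat K 1 (\<lambda>i j F. lmap inl (u (i + 1) j (lmap prr F)))"
    "hadd K (\<lambda>i j F. lmap inl (u (i + 1) j (lmap prr F)))"
  proof -
    note l = hlinear_comp[OF cl(2) ul]
    have "hat X 0 u * hat K 1 (\<lambda>i j. lmap prr) = hat K 1 (\<lambda>i j F. u (i + 1) j (lmap prr F))"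
      by (rule hat_comp[OF K' X' cl(2) hlinear_hadd[OF ul]]) simp
    thus "hat Y 0 (\<lambda>i j. lmap inl) * hat X 0 u * hat K 1 (\<lambda>i j. lmap prr) = hat K 1 (\<lambda>i j F. lmap inl (u (i + 1) j (lmap prr F)))"
      using hat_comp[OF K' Y' l ca(3), of 1] by (simp add: mult.assoc)
    show "hadd K (\<lambda>i j F. lmap inl (u (i + 1) j (lmap prr F)))"
      using hlinear_hadd[OF hlinear_comp[OF l cl(3)]] by simp
  qed
  have c: "hat X (-1) (\<lambda>i j. lmap inr) * dM X * hat K 1 (\<lambda>i j. lmap prr) = hat K 1 (\<lambda>i j F. lmap inr (dif X (i + 1) j (lmap prr F)))"
    "hadd K (\<lambda>i j F. lmap inr (dif X (i + 1) j (lmap prr F)))"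
  proof -
    note l = hlinear_comp[OF cl(2) tfD(4)[OF X]]
    have "dM X * hat K 1 (\<lambda>i j. lmap prr) = hat K 2 (\<lambda>i j F. dif X (i + 1) j (lmap prr F))"
      unfolding dM_def by (rule hat_comp[OF K' X' cl(2) dif_hadd[OF X]]) simp
    thus "hat X (-1) (\<lambda>i j. lmap inr) * dM X * hat K 1 (\<lambda>i j. lmap prr) = hat K 1 (\<lambda>i j F. lmap inr (dif X (i + 1) j (lmap prr F)))"
      using hat_comp[OF K' X' l ca(4), of 1] by (simp add: mult.assoc)
    show "hadd K (\<lambda>i j F. lmap inr (dif X (i + 1) j (lmap prr F)))"
      using hlinear_hadd[OF hlinear_comp[OF l cl(4)]] by simp
  qed
  have "dif K = (\<lambda>i j F. lmap inl (dif Y i j (lmap prl F))) + (\<lambda>i j F. lmap inl (u (i + 1) j (lmap prr F)))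
      - (\<lambda>i j F. lmap inr (dif X (i + 1) j (lmap prr F)))"
    unfolding K_def by (intro ext) (simp add: cone_dif[OF X Y u] lmap_simps(1)[OF inl_lin(1)])
  hence dK: "dM K = hat K 1 ((\<lambda>i j F. lmap inl (dif Y i j (lmap prl F))) + (\<lambda>i j F. lmap inl (u (i + 1) j (lmap prr F)))
      - (\<lambda>i j F. lmap inr (dif X (i + 1) j (lmap prr F))))"
    unfolding dM_def by simp
  have 6: "dM K = hat Y 0 (\<lambda>i j. lmap inl) * dM Y * hat K 0 (\<lambda>i j. lmap prl)
     + hat Y 0 (\<lambda>i j. lmap inl) * hat X 0 u * hat K 1 (\<lambda>i j. lmap prr)
     - hat X (-1) (\<lambda>i j. lmap inr) * dM X * hat K 1 (\<lambda>i j. lmap prr)"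
    unfolding a(1) b(1) c(1) dK hat_add(1)[OF K' a(2) b(2)] hat_diff[OF K' hat_add(2)[OF K' a(2) b(2)] c(2)] ..
  show ?thesis unfolding coneS_def using z m K 1 2 3 4 5 6 by simp
qed

lemma zeroth_lmap: "lin \<phi> \<Longrightarrow> zeroth (\<lambda>i j. lmap \<phi>) p q m = (\<lambda>n. \<phi> (m n))"
  by (simp add: zeroth_def lmap_simps(6)) (simp add: corestr_def pure_def)

text \<open>The projection \<open>prl\<close> fails to commute with the differential by the term
  \<open>u\<close> after \<open>prr\<close>. For strict \<open>u\<close> this term has no Taylor
  component of positive length, which is the compatibility required of a semi-split splitting; it
  also identifies the connecting map as the shift of \<open>- u\<close>.\<close>

lemma strict_cone_triangle:
  fixes X Y :: "('b, 's::infinite, 'k) hmod"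
  assumes X: "X \<in> tf_modules A" and Y: "Y \<in> tf_modules A" and u: "u \<in> tf_morphisms A X Y" and s: "strict_map A X u"
  defines "K \<equiv> cone_mod X Y u"
  shows "(Y, K, shift_mod X, hclass A Y K (\<lambda>i j. lmap inl), hclass A K (shift_mod X) (\<lambda>i j. lmap prr),
     hclass A (shift_mod X) (shift_mod Y) (- shift_map u)) \<in> semi_split_triangles A"
proof -
  have K: "K \<in> tf_modules A" unfolding K_def by (rule cone_tf[OF X Y u])
  have sX: "shift_mod X \<in> tf_modules A" "shift_mod Y \<in> tf_modules A" using X Y tf_shift by blast+
  note cm = cone_comodule_maps[OF X Y u, folded K_def]
  note st = inl_lin[THEN strict_lmap]
  note un = st[THEN strict_unital]
  note pr = cone_dif_proj[OF X Y u, folded K_def]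
  have i: "(\<lambda>i j. lmap inl) \<in> tf_morphisms A Y K"
  proof (rule tf_morI[OF cm(3) un(1)])
    fix i j F assume F: "F \<in> comod A Y i j"
    have "u (i + 1) j 0 = 0" "dif X (i + 1) j 0 = 0"
      using hlinear_more(1)[OF tf_morD(3)[OF u] tfD(1)[OF X]] hlinear_more(1)[OF tfD(4)[OF X] tfD(1)[OF X]] by blast+
    thus "lmap inl (dif Y i j F) = dif K i j (lmap inl F)"
      unfolding K_def cone_dif[OF X Y u] by (simp only: lmap_inl lmap_simps(3)[OF inl_lin(2)] add_0_right diff_0_right)
  qed
  have g: "(\<lambda>i j. lmap prr) \<in> tf_morphisms A K (shift_mod X)"
  proof (rule tf_morI[OF _ un(4)])
    show "comodule_map A K (shift_mod X) 0 (\<lambda>i j. lmap prr)"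
      using cm(2) by (simp add: comodule_map_shift_right)
  qed (simp add: pr shift_mod_simps)
  have h: "- shift_map u \<in> tf_morphisms A (shift_mod X) (shift_mod Y)"
    using tf_mor_neg[OF sX] tf_mor_shift[OF X] u by blast
  have 0: "0 \<in> spc X i j" "0 \<in> spc Y i j" for i j
    using tfD(1)[OF X] tfD(1)[OF Y] by (auto simp: is_subspace_def)
  have "semi_split A Y K (shift_mod X) (\<lambda>i j. lmap inl) (\<lambda>i j. lmap prr) (\<lambda>i j. lmap prl)"
    unfolding semi_split_def zeroth_lmap[OF inl_lin(1)] zeroth_lmap[OF inl_lin(4)]
  proof (intro conjI allI ballI impI Y K sX i g st cm)
    fix p q
    show "inj_on (\<lambda>m n. inl (m n)) (hspc Y p q)"
    proof (rule inj_onI)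
      fix x y :: "nat \<Rightarrow> 's \<Rightarrow> 'k" assume "(\<lambda>n. inl (x n)) = (\<lambda>n. inl (y n))"
      hence "prl (inl (x n)) = prl (inl (y n))" for n by (metis (no_types))
      thus "x = y" by (simp add: fun_eq_iff)
    qed
    show "(\<lambda>m n. inl (m n)) ` hspc Y p q = {m \<in> hspc K p q. (\<lambda>n. prr (m n)) = 0}"
    proof (intro equalityI subsetI)
      fix m assume "m \<in> {m \<in> hspc K p q. (\<lambda>n. prr (m n)) = 0}"
      hence m: "m \<in> hspc K p q" "\<And>n. prr (m n) = 0" by (auto simp: fun_eq_iff)
      have "m = (\<lambda>n. inl (prl (m n)))"
        using inl_prl[of "m _"] m(2) linD(3)[OF inl_lin(2)] by (metis add_0_right)
      moreover have "(\<lambda>n. prl (m n)) \<in> hspc Y p q" using m(1) by (simp add: hspc_def K_def cone_mod_def)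
      ultimately show "m \<in> (\<lambda>m n. inl (m n)) ` hspc Y p q" by (rule image_eqI)
    qed (use 0 in \<open>auto simp: hspc_def K_def cone_mod_def zero_fun_def[symmetric]\<close>)
    show "(\<lambda>m n. prr (m n)) ` hspc K p q = hspc (shift_mod X) p q"
    proof (intro equalityI subsetI)
      fix m assume m: "m \<in> hspc (shift_mod X) p q"
      have "m = (\<lambda>n. prr (inr (m n)))" by simp
      moreover have "(\<lambda>n. inr (m n)) \<in> hspc K p q"
        using m 0 by (simp add: hspc_def K_def cone_mod_def shift_mod_simps)
      ultimately show "m \<in> (\<lambda>m n. prr (m n)) ` hspc K p q" by (rule image_eqI)
    qed (auto simp: hspc_def K_def cone_mod_def shift_mod_simps)
  next
    fix i j F show "lmap prl (lmap inl F) = F" by simp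
  next
    fix l :: nat and i j F assume l: "1 \<le> l" and F: "F \<in> comod A K i j \<inter> of_length l"
    have "lmap prr F \<in> comod A X (i + 1) j"
      using cone_comod(2)[OF X Y u, folded K_def] F by blast
    moreover have "lmap prr F \<in> of_length l" using lmap_length[OF X Y u inl_lin(4)] F by blast
    ultimately have "corestr (u (i + 1) j (lmap prr F)) = 0" using s l unfolding strict_map_def by blast
    thus "corestr (lmap prl (dif K i j F)) = corestr (dif Y i j (lmap prl F))"
      unfolding pr by (simp add: corestr_simps)
  qed
  moreover have "connecting_map A Y K (shift_mod X) (\<lambda>i j. lmap prr) (\<lambda>i j. lmap prl) (- shift_map u)"
    unfolding connecting_map_def using h pr(1) by (simp add: shift_map_def)
  ultimately show ?thesis unfolding semi_split_triangles_def by blast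
qed

text \<open>Restates semi-split data as ring identities, with \<open>ssec\<close> as the missing
  inclusion. Here \<open>shS' * hat N 0 h\<close> is the connecting map read as a map of degree one
  into \<open>L\<close>.\<close>

lemma semi_split_splitting:
  fixes L M N :: "('b, 's, 'k) hmod"
  assumes ss: "semi_split A L M N f g \<rho>" and cn: "connecting_map A L M N g \<rho> h"
  shows "hat L 0 f \<in> ZcS L M" "hat M 0 g \<in> ZcS M N" "hat N 0 h \<in> ZcS N (shift_mod L)"
    "hat M 0 \<rho> \<in> HmS M L 0" "hat N 0 (ssec M g \<rho>) \<in> HmS N M 0"
    "hat M 0 \<rho> * hat L 0 f = eM L" "hat M 0 g * hat N 0 (ssec M g \<rho>) = eM N"
    "hat M 0 \<rho> * hat N 0 (ssec M g \<rho>) = 0" "hat M 0 g * hat L 0 f = 0"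
    "hat L 0 f * hat M 0 \<rho> + hat N 0 (ssec M g \<rho>) * hat M 0 g = eM M"
    "hat M 0 \<rho> * dM M = dM L * hat M 0 \<rho> - shS' * hat N 0 h * hat M 0 g"
proof -
  note D = ssD[OF ss] and lin = ss_lin[OF ss] and sec = ssec[OF ss]
  note \<sigma> = ssec_comodule_map[OF ss] ssec_strict[OF ss]
  have h: "h \<in> tf_morphisms A N (shift_mod L)" using cn unfolding connecting_map_def by blast
  have sL: "shift_mod L \<in> tf_modules A" using D(1) tf_shift by blast
  note \<sigma>l = comodule_mapD(1)[OF \<sigma>(1)]
  note idl = hlinear_hadd[OF comodule_mapD(1)[OF comodule_map_id]]
  show "hat L 0 f \<in> ZcS L M" "hat M 0 g \<in> ZcS M N" "hat N 0 h \<in> ZcS N (shift_mod L)"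
    using ZcS_iff D(1-4,6) h sL by blast+
  show "hat M 0 \<rho> \<in> HmS M L 0" "hat N 0 (ssec M g \<rho>) \<in> HmS N M 0"
    by (intro HmSI D(1-3,10) \<sigma>(1) strict_unital D(11) \<sigma>(2))+
  note c1 = hlinear_comp[OF lin(6,8)] hlinear_comp[OF \<sigma>l lin(7)] hlinear_comp[OF \<sigma>l lin(8)]
    hlinear_comp[OF lin(6,7)] hlinear_comp[OF lin(8,6)] hlinear_comp[OF lin(7) \<sigma>l]
  note a1 = c1[THEN hlinear_hadd]
  have h1: "hat M 0 \<rho> * hat L 0 f = hat L 0 (\<lambda>i j F. \<rho> (i + 0) j (f i j F))"
    by (rule hat_comp[OF lin(1,2,6) hlinear_hadd[OF lin(8)]]) simp
  thus "hat M 0 \<rho> * hat L 0 f = eM L"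
    unfolding eM_def h1 using D(12) by (subst hat_eq_iff[OF lin(1) a1(1) idl]) simp
  have h2: "hat M 0 g * hat N 0 (ssec M g \<rho>) = hat N 0 (\<lambda>i j F. g (i + 0) j (ssec M g \<rho> i j F))"
    by (rule hat_comp[OF lin(3,2) \<sigma>l hlinear_hadd[OF lin(7)]]) simp
  thus "hat M 0 g * hat N 0 (ssec M g \<rho>) = eM N"
    unfolding eM_def h2 using sec(2) by (subst hat_eq_iff[OF lin(3) a1(2) idl]) simp
  have h3: "hat M 0 \<rho> * hat N 0 (ssec M g \<rho>) = hat N 0 (\<lambda>i j F. \<rho> (i + 0) j (ssec M g \<rho> i j F))"
    by (rule hat_comp[OF lin(3,2) \<sigma>l hlinear_hadd[OF lin(8)]]) simp
  also have "\<dots> = hat N 0 0"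
    using sec(3) by (subst hat_eq_iff[OF lin(3) a1(3) hat_zero(2)]) simp
  finally show "hat M 0 \<rho> * hat N 0 (ssec M g \<rho>) = 0" using hat_zero(1)[OF lin(3)] by metis
  have h4: "hat M 0 g * hat L 0 f = hat L 0 (\<lambda>i j F. g (i + 0) j (f i j F))"
    by (rule hat_comp[OF lin(1,2,6) hlinear_hadd[OF lin(7)]]) simp
  also have "\<dots> = hat L 0 0"
    using ss_gf[OF ss] by (subst hat_eq_iff[OF lin(1) a1(4) hat_zero(2)]) simp
  finally show "hat M 0 g * hat L 0 f = 0" using hat_zero(1)[OF lin(1)] by metis
  have h5: "hat L 0 f * hat M 0 \<rho> = hat M 0 (\<lambda>i j F. f (i + 0) j (\<rho> i j F))"
    by (rule hat_comp[OF lin(2,1,8) hlinear_hadd[OF lin(6)]]) simp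
  have h6: "hat N 0 (ssec M g \<rho>) * hat M 0 g = hat M 0 (\<lambda>i j F. ssec M g \<rho> (i + 0) j (g i j F))"
    by (rule hat_comp[OF lin(2,3,7) hlinear_hadd[OF \<sigma>l]]) simp
  show "hat L 0 f * hat M 0 \<rho> + hat N 0 (ssec M g \<rho>) * hat M 0 g = eM M"
    unfolding h5 h6 hat_add(1)[OF lin(2) a1(5,6)] eM_def
    using ssec_decomp[OF ss] by (subst hat_eq_iff[OF lin(2) hat_add(2)[OF lin(2) a1(5,6)] idl]) simp
  note hl = tf_morD(3)[OF h]
  note c2 = hlinear_comp[OF tfD(4)[OF D(2)] lin(8)] hlinear_comp[OF lin(8) tfD(4)[OF D(1)]] hlinear_comp[OF lin(7) hl]
  note a2 = c2[THEN hlinear_hadd]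
  have k1: "hat M 0 \<rho> * dM M = hat M 1 (\<lambda>i j F. \<rho> (i + 1) j (dif M i j F))"
    unfolding dM_def by (rule hat_comp[OF lin(2,2) tfD(4)[OF D(2)] hlinear_hadd[OF lin(8)]]) simp
  have k2: "dM L * hat M 0 \<rho> = hat M 1 (\<lambda>i j F. dif L (i + 0) j (\<rho> i j F))"
    unfolding dM_def by (rule hat_comp[OF lin(2,1,8) dif_hadd[OF D(1)]]) simp
  have k3: "shS' * hat N 0 h * hat M 0 g = hat M 1 (\<lambda>i j F. h (i + 0) j (g i j F))"
    unfolding shS_hat(2)[OF lin(3) tf_hadd[OF h], of 0 1, simplified]
    by (rule hat_comp[OF lin(2,3,7) tf_hadd[OF h]]) simp
  have d: "hadd M ((\<lambda>i j F. dif L (i + 0) j (\<rho> i j F)) - (\<lambda>i j F. h (i + 0) j (g i j F)))"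
    using a2(2,3) unfolding hadd_def by simp
  show "hat M 0 \<rho> * dM M = dM L * hat M 0 \<rho> - shS' * hat N 0 h * hat M 0 g"
    unfolding k1 k2 k3 hat_diff[OF lin(2) a2(2,3)]
    using cn by (subst hat_eq_iff[OF lin(2) a2(1) d]) (simp add: connecting_map_def)
qed

definition zero_mod :: "('b, 's, 'k) hmod" where
  "zero_mod = \<lparr>spc = (\<lambda>i j. {0}), dif = 0\<rparr>"

lemma zero_mod_comod: "F \<in> comod A zero_mod i j \<longleftrightarrow> F = 0"
proof
  assume F: "F \<in> comod A zero_mod i j"
  show "F = 0"
  proof (rule comod_eq_zeroI[OF F])
    fix v assume "v \<in> lists (bas A)"
    thus "(\<lambda>n. F n v) = 0" using comodD(2)[OF F] by (simp add: zero_mod_def fun_eq_iff)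
  qed
qed (use comod_zero[of zero_mod] in \<open>simp add: zero_mod_def is_subspace_def\<close>)

lemma zero_mod_tf: "zero_mod \<in> tf_modules A"
proof -
  have d: "dif zero_mod i j F = 0" for i j and F :: "('b, 'c, 'k) hcofree"
    by (simp add: zero_mod_def)
  have b: "(\<lambda>n u. id_bar A i 0 n u v) = (0 :: ('b, 'c, 'k) hcofree)" for i v
    by (simp add: id_bar_def fun_eq_iff)
  have hs: "m = 0" if "m \<in> hspc zero_mod p q" for m :: "nat \<Rightarrow> 'c \<Rightarrow> 'k" and p q
    using that by (auto simp: hspc_def zero_mod_def fun_eq_iff)
  have "sub_mod (zero_mod :: ('b, 'c, 'k) hmod)" by (simp add: zero_mod_def is_subspace_def)
  moreover have "codifferential A (zero_mod :: ('b, 'c, 'k) hmod)"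
    unfolding codifferential_def hlinear_def d
    by (auto simp: zero_mod_comod b hscale_simps coact_simps)
  moreover have "unital_module A (zero_mod :: ('b, 'c, 'k) hmod)"
    unfolding unital_module_def d corestr_simps by (auto dest!: hs simp: fun_eq_iff)
  ultimately show ?thesis unfolding tf_modules_def by blast
qed

lemma dg_model_Htf:
  "dg_model (Htf A) HmS eM dM shS shS' (shift_mod :: ('b, 's::infinite, 'k) hmod \<Rightarrow> _) shift_arr KL (semi_split_triangles A)"
proof -
  interpret B: dg_base "Htf A" HmS eM dM shS shS' "shift_mod :: ('b, 's, 'k) hmod \<Rightarrow> _" ZcS htpS coneS
    by (rule dg_base_Htf eq_reflection ZcS_def htpS_def coneS_def)+
  note ob = B.Zc_obj[unfolded Obj_Htf]
  have KL_cong: "KL X Y x = KL X Y y" if "htpS X Y x y" for X Y :: "('b, 's, 'k) hmod" and x y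
    unfolding KL_def using that B.htp_trans B.htp_sym by blast
  have KL_hat: "g \<in> tf_morphisms A X Y" "htpS X Y x (hat X 0 g)"
    if "g \<in> KL X Y x" for X Y :: "('b, 's, 'k) hmod" and x g
    using that unfolding KL_def by blast+
  have rep: "\<exists>g. g \<in> KL X Y x" if x: "x \<in> ZcS X Y" for X Y :: "('b, 's, 'k) hmod" and x
  proof -
    obtain g where "g \<in> tf_morphisms A X Y" "x = hat X 0 g" using x ZcS_iff[OF ob[OF x]] by blast
    thus ?thesis unfolding KL_def using B.htp_refl ob[OF x] by auto
  qed
  have KL_Z: "hat X 0 g \<in> ZcS X Y" if "g \<in> KL X Y x" "x \<in> ZcS X Y" for X Y :: "('b, 's, 'k) hmod" and x g
    using KL_hat(1)[OF that(1)] ZcS_iff[OF ob[OF that(2)]] by blast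
  \<comment> \<open>Composition and addition in \<open>Htf\<close> are unions over representatives.
    All members of such a union turn out to be the same class, and the union is nonempty by
    \<open>rep\<close>.\<close>
  have UN_eq: "(\<Union>g\<in>G. \<Union>f\<in>F. P g f) = c" if "\<exists>g. g \<in> G" "\<exists>f. f \<in> F" "\<And>g f. g \<in> G \<Longrightarrow> f \<in> F \<Longrightarrow> P g f = c"
    for G F :: "('b, 's, 'k) hmap set" and P and c :: "('b, 's, 'k) hmap set"
    using that by auto
  have kHom: "Hom (Htf A) X Y = KL X Y ` ZcS X Y" if "X \<in> Obj (Htf A)" "Y \<in> Obj (Htf A)" for X Y :: "('b, 's, 'k) hmod"
  proof -
    have t: "X \<in> tf_modules A" "Y \<in> tf_modules A" using that by auto
    have "hclass A X Y ` tf_morphisms A X Y = (\<lambda>f. KL X Y (hat X 0 f)) ` tf_morphisms A X Y"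
      by (rule image_cong[OF refl]) (rule hclass_KL[OF t tf_hadd])
    thus ?thesis unfolding ZcS_iff[OF t] image_image by (simp add: Htf_def)
  qed
  have kEq: "KL X Y f = KL X Y g \<longleftrightarrow> htpS X Y f g" if fg: "f \<in> ZcS X Y" "g \<in> ZcS X Y" for X Y :: "('b, 's, 'k) hmod" and f g
  proof
    assume "KL X Y f = KL X Y g"
    then obtain h where "h \<in> KL X Y f" "h \<in> KL X Y g" using rep[OF fg(2)] by blast
    thus "htpS X Y f g" using KL_hat(2) B.htp_trans B.htp_sym by blast
  qed (rule KL_cong)
  have kCmp: "Cmp (Htf A) X Y Z (KL Y Z g) (KL X Y f) = KL X Z (g * f)"
    if f: "f \<in> ZcS X Y" and g: "g \<in> ZcS Y Z" for X Y Z :: "('b, 's, 'k) hmod" and f g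
  proof -
    note t = ob[OF f] ob[OF g]
    have "hclass A X Z (hcomp g' f') = KL X Z (g * f)" if g': "g' \<in> KL Y Z g" and f': "f' \<in> KL X Y f" for g' f'
    proof -
      note h = KL_hat[OF f'] KL_hat[OF g']
      have c: "hat Y 0 g' * hat X 0 f' = hat X 0 (hcomp g' f')"
        using hat_comp[OF tfD(1)[OF t(1)] tfD(1)[OF t(2)] tf_morD(3)[OF h(1)] tf_hadd[OF h(3)], of 0]
        by (simp add: hcomp_def)
      have "hadd X (hcomp g' f')"
        using hlinear_hadd[OF hlinear_comp[OF tf_morD(3)[OF h(1)] tf_morD(3)[OF h(3)]]] by (simp add: hcomp_def)
      hence "hclass A X Z (hcomp g' f') = KL X Z (hat Y 0 g' * hat X 0 f')"
        unfolding c by (rule hclass_KL[OF t(1,4)])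
      also have "\<dots> = KL X Z (g * f)"
        using KL_cong[OF B.htp_trans[OF B.htp_right[OF h(4) f] B.htp_left[OF h(2) KL_Z[OF g' g]]]] by simp
      finally show ?thesis .
    qed
    thus ?thesis using UN_eq[OF rep[OF g] rep[OF f]] by (simp add: Htf_def)
  qed
  have kAdd: "Add (Htf A) X Y (KL X Y f) (KL X Y g) = KL X Y (f + g)"
    if f: "f \<in> ZcS X Y" and g: "g \<in> ZcS X Y" for X Y :: "('b, 's, 'k) hmod" and f g
  proof -
    note t = ob[OF f]
    have "hclass A X Y (f' + g') = KL X Y (f + g)" if f': "f' \<in> KL X Y f" and g': "g' \<in> KL X Y g" for g' f'
    proof -
      note h = KL_hat[OF f'] KL_hat[OF g']
      note a = hat_add[OF tfD(1)[OF t(1)] tf_hadd[OF h(1)] tf_hadd[OF h(3)]]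
      have "hclass A X Y (f' + g') = KL X Y (hat X 0 f' + hat X 0 g')"
        unfolding a(1) by (rule hclass_KL[OF t a(2)])
      also have "\<dots> = KL X Y (f + g)" using KL_cong[OF B.htp_add[OF h(2) h(4)]] by simp
      finally show ?thesis .
    qed
    thus ?thesis using UN_eq[OF rep[OF f] rep[OF g]] by (simp add: Htf_def)
  qed
  have kZer: "Zer (Htf A) X Y = KL X Y 0" if "X \<in> Obj (Htf A)" "Y \<in> Obj (Htf A)" for X Y :: "('b, 's, 'k) hmod"
  proof -
    have t: "X \<in> tf_modules A" "Y \<in> tf_modules A" using that by auto
    show ?thesis using hclass_KL[OF t hat_zero(2)] unfolding hat_zero(1)[OF tfD(1)[OF t(1)]] by (simp add: Htf_def)
  qed
  have kIdt: "Idt (Htf A) X = KL X X (eM X)" if "X \<in> Obj (Htf A)" for X :: "('b, 's, 'k) hmod"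
    using that hclass_KL[of X X, OF _ _ hlinear_hadd[OF comodule_mapD(1)[OF comodule_map_id]]]
    by (simp add: Htf_def eM_def)
  have ksh: "shift_arr (KL X Y f) = KL (shift_mod X) (shift_mod Y) (shS * f * shS')"
    if f: "f \<in> ZcS X Y" for X Y :: "('b, 's, 'k) hmod" and f
  proof -
    note t = ob[OF f]
    have m: "shift_map g \<in> KL (shift_mod X) (shift_mod Y) (shS * f * shS') \<longleftrightarrow> g \<in> KL X Y f" for g
    proof (cases "g \<in> tf_morphisms A X Y")
      case True
      have "shS * hat X 0 g * shS' = hat X (-1) g * shS'"
        using shS_hat(1)[OF tfD(1)[OF t(1)] tf_hadd[OF True], of "-1" 0] by simp
      also have "\<dots> = hat (shift_mod X) 0 (shift_map g)"
        by (rule hat_shS(1)[OF tfD(1)[OF t(1)] tf_hadd[OF True]]) simp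
      finally show ?thesis
        unfolding KL_def mem_Collect_eq tf_mor_shift[OF t(1)] using B.htp_sh[unfolded Obj_Htf, OF t, of f "hat X 0 g"] by simp
    next
      case False
      thus ?thesis unfolding KL_def mem_Collect_eq tf_mor_shift[OF t(1)] by simp
    qed
    show ?thesis unfolding shift_arr_def
    proof (intro equalityI subsetI)
      fix x assume x: "x \<in> KL (shift_mod X) (shift_mod Y) (shS * f * shS')"
      obtain g where g: "x = shift_map g" using shift_map_surj by blast
      thus "x \<in> shift_map ` KL X Y f" using x m by simp
    qed (use m in auto)
  qed
  have kZ0: "\<exists>Z\<in>Obj (Htf A). eM Z = (0 :: ('b, 's, 'k) hring)"
  proof (rule bexI)
    have s: "sub_mod (zero_mod :: ('b, 's, 'k) hmod)" using tfD(1)[OF zero_mod_tf] .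
    have "eM zero_mod = (hat zero_mod 0 0 :: ('b, 's, 'k) hring)"
      unfolding eM_def
      by (subst hat_eq_iff[OF s hlinear_hadd[OF comodule_mapD(1)[OF comodule_map_id]] hat_zero(2)]) (auto simp: zero_mod_comod)
    thus "eM zero_mod = (0 :: ('b, 's, 'k) hring)" using hat_zero(1)[OF s] by metis
  qed (simp add: zero_mod_tf)
  have kCone: "\<exists>K i j p q. coneS X Y u K i j p q \<and>
      (\<forall>X'\<in>Obj (Htf A). shift_mod X' = K \<longrightarrow> (\<exists>K' i' j' p' q'. coneS X' X (- (p * shS)) K' i' j' p' q' \<and>
         (X, K', K, KL X K' i', KL K' K (shS * p'), KL K (shift_mod X) (shS * p)) \<in> semi_split_triangles A))"
    if u: "u \<in> ZcS X Y" for X Y :: "('b, 's, 'k) hmod" and u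
  proof -
    note t = ob[OF u]
    obtain u0 where u0: "u0 \<in> tf_morphisms A X Y" "u = hat X 0 u0" using u ZcS_iff[OF t] by blast
    define K where "K = cone_mod X Y u0"
    have K: "K \<in> tf_modules A" unfolding K_def by (rule cone_tf[OF t u0(1)])
    note cm = cone_comodule_maps[OF t u0(1), folded K_def]
    note st = inl_lin[THEN strict_lmap]
    have ca: "hadd K (\<lambda>i j. lmap prr)" using hlinear_hadd[OF comodule_mapD(1)[OF cm(2)]] .
    have "\<exists>K' i' j' p' q'. coneS X' X (- (hat K 1 (\<lambda>i j. lmap prr) * shS)) K' i' j' p' q' \<and>
         (X, K', K, KL X K' i', KL K' K (shS * p'), KL K (shift_mod X) (shS * hat K 1 (\<lambda>i j. lmap prr))) \<in> semi_split_triangles A"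
      if X': "X' \<in> tf_modules A" "shift_mod X' = K" for X'
    proof -
      \<comment> \<open>The desuspended projection of the cone, negated. It is strict even if
        \<open>u0\<close> is not, so \<open>strict_cone_triangle\<close> applies to it.\<close>
      define v :: "('b, 's, 'k) hmap" where "v = - (\<lambda>i j. lmap prr)"
      have sm: "shift_map (\<lambda>i j. lmap prr) = ((\<lambda>i j. lmap prr) :: ('b, 's, 'k) hmap)" by (simp add: shift_map_def)
      have "comodule_map A X' X 0 (\<lambda>i j. lmap prr)"
        using cm(2) unfolding X'(2)[symmetric] by (subst (asm) sm[symmetric]) (simp add: comodule_map_shift_left)
      moreover have "lmap prr (dif X' i j F) = dif X i j (lmap prr F)" for i j F
      proof -
        have "lmap prr (dif K (i - 1) j F) = - dif X i j (lmap prr F)"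
          using cone_dif_proj(2)[OF t u0(1), folded K_def, of "i - 1" j F] by simp
        moreover have "dif K (i - 1) j F = - dif X' i j F"
          unfolding X'(2)[symmetric] shift_mod_simps by simp
        ultimately show ?thesis by (simp add: lmap_simps(2)[OF inl_lin(4)])
      qed
      ultimately have r: "(\<lambda>i j. lmap prr) \<in> tf_morphisms A X' X"
        by (intro tf_morI strict_unital[OF st(4)])
      hence v: "v \<in> tf_morphisms A X' X" unfolding v_def by (rule tf_mor_neg[OF X'(1) t(1)])
      have vs: "strict_map A X' v" using st(4)[of X'] unfolding v_def strict_map_def by (simp add: corestr_simps)
      have "hat K 1 (\<lambda>i j. lmap prr) * shS = hat X' 0 (\<lambda>i j. lmap prr)"
        using hat_shS(2)[OF tfD(1)[OF X'(1)] tf_hadd[OF r], of 1 0] unfolding X'(2) sm by simp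
      hence p: "- (hat K 1 (\<lambda>i j. lmap prr) * shS) = hat X' 0 v"
        unfolding v_def using hat_neg(1)[OF tfD(1)[OF X'(1)] tf_hadd[OF r]] by simp
      define K' where "K' = cone_mod X' X v"
      have K': "K' \<in> tf_modules A" unfolding K'_def by (rule cone_tf[OF X'(1) t(1) v])
      note cm' = cone_comodule_maps[OF X'(1) t(1) v, folded K'_def]
      note ca' = cm'[THEN comodule_mapD(1), THEN hlinear_hadd]
      have q: "shS * hat K 1 (\<lambda>i j. lmap prr) = hat K 0 (\<lambda>i j. lmap prr)"
        "shS * hat K' 1 (\<lambda>i j. lmap prr) = hat K' 0 (\<lambda>i j. lmap prr)"
        by (rule shS_hat(1)[OF tfD(1)[OF K] ca], simp) (rule shS_hat(1)[OF tfD(1)[OF K'] ca'(2)], simp)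
      \<comment> \<open>The sign in \<open>v\<close> cancels the sign of the connecting map, so the
        third arrow is the projection of the cone itself.\<close>
      have sv: "- shift_map v = (\<lambda>i j. lmap prr)" unfolding v_def by (simp add: shift_map_def fun_eq_iff)
      have sX: "shift_mod X \<in> tf_modules A" using t tf_shift by blast
      have "(X, K', K, hclass A X K' (\<lambda>i j. lmap inl), hclass A K' K (\<lambda>i j. lmap prr), hclass A K (shift_mod X) (\<lambda>i j. lmap prr))
          \<in> semi_split_triangles A"
        using strict_cone_triangle[OF X'(1) t(1) v vs] unfolding X'(2) sv K'_def .
      hence "(X, K', K, KL X K' (hat X 0 (\<lambda>i j. lmap inl)), KL K' K (shS * hat K' 1 (\<lambda>i j. lmap prr)),
          KL K (shift_mod X) (shS * hat K 1 (\<lambda>i j. lmap prr))) \<in> semi_split_triangles A"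
        unfolding q using hclass_KL[OF t(1) K' ca'(3)] hclass_KL[OF K' K ca'(2)] hclass_KL[OF K sX ca] by simp
      thus ?thesis unfolding p using cone_coneS[OF X'(1) t(1) v, folded K'_def] by blast
    qed
    thus ?thesis
      using cone_coneS[OF t u0(1), folded K_def u0(2)] unfolding Obj_Htf by blast
  qed
  have kSS: "\<exists>L M N f g \<rho> \<sigma> h. f \<in> ZcS L M \<and> g \<in> ZcS M N \<and> h \<in> ZcS N (shift_mod L) \<and>
      \<rho> \<in> HmS M L 0 \<and> \<sigma> \<in> HmS N M 0 \<and> \<rho> * f = eM L \<and> g * \<sigma> = eM N \<and> \<rho> * \<sigma> = 0 \<and> g * f = 0 \<and>
      f * \<rho> + \<sigma> * g = eM M \<and> \<rho> * dM M = dM L * \<rho> - shS' * h * g \<and>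
      T = (L, M, N, KL L M f, KL M N g, KL N (shift_mod L) h)"
    if T: "T \<in> semi_split_triangles A" for T :: "(('b, 's, 'k) hmod, ('b, 's, 'k) hmap set) triangle"
  proof -
    obtain L M N f g h \<rho> where T_eq: "T = (L, M, N, hclass A L M f, hclass A M N g, hclass A N (shift_mod L) h)"
      and ss: "semi_split A L M N f g \<rho>" and cn: "connecting_map A L M N g \<rho> h"
      using T unfolding semi_split_triangles_def by blast
    note D = ssD[OF ss]
    have h: "h \<in> tf_morphisms A N (shift_mod L)" using cn unfolding connecting_map_def by blast
    have sL: "shift_mod L \<in> tf_modules A" using D(1) tf_shift by blast
    have "T = (L, M, N, KL L M (hat L 0 f), KL M N (hat M 0 g), KL N (shift_mod L) (hat N 0 h))"
      unfolding T_eq using hclass_KL[OF D(1,2) tf_hadd[OF D(4)]] hclass_KL[OF D(2,3) tf_hadd[OF D(6)]]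
        hclass_KL[OF D(3) sL tf_hadd[OF h]] by simp
    thus ?thesis using semi_split_splitting[OF ss cn] by blast
  qed
  show ?thesis
  proof (rule dg_model.intro[OF dg_base_Htf dg_model_axioms.intro], goal_cases)
    case 1 thus ?case by (rule kHom[unfolded ZcS_def])
  next
    case 2 thus ?case by (rule kEq[unfolded ZcS_def htpS_def])
  next
    case 3 thus ?case by (rule kCmp[unfolded ZcS_def])
  next
    case 4 thus ?case by (rule kAdd[unfolded ZcS_def])
  next
    case 5 thus ?case by (rule kZer)
  next
    case 6 thus ?case by (rule kIdt)
  next
    case 7 thus ?case by (rule ksh[unfolded ZcS_def])
  next
    case 8 show ?case by (rule kZ0)
  next
    case 9 thus ?case by (rule kCone[unfolded ZcS_def coneS_def])
  next
    case 10 thus ?case by (rule kSS[unfolded ZcS_def])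
  qed
qed

theorem Htf_triangulated:
  "triangulated_category (Htf A :: (('b, 's::infinite, 'k) hmod, ('b, 's, 'k) hmap set) addcat)
     shift_mod shift_arr (distinguished A)"
  using dg_model.triangulated[OF dg_model_Htf]
  unfolding dg_model.Dist_def[OF dg_model_Htf] distinguished_def .

end

theorem theorem8:
  fixes d :: nat
    and P :: "nat \<Rightarrow> nat \<Rightarrow> 'k::real_normed_field mpol"
    and UA :: "nat \<Rightarrow> 'k mpol \<Rightarrow> 'k mpol \<Rightarrow> 'k mpol"
    and UB :: "nat \<Rightarrow> (nat set \<Rightarrow>\<^sub>0 'k) \<Rightarrow> (nat set \<Rightarrow>\<^sub>0 'k) \<Rightarrow> (nat set \<Rightarrow>\<^sub>0 'k)"
  assumes "quadratic_bivector d P"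
    and "poisson_bivector d P"
    and "hbar_algebra (sym_quant d UA)" and "sym_quantizes d P UA"
    and "hbar_algebra (ext_quant d UB)" and "ext_quantizes d P UB"
  shows "triangulated_category
           (Htf (sym_quant d UA) ::
             ((nat \<Rightarrow>\<^sub>0 nat, 's::infinite, 'k) hmod, (nat \<Rightarrow>\<^sub>0 nat, 's, 'k) hmap set) addcat)
           shift_mod shift_arr (distinguished (sym_quant d UA))
       \<and> triangulated_category
           (Htf (ext_quant d UB) ::
             ((nat set, 't::infinite, 'k) hmod, (nat set, 't, 'k) hmap set) addcat)
           shift_mod shift_arr (distinguished (ext_quant d UB))"
proof -
  \<comment> \<open>The units are the constant monomial and the empty subset, both of bidegree
    \<open>(0, 0)\<close>.\<close>
  have "halg_ctxt (sym_quant d UA)"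
    by standard (simp_all add: sym_quant_def monomials_def mon_deg_def)
  moreover have "halg_ctxt (ext_quant d UB)"
    by standard (simp_all add: ext_quant_def)
  ultimately show ?thesis by (intro conjI halg_ctxt.Htf_triangulated)
qed

end
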